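(* Let $T$ be any one of the three sets $\left(-\frac{13}{23},-\frac7{23}\right)\cup\left(-\frac1{23},\frac5{23}\right)$, $\left(-\frac{13}{23},-\frac7{23}\right)\cup\left(\frac5{23},\frac{11}{23}\right)$, $\left(-\frac7{23},-\frac1{23}\right)\cup\left(\frac5{23},\frac{11}{23}\right)$. Let $h$ be absolutely monotone with $h^{(6)}>0$ in $(-1,1)$, and let $C\subset\mathbb{S}^{22}$ be a $T$-avoiding spherical code with $|C|=48600$. Then $$E_h(C)\ \ge\ \mathcal{E}_h(23,48600;T)=48600\left(506\,h\!\left(-\tfrac{13}{23}\right)+8855\,h\!\left(-\tfrac7{23}\right)+23046\,h\!\left(-\tfrac1{23}\right)+14421\,h\!\left(\tfrac5{23}\right)+1771\,h\!\left(\tfrac{11}{23}\right)\right).$$ Equality $E_h(C)=\mathcal{E}_h(23,48600;T)$ is attained when $C$ is a spherical $5$-design with $I(C)=\{-\frac{13}{23},-\frac7{23},-\frac1{23},\frac5{23},\frac{11}{23}\}$ (hence a distance-invariant code) and with distance distribution $(506,8855,23046,14421,1771)$. In particular, the code $C_{\sqrt6/12}$ is a $T$-avoiding universally optimal code on $\mathbb{S}^{22}$.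
   Context: A spherical code is a finite set $C\subset\mathbb{S}^{n-1}$; $I(C)=\{x\cdot y: x,y\in C,\ x\ne y\}$. For $T\subset[-1,1)$, $C$ is $T$-avoiding if $I(C)\cap T=\varnothing$. A spherical $\tau$-design is a spherical code $C$ such that the average over $C$ of every polynomial in $n$ variables of total degree at most $\tau$ equals its average over $\mathbb{S}^{n-1}$ with respect to normalized surface measure. A potential is a function $h:[-1,1)\to(-\infty,+\infty)$, continuous on $[-1,1)$; it is absolutely monotone if $h^{(j)}\ge0$ for all $j\ge1$ (on $(-1,1)$). The $h$-energy is $E_h(C)=\sum_{x\neq y\in C}h(x\cdot y)$ (sum over ordered pairs). $\mathcal{E}_h(n,N;T)$ is the minimum of $E_h(C)$ over all $T$-avoiding spherical codes $C\subset\mathbb{S}^{n-1}$ with $|C|=N$. For $T$ open, a code $C\subset\mathbb{S}^{n-1}$ is $T$-avoiding universally optimal if it is $T$-avoiding and, for every absolutely monotone $h$, it minimizes $E_h$ among all $T$-avoiding codes on $\mathbb{S}^{n-1}$ of cardinality $|C|$. A code $C$ is distance invariant if for each $t\in I(C)$ the number $A_t=|\{y\in C: x\cdot y=t\}|$ does not depend on $x\in C$; its distance distribution is the tuple $(A_t)$ listed in increasing order of $t\in I(C)$. The code $C_{\sqrt6/12}$: let $L\subset\mathbb{S}^{23}$ be the set of the $196560$ minimal vectors (length $2$) of the Leech lattice $\Lambda_{24}$ (the even unimodular lattice in $\mathbb{R}^{24}$ of minimum norm $4$) rescaled to unit length. Let $W\in\Lambda_{24}$ be a vector of length $\sqrt6$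 and $\widetilde w=W/\sqrt6$. With $\alpha=\frac{\sqrt6}{12}$, $C_{\sqrt6/12}$ is the set of vectors $(y-\alpha\widetilde w)/\sqrt{1-\alpha^2}$ with $y\in L$, $y\cdot\widetilde w=\alpha$, regarded as a subset of the unit sphere $\mathbb{S}^{22}$ of $\widetilde w^\perp\cong\mathbb{R}^{23}$. It is a spherical $5$-design with $48600$ points, with the inner products and distance distribution listed in the claim. *)

theory Defs
  imports "HOL-Analysis.Analysis"
begin

section \<open>Spherical codes and energy\<close>

text \<open>Codes on the unit sphere of \<open>n\<close>-space are subsets of a Euclidean space of dimension \<open>n\<close>,
  so \<open>n\<close> is determined by the type (e.g. \<open>real ^ 23\<close>).\<close>

definition spherical_code :: "'a::euclidean_space set \<Rightarrow> bool" where
  "spherical_code C \<longleftrightarrow> finite C \<and> C \<subseteq> sphere 0 1"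

definition inner_products :: "'a::euclidean_space set \<Rightarrow> real set" where
  "inner_products C = {x \<bullet> y | x y. x \<in> C \<and> y \<in> C \<and> x \<noteq> y}"

definition avoiding :: "real set \<Rightarrow> 'a::euclidean_space set \<Rightarrow> bool" where
  "avoiding T C \<longleftrightarrow> inner_products C \<inter> T = {}"

text \<open>Potentials are functions on \<open>[-1,1)\<close>; values of \<open>h\<close> outside this interval are never used.\<close>

definition potential :: "(real \<Rightarrow> real) \<Rightarrow> bool" where
  "potential h \<longleftrightarrow> continuous_on {-1..<1} h"

definition absolutely_monotone :: "(real \<Rightarrow> real) \<Rightarrow> bool" where
  "absolutely_monotone h \<longleftrightarrow> potential h \<and>
     (\<forall>j. \<forall>t\<in>{-1<..<1}. (deriv ^^ j) h field_differentiable (at t)) \<and>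
     (\<forall>j\<ge>1. \<forall>t\<in>{-1<..<1}. (deriv ^^ j) h t \<ge> 0)"

definition energy :: "(real \<Rightarrow> real) \<Rightarrow> 'a::euclidean_space set \<Rightarrow> real" where
  "energy h C = (\<Sum>x\<in>C. \<Sum>y\<in>C - {x}. h (x \<bullet> y))"

definition avoiding_codes :: "real set \<Rightarrow> nat \<Rightarrow> 'a::euclidean_space set set" where
  "avoiding_codes T N = {C. spherical_code C \<and> avoiding T C \<and> card C = N}"

text \<open>The type argument carries the dimension \<open>n\<close> of \<open>\<E>\<^sub>h(n,N;T)\<close>. The value is meaningful only
  if the minimum exists.\<close>

definition min_energy ::
    "'a::euclidean_space itself \<Rightarrow> (real \<Rightarrow> real) \<Rightarrow> nat \<Rightarrow> real set \<Rightarrow> real" where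
  "min_energy _ h N T = (LEAST e. e \<in> energy h ` (avoiding_codes T N :: 'a set set))"

definition universally_optimal :: "real set \<Rightarrow> 'a::euclidean_space set \<Rightarrow> bool" where
  "universally_optimal T C \<longleftrightarrow> spherical_code C \<and> avoiding T C \<and>
     (\<forall>h. absolutely_monotone h \<longrightarrow>
        (\<forall>D\<in>avoiding_codes T (card C). energy h C \<le> energy h (D :: 'a set)))"


section \<open>Spherical designs\<close>

text \<open>A monomial is given by its exponents \<open>e b\<close> with respect to the coordinates \<open>x \<bullet> b\<close>.\<close>

definition polynomials_upto :: "nat \<Rightarrow> ('a::euclidean_space \<Rightarrow> real) set" where
  "polynomials_upto d =
     {p. \<exists>(E :: ('a \<Rightarrow> nat) set) c. finite E \<and> (\<forall>e\<in>E. (\<Sum>b\<in>Basis. e b) \<le> d) \<and>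
           p = (\<lambda>x. \<Sum>e\<in>E. c e * (\<Prod>b\<in>Basis. (x \<bullet> b) ^ e b))}"

text \<open>The normalized surface measure of a subset of the unit sphere is the proportion of the unit
  ball taken up by the cone over it, i.e. the measure is the radial projection of the uniform
  distribution on the ball. (The origin is a null set.)\<close>

definition sphere_measure :: "'a::euclidean_space measure" where
  "sphere_measure = distr (uniform_measure lborel (ball 0 1)) borel (\<lambda>x. x /\<^sub>R norm x)"

definition spherical_design :: "nat \<Rightarrow> 'a::euclidean_space set \<Rightarrow> bool" where
  "spherical_design d C \<longleftrightarrow> spherical_code C \<and>
     (\<forall>p\<in>polynomials_upto d. (\<Sum>x\<in>C. p x) / real (card C) = (LINT x|sphere_measure. p x))"

definition distance_invariant :: "'a::euclidean_space set \<Rightarrow> bool" where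
  "distance_invariant C \<longleftrightarrow>
     (\<forall>t\<in>inner_products C. \<exists>A. \<forall>x\<in>C. card {y \<in> C. x \<bullet> y = t} = A)"

text \<open>Meaningful for distance invariant codes only.\<close>

definition distance_distribution :: "'a::euclidean_space set \<Rightarrow> nat list" where
  "distance_distribution C =
     map (\<lambda>t. THE A. \<forall>x\<in>C. card {y \<in> C. x \<bullet> y = t} = A) (sorted_list_of_set (inner_products C))"


section \<open>The Leech lattice and the derived code\<close>

definition full_rank_lattice :: "'a::euclidean_space set \<Rightarrow> bool" where
  "full_rank_lattice \<Lambda> \<longleftrightarrow> (\<exists>B. independent B \<and> span B = UNIV \<and>
     \<Lambda> = {(\<Sum>b\<in>B. of_int (c b) *\<^sub>R b) | c :: 'a \<Rightarrow> int. True})"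

definition dual_lattice :: "'a::euclidean_space set \<Rightarrow> 'a set" where
  "dual_lattice \<Lambda> = {x. \<forall>y\<in>\<Lambda>. x \<bullet> y \<in> \<int>}"

definition even_unimodular_lattice :: "'a::euclidean_space set \<Rightarrow> bool" where
  "even_unimodular_lattice \<Lambda> \<longleftrightarrow> full_rank_lattice \<Lambda> \<and> dual_lattice \<Lambda> = \<Lambda> \<and>
     (\<forall>x\<in>\<Lambda>. \<exists>k::int. x \<bullet> x = 2 * of_int k)"

text \<open>The norm of a lattice vector is its squared length \<open>x \<bullet> x\<close>. The conditions determine the
  lattice up to isometry, so the Leech lattice is treated as a predicate.\<close>

definition leech_lattice :: "(real ^ 24) set \<Rightarrow> bool" where
  "leech_lattice \<Lambda> \<longleftrightarrow> even_unimodular_lattice \<Lambda> \<and>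
     (\<forall>x\<in>\<Lambda> - {0}. x \<bullet> x \<ge> 4) \<and> (\<exists>x\<in>\<Lambda>. x \<bullet> x = 4)"

definition leech_kissing_code :: "(real ^ 24) set \<Rightarrow> (real ^ 24) set" where
  "leech_kissing_code \<Lambda> = {x /\<^sub>R 2 | x. x \<in> \<Lambda> \<and> norm x = 2}"

text \<open>The code \<open>C\<close> with parameter \<open>\<alpha> = sqrt 6 / 12\<close>, inside the hyperplane orthogonal to \<open>W\<close>.\<close>

definition leech_slice_code :: "(real ^ 24) set \<Rightarrow> real ^ 24 \<Rightarrow> (real ^ 24) set" where
  "leech_slice_code \<Lambda> W =
     (let w = W /\<^sub>R sqrt 6; \<alpha> = sqrt 6 / 12 in
       {(y - \<alpha> *\<^sub>R w) /\<^sub>R sqrt (1 - \<alpha>\<^sup>2) | y. y \<in> leech_kissing_code \<Lambda> \<and> y \<bullet> w = \<alpha>})"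

text \<open>Identification of \<open>\<real>\<^sup>2\<^sup>3\<close> with the orthogonal complement of \<open>W\<close> by a linear isometry.\<close>

definition complement_isometry :: "real ^ 24 \<Rightarrow> (real ^ 23 \<Rightarrow> real ^ 24) \<Rightarrow> bool" where
  "complement_isometry W \<phi> \<longleftrightarrow> linear \<phi> \<and> (\<forall>x. norm (\<phi> x) = norm x) \<and> range \<phi> = {v. v \<bullet> W = 0}"

end

(*
Lower bound: interpolate h in Newton form at the five inner products, with one node doubled so that
the nodal product of degree 6 is nonnegative off T.  The interpolant then minorizes h, its
nonconstant Newton coefficients are divided differences of h and so nonnegative, and each Newton
product, expanded in Gegenbauer polynomials, satisfies the bound.

Slice of the Leech lattice: that the shells have isotropic even moments up to degree 10 follows
without harmonic polynomials.  By Poisson summation, the difference of the theta series weighted by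
(y . u)^(2m) and (y . v)^(2m), for unit vectors u and v, transforms like a modular form of weight
12 + 2m <= 22; as the lattice has no vectors of norm 2, its first two coefficients are zero, which
forces such a form to vanish.  The moments determine the inner product distribution of the slice.
*)
theory Submission imports Defs "HOL-Probability.Probability" "HOL-Complex_Analysis.Complex_Analysis" begin

text \<open>The sets \<open>T\<close> enter only through the sign of the nodal product. Doubling one
  of five nodes leaves four simple ones; they pair off into neighbours among the five exactly when
  the first, third or fifth node is doubled, and \<open>T\<close> is the union of the two gaps
  between paired neighbours. As \<open>min_energy\<close> is a LEAST, its value requires a code that
  attains the bound. Hence a Leech lattice with a vector of norm 6 is constructed, from an explicit
  basis. Moments of degree 10 = 4 + 6 arise as follows: the five multiplicities in the slice need
  power sums up to degree 4, and an even polynomial that isolates the inner products 1 and -1 with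
  \<open>W\<close> among -3, ..., 3 has degree 6. The weight 22 lies just below 24, where the square
  of the discriminant form is a nonzero form whose first two coefficients vanish. A single weighted
  theta series is not modular, since lower moments occur in its transformation. Only the difference
  for two directions is, once the lower moments are known to be isotropic, so the argument is an
  induction on the degree.\<close>

section \<open>The linear programming bound\<close>

text \<open>Rescaled Gegenbauer polynomials in dimension \<open>d\<close>, homogenised: at vectors \<open>x\<close>, \<open>y\<close> the arguments are
  \<open>t = x \<bullet> y\<close> and \<open>q = \<bar>x\<bar>\<^sup>2 \<bar>y\<bar>\<^sup>2\<close>.\<close>

definition gegen :: "nat \<Rightarrow> real \<Rightarrow> real \<Rightarrow> real \<Rightarrow> real" where
  "gegen n d t q = [1, t, d * t^2 - q, (d + 2) * t^3 - 3 * t * q,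
     (d + 4) * (d + 2) * t^4 - 6 * (d + 2) * t^2 * q + 3 * q^2,
     (d + 6) * (d + 4) * t^5 - 10 * (d + 4) * t^3 * q + 15 * t * q^2] ! n"

lemma gegen_simps:
  "gegen 0 d t q = 1" "gegen (Suc 0) d t q = t" "gegen 2 d t q = d * t^2 - q"
  "gegen 3 d t q = (d + 2) * t^3 - 3 * t * q"
  "gegen 4 d t q = (d + 4) * (d + 2) * t^4 - 6 * (d + 2) * t^2 * q + 3 * q^2"
  "gegen 5 d t q = (d + 6) * (d + 4) * t^5 - 10 * (d + 4) * t^3 * q + 15 * t * q^2"
  by (simp_all add: gegen_def numeral_eq_Suc)

text \<open>This is the addition theorem for splitting off one coordinate: \<open>a\<close>,
  \<open>b\<close> are the last coordinates of two vectors with squared lengths \<open>X\<close>,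
  \<open>Y\<close>, and \<open>t\<close> is the inner product of their projections. The factor
  \<open>L\<close> clears denominators. What matters is that \<open>e\<close> is nonnegative and
  that the other factors separate the two vectors, so that they can be absorbed into
  weights.\<close>

lemma gegen_addition:
  fixes d :: real
  assumes "d \<ge> 1" "k \<le> 5"
  shows "\<exists>L>0. \<exists>e u. (\<forall>j. e j \<ge> 0) \<and> (\<forall>t a b X Y. L * gegen k (d + 1) (t + a * b) (X * Y) =
    (\<Sum>j\<le>k. e j * (u j a X * u j b Y) * gegen j d t ((X - a^2) * (Y - b^2))))"
proof -
  \<comment> \<open>The factor belonging to \<open>j\<close> is the polynomial of degree
    \<open>k - j\<close> for the dimension raised by \<open>2 * j\<close>.\<close>
  define u where "u = (\<lambda>j. gegen (k - j) (d + 1 + 2 * real j))"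
  \<comment> \<open>The coefficients are given as a list and extended by 0 beyond \<open>k\<close>,
    since \<open>e\<close> has to be nonnegative everywhere.\<close>
  have wit: ?thesis if "L > 0" "\<And>x. x \<in> set es \<Longrightarrow> x \<ge> 0" "length es = Suc k"
    "\<And>t a b X Y. L * gegen k (d + 1) (t + a * b) (X * Y) =
      (\<Sum>j\<le>k. es ! j * (u j a X * u j b Y) * gegen j d t ((X - a^2) * (Y - b^2)))" for L es
    using that
    by (intro exI[of _ L] conjI exI[of _ "\<lambda>j. if j \<le> k then es ! j else 0"] exI[of _ u]) auto
  consider "k = 0" | "k = 1" | "k = 2" | "k = 3" | "k = 4" | "k = 5" using assms(2) by linarith
  then show ?thesis
  proof cases
    case 1 show ?thesis by (rule wit[of 1 "[1]"]) (use 1 in \<open>auto simp: u_def gegen_simps\<close>)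
  next
    case 2
    have sets: "{..1::nat} = {0,1}" by auto
    show ?thesis
    proof (intro wit[of "1::real" "[1::real, 1]"])
      show "(1::real) > 0" using assms by simp
      show "x \<ge> 0" if "x \<in> set [1::real, 1]" for x using that assms by auto
      show "length [1::real, 1] = Suc k" using 2 by simp
      fix t a b X Y
      show "1 * gegen k (d + 1) (t + a * b) (X * Y) =
        (\<Sum>j\<le>k. [1, 1] ! j * (u j a X * u j b Y) * gegen j d t ((X - a^2) * (Y - b^2)))"
        unfolding 2 sets u_def by (simp add: 2 gegen_simps algebra_simps)
    qed
  next
    case 3
    have sets: "{..2::nat} = {0,1,2}" by auto
    \<comment> \<open>Here and in the remaining cases the list holds the coefficients multiplied by
      their common denominator, so that the identity is polynomial in all variables.\<close>
    show ?thesis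
    proof (intro wit[of "d" "[1, 2*d*(d+1), d+1]"])
      show "d > 0" using assms by simp
      show "x \<ge> 0" if "x \<in> set [1, 2*d*(d+1), d+1]" for x using that assms by auto
      show "length [1, 2*d*(d+1), d+1] = Suc k" using 3 by simp
      fix t a b X Y
      show "d * gegen k (d + 1) (t + a * b) (X * Y) =
        (\<Sum>j\<le>k. [1, 2*d*(d+1), d+1] ! j * (u j a X * u j b Y) * gegen j d t ((X - a^2) * (Y - b^2)))"
        unfolding 3 sets u_def by (simp add: 3 gegen_simps add.assoc) algebra
    qed
  next
    case 4
    have sets: "{..3::nat} = {0,1,2,3}" by auto
    show ?thesis
    proof (intro wit[of "d*(d+2)" "[d+2, 3*d, 3*(d+2)*(d+3), d*(d+3)]"])
      show "d*(d+2) > 0" using assms by simp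
      show "x \<ge> 0" if "x \<in> set [d+2, 3*d, 3*(d+2)*(d+3), d*(d+3)]" for x using that assms by auto
      show "length [d+2, 3*d, 3*(d+2)*(d+3), d*(d+3)] = Suc k" using 4 by simp
      fix t a b X Y
      show "d*(d+2) * gegen k (d + 1) (t + a * b) (X * Y) =
        (\<Sum>j\<le>k. [d+2, 3*d, 3*(d+2)*(d+3), d*(d+3)] ! j * (u j a X * u j b Y) * gegen j d t ((X - a^2) * (Y - b^2)))"
        unfolding 4 sets u_def by (simp add: 4 gegen_simps add.assoc) algebra
    qed
  next
    case 5
    have sets: "{..4::nat} = {0,1,2,3,4}" by auto
    show ?thesis
    proof (intro wit[of "d*(d+2)*(d+4)" "[d+4, 4*d*(d+3)*(d+4), 6*(d+3)*(d+2), 4*d*(d+4)*(d+5)*(d+3), d*(d+5)*(d+3)]"])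
      show "d*(d+2)*(d+4) > 0" using assms by simp
      show "x \<ge> 0" if "x \<in> set [d+4, 4*d*(d+3)*(d+4), 6*(d+3)*(d+2), 4*d*(d+4)*(d+5)*(d+3), d*(d+5)*(d+3)]" for x using that assms by auto
      show "length [d+4, 4*d*(d+3)*(d+4), 6*(d+3)*(d+2), 4*d*(d+4)*(d+5)*(d+3), d*(d+5)*(d+3)] = Suc k" using 5 by simp
      fix t a b X Y
      show "d*(d+2)*(d+4) * gegen k (d + 1) (t + a * b) (X * Y) =
        (\<Sum>j\<le>k. [d+4, 4*d*(d+3)*(d+4), 6*(d+3)*(d+2), 4*d*(d+4)*(d+5)*(d+3), d*(d+5)*(d+3)] ! j * (u j a X * u j b Y) * gegen j d t ((X - a^2) * (Y - b^2)))"
        unfolding 5 sets u_def by (simp add: 5 gegen_simps add.assoc) algebra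
    qed
  next
    case 6
    have sets: "{..5::nat} = {0,1,2,3,4,5}" by auto
    show ?thesis
    proof (intro wit[of "d*(d+2)*(d+4)*(d+6)" "[(d+4)*(d+6), 5*d*(d+6), 10*(d+5)*(d+2)*(d+6), 10*(d+5)*d*(d+4), 5*(d+7)*(d+5)*d*(d+6), (d+7)*(d+5)*d*(d+2)]"])
      show "d*(d+2)*(d+4)*(d+6) > 0" using assms by simp
      show "x \<ge> 0" if "x \<in> set [(d+4)*(d+6), 5*d*(d+6), 10*(d+5)*(d+2)*(d+6), 10*(d+5)*d*(d+4), 5*(d+7)*(d+5)*d*(d+6), (d+7)*(d+5)*d*(d+2)]" for x using that assms by auto
      show "length [(d+4)*(d+6), 5*d*(d+6), 10*(d+5)*(d+2)*(d+6), 10*(d+5)*d*(d+4), 5*(d+7)*(d+5)*d*(d+6), (d+7)*(d+5)*d*(d+2)] = Suc k" using 6 by simp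
      fix t a b X Y
      show "d*(d+2)*(d+4)*(d+6) * gegen k (d + 1) (t + a * b) (X * Y) =
        (\<Sum>j\<le>k. [(d+4)*(d+6), 5*d*(d+6), 10*(d+5)*(d+2)*(d+6), 10*(d+5)*d*(d+4), 5*(d+7)*(d+5)*d*(d+6), (d+7)*(d+5)*d*(d+2)] ! j * (u j a X * u j b Y) * gegen j d t ((X - a^2) * (Y - b^2)))"
        unfolding 6 sets u_def by (simp add: 6 gegen_simps add.assoc) algebra
    qed
  qed
qed

text \<open>Schoenberg's positive definiteness, by induction on the dimension. The weights
  \<open>w\<close> are arbitrary because each step multiplies them by the factors \<open>u j\<close>
  of the addition theorem. The vectors have arbitrary length because dropping a coordinate changes
  the length, which is why \<open>gegen\<close> is homogenised.\<close>

lemma gegen_posdef_coords: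
  fixes w :: "'b \<Rightarrow> real" and X :: "'b \<Rightarrow> nat \<Rightarrow> real"
  assumes "n \<ge> 1" "k \<le> 5"
  shows "0 \<le> (\<Sum>a\<in>D. \<Sum>b\<in>D. w a * w b * gegen k (real n) (\<Sum>i<n. X a i * X b i)
    ((\<Sum>i<n. (X a i)^2) * (\<Sum>i<n. (X b i)^2)))"
  using assms
proof (induction n arbitrary: k w rule: nat_induct_at_least)
  case base
  have sq: "(\<Sum>a\<in>D. \<Sum>b\<in>D. w a * w b * (v a * v b)) = (\<Sum>a\<in>D. w a * v a)^2" for v :: "'b \<Rightarrow> real"
    by (simp add: power2_eq_square sum_product algebra_simps)
  \<comment> \<open>On a line \<open>q = t^2\<close>, where all polynomials of degree at least 2
    vanish: harmonic polynomials in one variable have degree at most 1.\<close>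
  have eq: "gegen k 1 (x * y) (x^2 * y^2) = (if k = 0 then 1 else if k = 1 then x * y else 0)" for x y :: real
  proof -
    consider "k = 0" | "k = 1" | "k = 2" | "k = 3" | "k = 4" | "k = 5" using base by linarith
    then show ?thesis
      by (cases, simp_all add: gegen_simps power_mult_distrib flip: power_Suc power_add power_mult, simp_all add: eval_nat_numeral algebra_simps)
  qed
  have "(\<Sum>a\<in>D. \<Sum>b\<in>D. w a * w b * (if k = 0 then 1 else if k = 1 then X a 0 * X b 0 else 0)) \<ge> 0"
  proof -
    consider "k = 0" | "k = 1" | "k > 1" by linarith
    then show ?thesis using sq[of "\<lambda>_. 1"] sq[of "\<lambda>a. X a 0"] by cases simp_all
  qed
  then show ?case by (simp add: eq)
next
  case (Suc n)
  obtain L e u where L: "L > 0" and e: "\<And>j. e j \<ge> (0::real)" and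
    eq: "\<And>t a b X Y. L * gegen k (real n + 1) (t + a * b) (X * Y) =
      (\<Sum>j\<le>k. e j * (u j a X * u j b Y) * gegen j (real n) t ((X - a^2) * (Y - b^2)))"
    using gegen_addition[of "real n" k] Suc by auto
  define Q where "Q = (\<lambda>a m. \<Sum>i<m. (X a i)^2)"
  have "L * (\<Sum>a\<in>D. \<Sum>b\<in>D. w a * w b * gegen k (real (Suc n)) (\<Sum>i<Suc n. X a i * X b i) (Q a (Suc n) * Q b (Suc n)))
    = (\<Sum>a\<in>D. \<Sum>b\<in>D. w a * w b * (L * gegen k (real n + 1) ((\<Sum>i<n. X a i * X b i) + X a n * X b n) (Q a (Suc n) * Q b (Suc n))))"
    by (simp add: sum_distrib_left algebra_simps)
  also have "\<dots> = (\<Sum>a\<in>D. \<Sum>b\<in>D. \<Sum>j\<le>k. e j * ((w a * u j (X a n) (Q a (Suc n))) * (w b * u j (X b n) (Q b (Suc n)))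
       * gegen j (real n) (\<Sum>i<n. X a i * X b i) (Q a n * Q b n)))"
    unfolding eq by (simp add: sum_distrib_left Q_def algebra_simps)
  also have "\<dots> = (\<Sum>j\<le>k. e j * (\<Sum>a\<in>D. \<Sum>b\<in>D. (w a * u j (X a n) (Q a (Suc n))) * (w b * u j (X b n) (Q b (Suc n)))
       * gegen j (real n) (\<Sum>i<n. X a i * X b i) (Q a n * Q b n)))"
    by (simp add: sum_distrib_left sum.swap[of _ "{..k}"])
  also have "\<dots> \<ge> 0"
  proof (rule sum_nonneg)
    fix j assume "j \<in> {..k}"
    then have "j \<le> 5" using Suc.prems by simp
    from mult_nonneg_nonneg[OF e Suc.IH[OF this, of "\<lambda>a. w a * u j (X a n) (Q a (Suc n))"]]
    show "0 \<le> e j * (\<Sum>a\<in>D. \<Sum>b\<in>D. (w a * u j (X a n) (Q a (Suc n))) * (w b * u j (X b n) (Q b (Suc n)))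
       * gegen j (real n) (\<Sum>i<n. X a i * X b i) (Q a n * Q b n))"
      unfolding Q_def .
  qed
  finally show ?case using L by (simp add: zero_le_mult_iff Q_def)
qed

lemma gegen_posdef:
  fixes D :: "'a::euclidean_space set"
  assumes "D \<subseteq> sphere 0 1" "k \<le> 5"
  shows "0 \<le> (\<Sum>x\<in>D. \<Sum>y\<in>D. gegen k (real DIM('a)) (x \<bullet> y) 1)"
proof -
  obtain e where e: "bij_betw e {..<DIM('a)} (Basis :: 'a set)"
    using bij_betw_from_nat_into_finite[OF finite_Basis] by blast
  have ip: "(\<Sum>i<DIM('a). (x \<bullet> e i) * (y \<bullet> e i)) = x \<bullet> y" for x y :: 'a
    using sum.reindex_bij_betw[OF e, of "\<lambda>b. (x \<bullet> b) * (y \<bullet> b)"] by (simp add: euclidean_inner[of x y])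
  have nm: "(\<Sum>i<DIM('a). (x \<bullet> e i)^2) = 1" if "x \<in> D" for x
    using ip[of x x] that assms(1) by (auto simp: power2_eq_square norm_eq_1)
  have "0 \<le> (\<Sum>x\<in>D. \<Sum>y\<in>D. 1 * 1 * gegen k (real DIM('a)) (\<Sum>i<DIM('a). (x \<bullet> e i) * (y \<bullet> e i))
     ((\<Sum>i<DIM('a). (x \<bullet> e i)^2) * (\<Sum>i<DIM('a). (y \<bullet> e i)^2)))"
    using assms(2) by (intro gegen_posdef_coords) (auto simp: Suc_leI)
  also have "\<dots> = (\<Sum>x\<in>D. \<Sum>y\<in>D. gegen k (real DIM('a)) (x \<bullet> y) 1)"
    by (intro sum.cong refl) (simp add: ip nm)
  finally show ?thesis .
qed

section \<open>Zeros of successive derivatives\<close>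

lemma Rolle_zeros:
  fixes f f' :: "real \<Rightarrow> real"
  assumes "finite Z" "Z \<noteq> {}" "Z \<subseteq> {a<..<b}"
    and der: "\<And>x. x \<in> {a<..<b} \<Longrightarrow> (f has_real_derivative f' x) (at x)"
    and "\<And>z. z \<in> Z \<Longrightarrow> f z = 0"
  shows "\<exists>Z'. finite Z' \<and> Suc (card Z') = card Z \<and> Z' \<inter> Z = {} \<and> Z' \<subseteq> {a<..<b} \<and>
    (\<forall>z\<in>Z'. f' z = 0 \<and> z < Max Z)"
  using assms(1,2,3,5)
proof (induction Z rule: finite_linorder_max_induct)
  case empty then show ?case by simp
next
  case (insert c Z)
  show ?case
  proof (cases "Z = {}")
    case True then show ?thesis by (intro exI[of _ "{}"]) auto
  next
    case False
    then obtain Z' where Z': "finite Z'" "Suc (card Z') = card Z" "Z' \<inter> Z = {}" "Z' \<subseteq> {a<..<b}"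
      "\<And>z. z \<in> Z' \<Longrightarrow> f' z = 0 \<and> z < Max Z"
      using insert by (metis insertCI subset_iff)
    define m where "m = Max Z"
    have m: "m \<in> Z" "\<And>z. z \<in> Z \<Longrightarrow> z \<le> m" using False insert(1) by (auto simp: m_def)
    have mc: "m < c" using m insert by auto
    have ab: "a < m" "c < b" "f m = 0" "f c = 0" using m insert.prems by auto
    \<comment> \<open>Rolle on the gap between the two largest zeros. The new zero lies strictly
      inside the gap, so the zeros found for \<open>f'\<close> are disjoint from \<open>Z\<close>,
      and a double zero of \<open>f\<close> can be counted in addition to them. The bound by
      \<open>Max Z\<close> is the invariant that keeps the new zero apart from the earlier
      ones.\<close>
    have "\<exists>z. m < z \<and> z < c \<and> (*) (f' z) = (\<lambda>v. 0)"
      using mc ab by (intro Rolle_deriv[of m c f "\<lambda>x. (*) (f' x)"])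
        (auto intro!: continuous_at_imp_continuous_on DERIV_isCont[OF der] der[THEN has_field_derivative_imp_has_derivative])
    then obtain z where z: "m < z" "z < c" "f' z = 0" by (metis mult_cancel_right1 mult.comm_neutral)
    have Mx: "Max (insert c Z) = c" using insert mc m by (intro Max_eqI) (auto simp: less_imp_le)
    have "z \<notin> Z'" using Z'(5) z(1) m_def by force
    show ?thesis
    proof (intro exI[of _ "insert z Z'"] conjI ballI)
      show "Suc (card (insert z Z')) = card (insert c Z)" using Z' \<open>z \<notin> Z'\<close> insert by auto
      show "insert z Z' \<inter> insert c Z = {}" using Z' z m mc by (force simp: m_def)
      show "insert z Z' \<subseteq> {a<..<b}" using Z' z ab by auto
      fix y assume "y \<in> insert z Z'"
      then show "f' y = 0" "y < Max (insert c Z)" using Z' z mc by (force simp: Mx m_def)+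
    qed (use Z' in auto)
  qed
qed

lemma Rolle_iterated:
  fixes g :: "nat \<Rightarrow> real \<Rightarrow> real"
  assumes "finite Z" "card Z = Suc m" "Z \<subseteq> {a<..<b}"
    and der: "\<And>j x. x \<in> {a<..<b} \<Longrightarrow> (g j has_real_derivative g (Suc j) x) (at x)"
    and "\<And>z. z \<in> Z \<Longrightarrow> g i z = 0"
  shows "\<exists>x\<in>{a<..<b}. g (i + m) x = 0"
  using assms(1,2,3,5)
proof (induction m arbitrary: i Z)
  case 0
  then obtain z where "Z = {z}" by (auto simp: card_1_singleton_iff)
  with 0 show ?case by auto
next
  case (Suc m)
  have "Z \<noteq> {}" using Suc.prems by auto
  then obtain Z' where Z': "finite Z'" "Suc (card Z') = card Z" "Z' \<subseteq> {a<..<b}" "\<forall>z\<in>Z'. g (Suc i) z = 0"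
    using Rolle_zeros[OF Suc.prems(1) _ Suc.prems(3) der[of _ i] Suc.prems(4)] by blast
  then show ?case using Suc.IH[of Z' "Suc i"] Suc.prems by auto
qed

section \<open>Newton products at the five inner products, and the bound for each of them\<close>

definition node :: "nat \<Rightarrow> real" where
  "node i = [-13/23, -7/23, -1/23, 5/23, 11/23] ! i"

lemma node_simps:
  "node 0 = -13/23" "node (Suc 0) = -7/23" "node 2 = -1/23" "node 3 = 5/23" "node 4 = 11/23"
  by (simp_all add: node_def numeral_eq_Suc)

definition newton_poly :: "nat \<Rightarrow> real poly" where
  "newton_poly k = (\<Prod>i<k. [:- node i, 1:])"

lemma poly_newton: "poly (newton_poly k) t = (\<Prod>i<k. t - node i)"
  by (simp add: newton_poly_def poly_prod)

lemma newton_poly_degree: "degree (newton_poly k) = k" "coeff (newton_poly k) k = 1"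
proof -
  have "degree (newton_poly k) = k \<and> coeff (newton_poly k) k = 1"
  proof (induction k)
    case (Suc k)
    have eq: "newton_poly (Suc k) = [:- node k, 1:] * newton_poly k" by (simp add: newton_poly_def)
    have nz: "newton_poly k \<noteq> 0" using Suc by auto
    have "degree (newton_poly (Suc k)) = Suc k"
      unfolding eq using nz Suc by (subst degree_mult_eq) auto
    moreover have "lead_coeff (newton_poly (Suc k)) = 1"
      unfolding eq lead_coeff_mult using Suc by simp
    ultimately show ?case by simp
  qed (simp add: newton_poly_def)
  then show "degree (newton_poly k) = k" "coeff (newton_poly k) k = 1" by auto
qed

definition slice_dist :: "nat \<Rightarrow> real" where
  "slice_dist i = [506, 8855, 23046, 14421, 1771] ! i"

lemma lessThan_lit: "{..<1::nat} = {0}" "{..<2::nat} = {0,1}" "{..<3::nat} = {0,1,2}" "{..<4::nat} = {0,1,2,3}" "{..<5::nat} = {0,1,2,3,4}"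
  by auto

definition slice_sum :: "(real \<Rightarrow> real) \<Rightarrow> real" where
  "slice_sum h = (\<Sum>i<5. slice_dist i * h (node i))"

lemma slice_sum_eq:
  "slice_sum h = 506 * h (-13/23) + 8855 * h (-7/23) + 23046 * h (-1/23) + 14421 * h (5/23) + 1771 * h (11/23)"
  by (simp add: slice_sum_def lessThan_lit slice_dist_def node_def)

text \<open>Each Newton product is a nonnegative combination of Gegenbauer polynomials, so its sum
  over all pairs is at least the contribution of the constant term. In degree at most 5 the
  resulting bound is exactly \<open>slice_sum\<close>, because the target distribution averages
  these polynomials as a 5-design would. For \<open>k = 0\<close> equality is recorded as well: the
  constant Newton coefficient of a potential may be negative, and an inequality could not be
  multiplied by it.\<close>

lemma energy_newton_ge:
  fixes D :: "(real ^ 23) set"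
  assumes "D \<subseteq> sphere 0 1" "card D = 48600" "k \<le> 5"
  shows "energy (poly (newton_poly k)) D \<ge> 48600 * slice_sum (poly (newton_poly k))"
    "k = 0 \<Longrightarrow> energy (poly (newton_poly k)) D = 48600 * slice_sum (poly (newton_poly k))"
proof -
  have fin: "finite D" using assms(2) card.infinite by fastforce
  define P where "P = (\<lambda>k. \<Sum>x\<in>D. \<Sum>y\<in>D. gegen k 23 (x \<bullet> y) 1)"
  have pd: "P j \<ge> 0" if "j \<le> 5" for j using gegen_posdef[OF assms(1) that] by (simp add: P_def)
  have P0: "P 0 = 48600^2" using assms(2) by (simp add: P_def gegen_simps power2_eq_square)
  have full: "energy (poly p) D = (\<Sum>x\<in>D. \<Sum>y\<in>D. poly p (x \<bullet> y)) - 48600 * poly p 1" for p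
  proof -
    have "(\<Sum>y\<in>D - {x}. poly p (x \<bullet> y)) = (\<Sum>y\<in>D. poly p (x \<bullet> y)) - poly p 1" if "x \<in> D" for x
    proof -
      have "x \<bullet> x = 1" using that assms(1) by (auto simp: norm_eq_1)
      then show ?thesis using fin that by (simp add: sum_diff1)
    qed
    then show ?thesis using assms(2) by (simp add: energy_def sum_subtractf)
  qed
  have main: "energy (poly (newton_poly k)) D = (\<Sum>j<6. f j * P j) - 48600 * poly (newton_poly k) 1"
    if "\<And>t. poly (newton_poly k) t = (\<Sum>j<6. f j * gegen j 23 t 1)" for f k
    unfolding full that P_def
    by (simp add: sum_distrib_left sum.swap[of _ _ "{..<6::nat}"])
  consider "k = 0" | "k = 1" | "k = 2" | "k = 3" | "k = 4" | "k = 5" using assms(3) by linarith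
  note cs = this
  have s6: "{..<6::nat} = {0,1,2,3,4,5}" by auto
  \<comment> \<open>The second condition on \<open>f\<close> says that the constant Gegenbauer
    coefficient alone accounts for the energy of the target distribution; the sum from 1 to 5 is the
    nonnegative excess.\<close>
  have fin: "energy (poly (newton_poly k)) D = 48600 * slice_sum (poly (newton_poly k)) + (\<Sum>j\<in>{1..5}. f ! j * P j)"
    if "\<And>t. poly (newton_poly k) t = (\<Sum>j<6. f ! j * gegen j 23 t 1)"
      "f ! 0 * 48600 - poly (newton_poly k) 1 = slice_sum (poly (newton_poly k))" for f
  proof -
    have "{..<6} = insert 0 {1..5::nat}" by auto
    then show ?thesis using main[OF that(1)] that(2)[symmetric] P0 by (simp add: power2_eq_square)
  qed
  have ge: "48600 * slice_sum (poly (newton_poly k)) \<le> energy (poly (newton_poly k)) D"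
    if "\<And>t. poly (newton_poly k) t = (\<Sum>j<6. f ! j * gegen j 23 t 1)"
      "f ! 0 * 48600 - poly (newton_poly k) 1 = slice_sum (poly (newton_poly k))" "length f = 6" "\<And>x. x \<in> set f \<Longrightarrow> x \<ge> 0" for f
    using that by (subst fin[of f]) (auto intro!: sum_nonneg mult_nonneg_nonneg pd)
  show "energy (poly (newton_poly k)) D \<ge> 48600 * slice_sum (poly (newton_poly k))"
    using cs
  proof cases
    \<comment> \<open>The lists hold the Gegenbauer coefficients of the Newton products in dimension
      23.\<close>
    case 1 show ?thesis by (rule ge[of "[1,0,0,0,0,0]"])
      (auto simp: 1 s6 poly_newton gegen_simps slice_sum_eq lessThan_lit node_simps)
  next
    case 2 show ?thesis by (rule ge[of "[13/23,1,0,0,0,0]"])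
      (auto simp: 2 s6 poly_newton gegen_simps slice_sum_eq lessThan_lit node_simps)
  next
    case 3 show ?thesis by (rule ge[of "[114/529,20/23,1/23,0,0,0]"])
      (auto simp: 3 s6 poly_newton gegen_simps slice_sum_eq lessThan_lit node_simps, algebra)
  next
    case 4 show ?thesis by (rule ge[of "[574/12167,4362/13225,21/529,1/25,0,0]"])
      (auto simp: 4 s6 poly_newton gegen_simps slice_sum_eq lessThan_lit node_simps, algebra)
  next
    case 5 show ?thesis by (rule ge[of "[28576/6996025,13792/304175,1112/109503,16/575,1/675,0]"])
      (auto simp: 5 s6 poly_newton gegen_simps slice_sum_eq lessThan_lit node_simps, algebra)
  next
    case 6 show ?thesis by (rule ge[of "[576/32181715,3424/12592845,520/2518569,72/76705,1/3105,1/783]"])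
      (auto simp: 6 s6 poly_newton gegen_simps slice_sum_eq lessThan_lit node_simps, algebra)
  qed
  show "energy (poly (newton_poly k)) D = 48600 * slice_sum (poly (newton_poly k))" if "k = 0"
    using fin[of "[1,0,0,0,0,0]"] that
    by (auto intro!: sum.neutral simp: nth_Cons split: nat.splits simp: s6 poly_newton gegen_simps slice_sum_eq lessThan_lit node_simps)
qed

text \<open>The system is triangular, as \<open>newton_poly j\<close> vanishes at the nodes before
  \<open>j\<close>. One sequence \<open>d\<close> serves all \<open>m\<close> at once: truncated
  after \<open>m\<close> it interpolates at the first \<open>m + 1\<close> nodes, so
  \<open>d m\<close> is the leading coefficient of an interpolant and its sign is accessible to
  Rolle's theorem.\<close>

lemma newton_interpolation:
  "\<exists>d. \<forall>m\<le>4. \<forall>i\<le>m. h (node i) = (\<Sum>j\<le>m. d j * poly (newton_poly j) (node i))" for h :: "real \<Rightarrow> real"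
proof -
  have inj: "node i \<noteq> node j" if "i < j" "j \<le> 4" for i j
  proof -
    have "j \<in> {1,2,3,4}" "i \<in> {0,1,2,3}" using that by auto
    then show ?thesis using that by (auto simp: node_simps)
  qed
  have zero: "poly (newton_poly j) (node i) = 0" if "i < j" for i j
    using that by (auto simp: poly_newton)
  have nz: "poly (newton_poly j) (node j) \<noteq> 0" if "j \<le> 4" for j
    using inj[OF _ that] by (fastforce simp: poly_newton)
  have "\<exists>d. \<forall>m<n. \<forall>i\<le>m. h (node i) = (\<Sum>j\<le>m. d j * poly (newton_poly j) (node i))" if "n \<le> 5" for n
    using that
  proof (induction n)
    case (Suc n)
    then obtain d where d: "\<forall>m<n. \<forall>i\<le>m. h (node i) = (\<Sum>j\<le>m. d j * poly (newton_poly j) (node i))" by auto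
    define d' where "d' = d(n := (h (node n) - (\<Sum>j<n. d j * poly (newton_poly j) (node n))) / poly (newton_poly n) (node n))"
    have lt: "(\<Sum>j\<le>m. d' j * poly (newton_poly j) (node i)) = (\<Sum>j\<le>m. d j * poly (newton_poly j) (node i))" if "m < n" for m i
      using that by (intro sum.cong) (auto simp: d'_def)
    have eqn: "(\<Sum>j\<le>n. d' j * poly (newton_poly j) (node i)) = (\<Sum>j<n. d j * poly (newton_poly j) (node i)) + d' n * poly (newton_poly n) (node i)" for i
    proof -
      have "(\<Sum>j<n. d' j * poly (newton_poly j) (node i)) = (\<Sum>j<n. d j * poly (newton_poly j) (node i))"
        by (intro sum.cong) (auto simp: d'_def)
      then show ?thesis by (simp add: lessThan_Suc_atMost[symmetric])
    qed
    have last: "h (node i) = (\<Sum>j\<le>n. d' j * poly (newton_poly j) (node i))" if "i \<le> n" for i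
    proof (cases "i = n")
      case True
      then show ?thesis unfolding eqn using nz[of n] Suc.prems by (simp add: d'_def)
    next
      case False
      then have "i < n" using that by simp
      define n' where "n' = n - 1"
      have n': "n' < n" "i \<le> n'" "{..<n} = {..n'}" using \<open>i < n\<close> by (auto simp: n'_def)
      have "h (node i) = (\<Sum>j\<le>n'. d j * poly (newton_poly j) (node i))" using d n'(1,2) by blast
      then show ?thesis unfolding eqn n'(3) zero[OF \<open>i < n\<close>] by simp
    qed
    show ?case
    proof (intro exI[of _ d'] allI impI)
      fix m i assume m: "m < Suc n" "i \<le> m"
      show "h (node i) = (\<Sum>j\<le>m. d' j * poly (newton_poly j) (node i))"
      proof (cases "m = n")
        case True then show ?thesis using last m by blast
      next
        case False
        then have "m < n" using m by simp
        then show ?thesis using lt d m(2) by metis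
      qed
    qed
  qed simp
  note ex5 = this[of 5, OF order_refl]
  have "m < 5 \<longleftrightarrow> m \<le> 4" for m :: nat by auto
  then show ?thesis using ex5 by simp
qed

section \<open>Signs of divided differences and the Hermite minorant\<close>

lemma poly_higher_pderiv_degree:
  fixes p :: "real poly"
  assumes "degree p \<le> k"
  shows "poly ((pderiv ^^ k) p) x = fact k * coeff p k"
proof -
  have "coeff ((pderiv ^^ k) p) n = 0" if "n > 0" for n
    using that assms by (simp add: coeff_higher_pderiv coeff_eq_0)
  then have "degree ((pderiv ^^ k) p) = 0"
    by (metis bot_nat_0.not_eq_extremum leading_coeff_0_iff degree_0)
  then obtain c where c: "(pderiv ^^ k) p = [:c:]" by (metis degree_eq_zeroE)
  have "coeff ((pderiv ^^ k) p) 0 = fact k * coeff p k"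
    by (simp add: coeff_higher_pderiv pochhammer_fact)
  then show ?thesis by (simp add: c)
qed

lemma absolutely_monotone_diff_poly_deriv:
  assumes "absolutely_monotone h" "x \<in> {-1<..<1}"
  shows "((\<lambda>x. (deriv ^^ j) h x - poly ((pderiv ^^ j) p) x) has_real_derivative
    (deriv ^^ Suc j) h x - poly ((pderiv ^^ Suc j) p) x) (at x)"
  using assms unfolding absolutely_monotone_def
  by (auto intro!: DERIV_diff poly_DERIV simp: DERIV_deriv_iff_field_differentiable)

lemma absolutely_monotone_deriv_nonneg:
  assumes "absolutely_monotone h" "j \<ge> 1" "x \<in> {-1<..<1}"
  shows "(deriv ^^ j) h x \<ge> 0"
  using assms unfolding absolutely_monotone_def by blast

lemma node_lt: assumes "i < j" "j \<le> 4" shows "node i < node j"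
proof -
  have "j \<in> {1,2,3,4}" "i \<in> {0,1,2,3}" using assms by auto
  then show ?thesis using assms by (auto simp: node_simps)
qed

lemma node_inj: "inj_on node {..4}"
  by (intro linorder_inj_onI) (use node_lt in force)+

lemma node_bounds: assumes "i \<le> 4" shows "-1 < node i" "node i < 1"
proof -
  have "i \<in> {0,1,2,3,4}" using assms by auto
  then show "-1 < node i" "node i < 1" by (auto simp: node_simps)
qed

text \<open>Counted with multiplicity, \<open>h - p\<close> has \<open>m + 2\<close> zeros. Rolle
  gives \<open>m\<close> zeros of the first derivative away from \<open>Z\<close>, to which
  \<open>s\<close> is added; a zero of the derivative of order \<open>m + 1\<close> remains. There
  the derivative of \<open>p\<close> is a factorial times its top coefficient, which thus inherits
  the sign of a derivative of \<open>h\<close>.\<close>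

lemma Rolle_double_node:
  fixes p :: "real poly"
  assumes h: "absolutely_monotone h" and Z: "finite Z" "card Z = Suc m" "Z \<subseteq> {-1<..<1}" "s \<in> Z"
    and p: "\<And>z. z \<in> Z \<Longrightarrow> h z = poly p z" "deriv h s = poly (pderiv p) s" "degree p \<le> Suc m"
  shows "coeff p (Suc m) \<ge> 0"
proof -
  define g where "g j x = (deriv ^^ j) h x - poly ((pderiv ^^ j) p) x" for j x
  have g: "(g j has_real_derivative g (Suc j) x) (at x)" if "x \<in> {-1<..<1}" for j x
    using absolutely_monotone_diff_poly_deriv[OF h that] unfolding g_def .
  have "Z \<noteq> {}" using Z by auto
  have g0: "(g 0 has_real_derivative g 1 x) (at x)" if "x \<in> {-1<..<1}" for x using g[OF that, of 0] by simp
  have z0: "g 0 z = 0" if "z \<in> Z" for z using p(1) that by (simp add: g_def)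
  obtain Z' where Z': "finite Z'" "Suc (card Z') = card Z" "Z' \<inter> Z = {}" "Z' \<subseteq> {-1<..<1}" "\<forall>z\<in>Z'. g 1 z = 0"
    using Rolle_zeros[OF Z(1) \<open>Z \<noteq> {}\<close> Z(3) g0 z0] by blast
  have "s \<notin> Z'" using Z' Z by auto
  have "\<exists>x\<in>{-1<..<1}. g (1 + m) x = 0"
  proof (rule Rolle_iterated[of "insert s Z'"])
    show "card (insert s Z') = Suc m" using Z' Z \<open>s \<notin> Z'\<close> by simp
    show "g 1 z = 0" if "z \<in> insert s Z'" for z using that Z' p(2) by (auto simp: g_def)
  qed (use Z' Z g in auto)
  then obtain x where x: "x \<in> {-1<..<1}" "(deriv ^^ Suc m) h x = poly ((pderiv ^^ Suc m) p) x"
    by (auto simp: g_def)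
  moreover have "(deriv ^^ Suc m) h x \<ge> 0"
    using absolutely_monotone_deriv_nonneg[OF h _ x(1), of "Suc m"] by simp
  ultimately have "fact (Suc m) * coeff p (Suc m) \<ge> 0" using poly_higher_pderiv_degree[OF p(3)] by metis
  then show ?thesis by (metis fact_gt_zero zero_le_mult_iff not_le)
qed

text \<open>The same count without a double node. Order 0 is excluded, as the values of
  \<open>h\<close> itself have no sign.\<close>

lemma Rolle_simple_nodes:
  fixes p :: "real poly"
  assumes h: "absolutely_monotone h" and Z: "finite Z" "card Z = Suc m" "Z \<subseteq> {-1<..<1}"
    and p: "\<And>z. z \<in> Z \<Longrightarrow> h z = poly p z" "degree p \<le> m" "m \<ge> 1"
  shows "coeff p m \<ge> 0"
proof -
  have "\<exists>x\<in>{-1<..<1}. (\<lambda>j x. (deriv ^^ j) h x - poly ((pderiv ^^ j) p) x) (0 + m) x = 0"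
    by (intro Rolle_iterated[OF Z]) (use p(1) absolutely_monotone_diff_poly_deriv[OF h] in auto)
  then obtain x where x: "x \<in> {-1<..<1}" "(deriv ^^ m) h x = poly ((pderiv ^^ m) p) x"
    by auto
  moreover have "(deriv ^^ m) h x \<ge> 0" using absolutely_monotone_deriv_nonneg[OF h p(3) x(1)] .
  ultimately have "fact m * coeff p m \<ge> 0" using poly_higher_pderiv_degree[OF p(2)] by metis
  then show ?thesis by (metis fact_gt_zero zero_le_mult_iff not_le)
qed

lemma degree_coeff_newton_sum:
  "degree (\<Sum>j\<le>m. smult (d j) (newton_poly j)) \<le> m"
  "coeff (\<Sum>j\<le>m. smult (d j) (newton_poly j)) m = d m"
proof -
  show "degree (\<Sum>j\<le>m. smult (d j) (newton_poly j)) \<le> m"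
    by (intro degree_sum_le) (auto intro: order.trans[OF degree_smult_le] simp: newton_poly_degree)
  have "coeff (\<Sum>j\<le>m. smult (d j) (newton_poly j)) m = (\<Sum>j\<le>m. if j = m then d m else 0)"
    unfolding coeff_sum by (intro sum.cong refl) (auto simp: newton_poly_degree coeff_eq_0)
  then show "coeff (\<Sum>j\<le>m. smult (d j) (newton_poly j)) m = d m" by simp
qed

text \<open>The error of the interpolant with double node \<open>s\<close> is a divided difference
  of order 6 times the nodal product \<open>newton_poly 5 * (t - s)\<close>. The former is
  nonnegative, so \<open>h\<close> lies above the interpolant wherever the product is nonnegative.
  The coefficients up to 4 are those of plain interpolation; the last one carries the tangency
  condition at \<open>s\<close>.\<close>

lemma hermite_minorant:
  assumes h: "absolutely_monotone h" and i: "i \<in> {0,2,4}"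
  obtains d :: "nat \<Rightarrow> real" where "\<And>j. j \<ge> 1 \<Longrightarrow> j \<le> 5 \<Longrightarrow> d j \<ge> 0"
    "\<And>i. i \<le> 4 \<Longrightarrow> h (node i) = (\<Sum>j\<le>5. d j * poly (newton_poly j) (node i))"
    "\<And>t. -1 \<le> t \<Longrightarrow> t < 1 \<Longrightarrow> poly (newton_poly 5) t * (t - node i) \<ge> 0 \<Longrightarrow>
       h t \<ge> (\<Sum>j\<le>5. d j * poly (newton_poly j) t)"
proof -
  obtain d0 where d0: "\<And>m i. m \<le> 4 \<Longrightarrow> i \<le> m \<Longrightarrow> h (node i) = (\<Sum>j\<le>m. d0 j * poly (newton_poly j) (node i))"
    using newton_interpolation[of h] by auto
  define s where "s = node i"
  have s: "s \<in> node ` {..4}" using i by (auto simp: s_def)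
  have l5: "newton_poly 5 = [:- node 0, 1:] * [:- node 1, 1:] * [:- node 2, 1:] * [:- node 3, 1:] * [:- node 4, 1:]"
    unfolding newton_poly_def lessThan_lit by (simp add: mult.assoc del: mult_pCons_left mult_pCons_right)
  \<comment> \<open>\<open>s\<close> is a simple root of \<open>newton_poly 5\<close>, so the
    tangency condition can be solved for the last coefficient.\<close>
  have w5: "poly (pderiv (newton_poly 5)) s \<noteq> 0"
    using i unfolding l5 s_def by (auto simp: pderiv_mult pderiv_pCons node_simps)
  define p4 where "p4 = (\<Sum>j\<le>4. smult (d0 j) (newton_poly j))"
  define d where "d = d0(5 := (deriv h s - poly (pderiv p4) s) / poly (pderiv (newton_poly 5)) s)"
  define P where "P m = (\<Sum>j\<le>m. smult (d j) (newton_poly j))" for m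
  have polyP: "poly (P m) x = (\<Sum>j\<le>m. d j * poly (newton_poly j) x)" for m x by (simp add: P_def poly_sum)
  have P4: "P 4 = p4" by (auto simp: P_def p4_def d_def intro!: sum.cong)
  have P5: "P 5 = p4 + smult (d 5) (newton_poly 5)"
  proof -
    have "{..5::nat} = insert 5 {..4}" by auto
    then show ?thesis unfolding P4[symmetric] P_def by simp
  qed
  have zero5: "poly (newton_poly 5) (node i) = 0" if "i \<le> 4" for i
    using that unfolding poly_newton by (intro prod_zero) auto
  have lo: "h (node i) = poly (P m) (node i)" if "i \<le> m" "m \<le> 4" for i m
    using d0[OF that(2,1)] that by (auto simp: polyP d_def intro!: sum.cong)
  have P5h: "h (node i) = poly (P 5) (node i)" if "i \<le> 4" for i
    using lo[OF that order.refl] zero5[OF that] by (simp add: P5 P4)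
  have P5h': "deriv h s = poly (pderiv (P 5)) s"
    unfolding P5 using w5 by (simp add: pderiv_add pderiv_smult d_def)
  define N where "N = node ` {..4}"
  have N: "finite N" "card N = 5" "N \<subseteq> {-1<..<1}" "s \<in> N"
    using card_image[OF node_inj] node_bounds s by (auto simp: N_def)
  have nn: "d j \<ge> 0" if "j \<ge> 1" "j \<le> 5" for j
  proof (cases "j = 5")
    case True
    have "coeff (P 5) (Suc 4) \<ge> 0"
      using N P5h P5h' degree_coeff_newton_sum(1)[of d 5]
      by (intro Rolle_double_node[OF h, of N]) (auto simp: N_def P_def)
    then show ?thesis using True degree_coeff_newton_sum(2)[of d 5] by (simp add: P_def)
  next
    case False
    then have j: "j \<le> 4" using that by simp
    have "card (node ` {..j}) = Suc j" using j by (subst card_image) (auto intro: inj_on_subset[OF node_inj])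
    then have "coeff (P j) j \<ge> 0"
    proof (intro Rolle_simple_nodes[OF h, of "node ` {..j}"])
      show "node ` {..j} \<subseteq> {-1<..<1}" using node_bounds j by auto
      show "h z = poly (P j) z" if "z \<in> node ` {..j}" for z using that lo[OF _ j] by auto
    qed (use that degree_coeff_newton_sum(1)[of d j] in \<open>auto simp: P_def\<close>)
    then show ?thesis using degree_coeff_newton_sum(2)[of d j] by (simp add: P_def)
  qed
  have open_ge: "h t \<ge> poly (P 5) t" if t: "-1 < t" "t < 1" "poly (newton_poly 5) t * (t - s) \<ge> 0" for t
  proof (cases "t \<in> N")
    case True then show ?thesis using P5h by (auto simp: N_def)
  next
    case False
    define w where "w = newton_poly 5 * [:- s, 1:]"
    have wt: "poly w t \<noteq> 0"
    proof -
      have "t \<noteq> node i" if "i \<le> 4" for i using False that by (auto simp: N_def)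
      then have "poly (newton_poly 5) t \<noteq> 0" unfolding poly_newton by (subst prod_zero_iff) auto
      moreover have "t \<noteq> s" using False N by auto
      ultimately show ?thesis by (auto simp: w_def)
    qed
    \<comment> \<open>Adding \<open>c * w\<close> preserves all interpolation conditions, including
      the one on the derivative, and \<open>c\<close> is chosen so that the polynomial agrees with
      \<open>h\<close> at \<open>t\<close> too. Thus \<open>c\<close> is a divided difference on
      seven points counted with multiplicity.\<close>
    define c where "c = (h t - poly (P 5) t) / poly w t"
    define q where "q = P 5 + smult c w"
    have degw: "degree w = 6" "coeff w 6 = 1"
    proof -
      have nz: "newton_poly 5 \<noteq> 0" using newton_poly_degree[of 5] by auto
      show "degree w = 6" unfolding w_def using nz by (subst degree_mult_eq) (auto simp: newton_poly_degree)
      then show "coeff w 6 = 1" using lead_coeff_mult[of "newton_poly 5" "[:- s, 1:]"] newton_poly_degree[of 5]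
        by (simp add: w_def)
    qed
    have degP: "degree (P 5) \<le> 5" using degree_coeff_newton_sum(1)[of d 5] by (simp add: P_def)
    have wz: "poly w z = 0" if "z \<in> N" for z using that zero5 by (auto simp: w_def N_def)
    have w's: "poly (pderiv w) s = 0"
      using s zero5 by (auto simp: w_def pderiv_mult pderiv_pCons simp del: mult_pCons_right)
    have "coeff q (Suc 5) \<ge> 0"
    proof (rule Rolle_double_node[OF h, of "insert t N"])
      show "card (insert t N) = Suc 5" using N False by simp
      show "degree q \<le> Suc 5" unfolding q_def
        using degP degw by (intro degree_add_le order.trans[OF degree_smult_le]) auto
      show "deriv h s = poly (pderiv q) s" using P5h' w's by (simp add: q_def pderiv_add pderiv_smult)
      show "h z = poly q z" if "z \<in> insert t N" for z
        using that P5h wz wt by (auto simp: q_def c_def N_def)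
    qed (use N t in auto)
    moreover have "coeff q 6 = c" using degP degw by (simp add: q_def coeff_eq_0)
    ultimately have "c \<ge> 0" by simp
    moreover have "h t - poly (P 5) t = c * poly w t" using wt by (simp add: c_def)
    moreover have "poly w t \<ge> 0" using t(3) by (simp add: w_def algebra_simps)
    ultimately show ?thesis by (metis diff_ge_0_iff_ge mult_nonneg_nonneg)
  qed
  have "h t \<ge> poly (P 5) t" if t: "-1 \<le> t" "t < 1" "poly (newton_poly 5) t * (t - s) \<ge> 0" for t
  proof (cases "t = -1")
    case False then show ?thesis using open_ge t by auto
  next
    case True
    \<comment> \<open>A potential is only continuous at -1, which the Rolle argument does not reach.
      The inequality is carried over as a limit from the interval to the left of all nodes, where
      both factors of the nodal product are nonpositive.\<close>
    have cl: "closure {-1<..<-13/23::real} = {-1..-13/23}" by (intro closure_greaterThanLessThan) auto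
    have "0 \<le> h (-1) - poly (P 5) (-1)"
    proof (rule continuous_ge_on_closure[of "{-1<..<-13/23::real}" "\<lambda>t. h t - poly (P 5) t"])
      show "continuous_on (closure {-1<..<-13/23}) (\<lambda>t. h t - poly (P 5) t)"
        using h unfolding cl absolutely_monotone_def potential_def
        by (auto intro!: continuous_intros intro: continuous_on_subset)
      fix x :: real assume x: "x \<in> {-1<..<-13/23}"
      have "x - node j \<le> 0" if "j \<le> 4" for j
      proof -
        have "node 0 \<le> node j" using node_lt[of 0 j] that by (cases "j = 0") auto
        then show ?thesis using x by (simp add: node_simps)
      qed
      note neg = this
      have "poly (newton_poly 5) x \<le> 0"
      proof -
        have "poly (newton_poly 5) x = - (\<Prod>i<5. node i - x)"
          by (simp add: poly_newton lessThan_lit algebra_simps)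
        moreover have "(\<Prod>i<5. node i - x) \<ge> 0" using neg by (intro prod_nonneg) auto
        ultimately show ?thesis by simp
      qed
      moreover have "x - s \<le> 0" using neg s by auto
      ultimately have "poly (newton_poly 5) x * (x - s) \<ge> 0" by (rule mult_nonpos_nonpos)
      then show "0 \<le> h x - poly (P 5) x" using open_ge[of x] x by simp
    qed (simp add: cl)
    then show ?thesis using True by simp
  qed
  then show ?thesis using that[of d] nn P5h by (simp add: polyP s_def)
qed

theorem energy_lower_bound:
  fixes D :: "(real ^ 23) set"
  assumes T: "T \<in> {{-13/23<..<-7/23} \<union> {-1/23<..<5/23},
                {-13/23<..<-7/23} \<union> {5/23<..<11/23},
                {-7/23<..<-1/23} \<union> {5/23<..<11/23}}"
    and h: "absolutely_monotone h" and D: "D \<in> avoiding_codes T 48600"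
  shows "energy h D \<ge> 48600 * slice_sum h"
proof -
  have D': "D \<subseteq> sphere 0 1" "card D = 48600" "finite D" "inner_products D \<inter> T = {}"
    using D by (auto simp: avoiding_codes_def spherical_code_def avoiding_def)
  \<comment> \<open>The doubled node is the one that is not an endpoint of a component of
    \<open>T\<close>. The other four are grouped into two quadratics, each negative precisely on one
    component of \<open>T\<close>.\<close>
  obtain i where i: "i \<in> {0,2,4}" "\<And>t. t \<notin> T \<Longrightarrow> poly (newton_poly 5) t * (t - node i) \<ge> 0"
  proof -
    define a where "a t = (t + 13/23) * (t + 7/23)" for t :: real
    define b where "b t = (t + 7/23) * (t + 1/23)" for t :: real
    define c where "c t = (t + 1/23) * (t - 5/23)" for t :: real
    define e where "e t = (t - 5/23) * (t - 11/23)" for t :: real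
    have nn: "t \<notin> {-13/23<..<-7/23} \<Longrightarrow> a t \<ge> 0" "t \<notin> {-7/23<..<-1/23} \<Longrightarrow> b t \<ge> 0"
      "t \<notin> {-1/23<..<5/23} \<Longrightarrow> c t \<ge> 0" "t \<notin> {5/23<..<11/23} \<Longrightarrow> e t \<ge> 0" for t
      by (auto simp: a_def b_def c_def e_def zero_le_mult_iff not_less)
    have fac: "poly (newton_poly 5) t * (t - node 4) = a t * c t * (t - 11/23)^2"
      "poly (newton_poly 5) t * (t - node 2) = a t * e t * (t + 1/23)^2"
      "poly (newton_poly 5) t * (t - node 0) = b t * e t * (t + 13/23)^2" for t
      by (simp_all add: poly_newton lessThan_lit node_simps a_def b_def c_def e_def power2_eq_square)
    from T consider "T = {-13/23<..<-7/23} \<union> {-1/23<..<5/23}" | "T = {-13/23<..<-7/23} \<union> {5/23<..<11/23}"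
      | "T = {-7/23<..<-1/23} \<union> {5/23<..<11/23}" by auto
    then show ?thesis
    proof cases
      case 1 show ?thesis by (rule that[of 4]) (use nn 1 in \<open>auto simp: fac simp del: greaterThanLessThan_iff\<close>)
    next
      case 2 show ?thesis by (rule that[of 2]) (use nn 2 in \<open>auto simp: fac simp del: greaterThanLessThan_iff\<close>)
    next
      case 3 show ?thesis by (rule that[of 0]) (use nn 3 in \<open>auto simp: fac simp del: greaterThanLessThan_iff\<close>)
    qed
  qed
  obtain d where d: "\<And>j. j \<ge> 1 \<Longrightarrow> j \<le> 5 \<Longrightarrow> d j \<ge> 0"
    "\<And>i. i \<le> 4 \<Longrightarrow> h (node i) = (\<Sum>j\<le>5. d j * poly (newton_poly j) (node i))"
    "\<And>t. -1 \<le> t \<Longrightarrow> t < 1 \<Longrightarrow> poly (newton_poly 5) t * (t - node i) \<ge> 0 \<Longrightarrow>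
       h t \<ge> (\<Sum>j\<le>5. d j * poly (newton_poly j) t)"
    by (rule hermite_minorant[OF h i(1)]) blast
  have "48600 * slice_sum h = 48600 * (\<Sum>i<5. \<Sum>j\<le>5. slice_dist i * (d j * poly (newton_poly j) (node i)))"
    unfolding slice_sum_def by (simp add: d(2) sum_distrib_left)
  also have "\<dots> = (\<Sum>j\<le>5. d j * (48600 * slice_sum (poly (newton_poly j))))"
    unfolding slice_sum_def sum_distrib_left by (subst sum.swap, intro sum.cong refl) simp
  also have "\<dots> \<le> (\<Sum>j\<le>5. d j * energy (poly (newton_poly j)) D)"
  proof (intro sum_mono)
    fix j :: nat assume "j \<in> {..5}"
    then show "d j * (48600 * slice_sum (poly (newton_poly j))) \<le> d j * energy (poly (newton_poly j)) D"
      using energy_newton_ge[OF D'(1,2), of j] d(1)[of j]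
      by (cases "j = 0") (auto intro!: mult_left_mono)
  qed
  also have "\<dots> = (\<Sum>x\<in>D. \<Sum>y\<in>D - {x}. \<Sum>j\<le>5. d j * poly (newton_poly j) (x \<bullet> y))"
    by (simp add: energy_def sum_distrib_left sum.swap[of _ _ "{..5::nat}"])
  also have "\<dots> \<le> energy h D"
    unfolding energy_def
  proof (intro sum_mono d(3) i(2))
    fix x y assume xy: "x \<in> D" "y \<in> D - {x}"
    then have n: "norm x = 1" "norm y = 1" "x \<noteq> y" using D'(1) by auto
    show "-1 \<le> x \<bullet> y" using Cauchy_Schwarz_ineq2[of x y] n by auto
    show "x \<bullet> y < 1"
    proof -
      have "0 < (x - y) \<bullet> (x - y)" using n by simp
      then show ?thesis using n by (simp add: inner_diff_left inner_diff_right inner_commute norm_eq_1)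
    qed
    show "x \<bullet> y \<notin> T" using xy D'(4) by (auto simp: inner_products_def)
  qed
  finally show ?thesis .
qed

section \<open>Integration of polynomials over the sphere\<close>

lemma polynomials_upto_zero: "(\<lambda>x. 0) \<in> polynomials_upto d"
  unfolding polynomials_upto_def by (intro CollectI exI[of _ "{}"]) auto

lemma polynomials_upto_one: "(\<lambda>x. 1) \<in> polynomials_upto d"
  unfolding polynomials_upto_def
  by (intro CollectI exI[of _ "{\<lambda>_. 0}"] exI[of _ "\<lambda>_. 1"]) auto

lemma polynomials_upto_add:
  assumes "p \<in> polynomials_upto d" "q \<in> polynomials_upto d"
  shows "(\<lambda>x. p x + q x) \<in> polynomials_upto d"
proof -
  obtain E c F c' where E: "finite E" "\<forall>e\<in>E. (\<Sum>b\<in>Basis. e b) \<le> d" "p = (\<lambda>x. \<Sum>e\<in>E. c e * (\<Prod>b\<in>Basis. (x \<bullet> b) ^ e b))"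
    and F: "finite F" "\<forall>e\<in>F. (\<Sum>b\<in>Basis. e b) \<le> d" "q = (\<lambda>x. \<Sum>e\<in>F. c' e * (\<Prod>b\<in>Basis. (x \<bullet> b) ^ e b))"
    using assms unfolding polynomials_upto_def by blast
  have "p x + q x = (\<Sum>e\<in>E \<union> F. ((if e \<in> E then c e else 0) + (if e \<in> F then c' e else 0)) * (\<Prod>b\<in>Basis. (x \<bullet> b) ^ e b))" for x
  proof -
    have "p x = (\<Sum>e\<in>E \<union> F. (if e \<in> E then c e else 0) * (\<Prod>b\<in>Basis. (x \<bullet> b) ^ e b))"
      unfolding E(3) using E(1) F(1) by (intro sum.mono_neutral_cong_left) auto
    moreover have "q x = (\<Sum>e\<in>E \<union> F. (if e \<in> F then c' e else 0) * (\<Prod>b\<in>Basis. (x \<bullet> b) ^ e b))"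
      unfolding F(3) using E(1) F(1) by (intro sum.mono_neutral_cong_left) auto
    ultimately show ?thesis by (simp add: sum.distrib distrib_right)
  qed
  then show ?thesis unfolding polynomials_upto_def using E(1,2) F(1,2)
    by (intro CollectI exI[of _ "E \<union> F"] exI[of _ "\<lambda>e. (if e \<in> E then c e else 0) + (if e \<in> F then c' e else 0)"]) auto
qed

lemma polynomials_upto_scale:
  assumes "p \<in> polynomials_upto d" shows "(\<lambda>x. r * p x) \<in> polynomials_upto d"
proof -
  obtain E c where E: "finite E" "\<forall>e\<in>E. (\<Sum>b\<in>Basis. e b) \<le> d" "p = (\<lambda>x. \<Sum>e\<in>E. c e * (\<Prod>b\<in>Basis. (x \<bullet> b) ^ e b))"
    using assms unfolding polynomials_upto_def by blast
  then show ?thesis unfolding polynomials_upto_def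
    by (intro CollectI exI[of _ E] exI[of _ "\<lambda>e. r * c e"]) (auto simp: sum_distrib_left mult.assoc)
qed

text \<open>Multiplication by a coordinate raises one exponent. The map \<open>up\<close> on
  exponent vectors has the left inverse \<open>down\<close>, which transports the
  coefficients.\<close>

lemma polynomials_upto_mult_coordinate:
  fixes b :: "'a::euclidean_space"
  assumes "p \<in> polynomials_upto d" "b \<in> Basis"
  shows "(\<lambda>x. p x * (x \<bullet> b)) \<in> polynomials_upto (Suc d)"
proof -
  obtain E c where E: "finite E" "\<forall>e\<in>E. (\<Sum>b\<in>Basis. e b) \<le> d" "p = (\<lambda>x. \<Sum>e\<in>E. c e * (\<Prod>b\<in>Basis. (x \<bullet> b) ^ e b))"
    using assms(1) unfolding polynomials_upto_def by blast
  define up where "up e = e(b := Suc (e b))" for e :: "'a \<Rightarrow> nat"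
  define down where "down e = e(b := e b - 1)" for e :: "'a \<Rightarrow> nat"
  have du: "down (up e) = e" for e by (simp add: up_def down_def)
  have inj: "inj_on up E" by (rule inj_on_inverseI[of _ down]) (rule du)
  have sum_up: "(\<Sum>b'\<in>Basis. up e b') = Suc (\<Sum>b'\<in>Basis. e b')" for e
  proof -
    have "(\<Sum>b'\<in>Basis - {b}. up e b') = (\<Sum>b'\<in>Basis - {b}. e b')" by (intro sum.cong refl) (auto simp: up_def)
    then show ?thesis using assms(2) by (simp add: sum.remove[of Basis b] up_def)
  qed
  have prod_up: "(\<Prod>b'\<in>Basis. (x \<bullet> b') ^ up e b') = (\<Prod>b'\<in>Basis. (x \<bullet> b') ^ e b') * (x \<bullet> b)" for e x
  proof -
    have "(\<Prod>b'\<in>Basis - {b}. (x \<bullet> b') ^ up e b') = (\<Prod>b'\<in>Basis - {b}. (x \<bullet> b') ^ e b')"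
      by (intro prod.cong refl) (auto simp: up_def)
    then show ?thesis using assms(2) by (simp add: prod.remove[of Basis b] up_def)
  qed
  have "p x * (x \<bullet> b) = (\<Sum>e\<in>up ` E. c (down e) * (\<Prod>b\<in>Basis. (x \<bullet> b) ^ e b))" for x
    unfolding E(3) sum_distrib_right sum.reindex[OF inj] by (intro sum.cong refl) (simp add: du prod_up)
  then show ?thesis unfolding polynomials_upto_def using E(1,2)
    by (intro CollectI exI[of _ "up ` E"] exI[of _ "\<lambda>e. c (down e)"]) (auto simp: sum_up)
qed

lemma polynomials_upto_mono: "d \<le> d' \<Longrightarrow> polynomials_upto d \<subseteq> polynomials_upto d'"
  unfolding polynomials_upto_def by (auto intro: order.trans)

lemma polynomials_upto_sum:
  "(\<And>i. i \<in> I \<Longrightarrow> p i \<in> polynomials_upto d) \<Longrightarrow> (\<lambda>x. \<Sum>i\<in>I. p i x) \<in> polynomials_upto d"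
  by (induction I rule: infinite_finite_induct) (auto intro: polynomials_upto_zero polynomials_upto_add)

text \<open>Powers of linear forms are the test polynomials to which the design condition is
  applied.\<close>

lemma inner_power_polynomial: "(\<lambda>x. (a \<bullet> x) ^ k) \<in> polynomials_upto k"
proof (induction k)
  case 0 show ?case using polynomials_upto_one by simp
next
  case (Suc k)
  have "(\<lambda>x. \<Sum>b\<in>Basis. (a \<bullet> b) * ((a \<bullet> x) ^ k * (x \<bullet> b))) \<in> polynomials_upto (Suc k)"
    by (intro polynomials_upto_sum polynomials_upto_scale polynomials_upto_mult_coordinate Suc)
  moreover have "(\<Sum>b\<in>Basis. (a \<bullet> b) * ((a \<bullet> x) ^ k * (x \<bullet> b))) = (a \<bullet> x) ^ Suc k" for x
  proof -
    have "(\<Sum>b\<in>Basis. (a \<bullet> b) * ((a \<bullet> x) ^ k * (x \<bullet> b))) = (a \<bullet> x) ^ k * (\<Sum>b\<in>Basis. (a \<bullet> b) * (x \<bullet> b))"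
      unfolding sum_distrib_left by (intro sum.cong refl) simp
    then show ?thesis by (simp add: euclidean_inner[symmetric])
  qed
  ultimately show ?case by simp
qed

section \<open>Rotation invariance of the surface measure\<close>

lemma emeasure_lborel_orthogonal_vimage:
  fixes T :: "real ^ 'n::{finite,wellorder} \<Rightarrow> real ^ 'n::{finite,wellorder}"
  assumes T: "orthogonal_transformation T" and X: "X \<in> sets borel" "bounded X"
  shows "emeasure lborel (T -` X) = emeasure lborel X"
proof -
  have bij: "bij T" using T by (rule orthogonal_transformation_bij)
  define T' where "T' = inv T"
  have T': "orthogonal_transformation T'" unfolding T'_def by (rule orthogonal_transformation_inv[OF T])
  have vi: "T -` X = T' ` X" unfolding T'_def by (rule bij_vimage_eq_inv_image[OF bij])
  have lm: "X \<in> lmeasurable" using X by (simp add: bounded_set_imp_lmeasurable)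
  have Tm: "T \<in> borel_measurable borel"
    using T by (intro borel_measurable_continuous_onI linear_continuous_on linear_conv_bounded_linear[THEN iffD1] orthogonal_transformation_linear)
  have vX: "T -` X \<in> sets borel" using measurable_sets[OF Tm X(1)] by simp
  have lm': "T' ` X \<in> lmeasurable" and eq: "measure lebesgue (T' ` X) = measure lebesgue X"
    using measurable_orthogonal_image[OF T' lm] measure_orthogonal_image[OF T' lm] by auto
  have "emeasure lebesgue (T' ` X) = emeasure lebesgue X"
    using emeasure_eq_measure2[OF lm] emeasure_eq_measure2[OF lm'] eq by simp
  then show ?thesis using vX X(1) by (simp add: vi)
qed

text \<open>A rotation taking \<open>a\<close> to \<open>b\<close> preserves the uniform
  distribution on the ball and commutes with the radial projection. The value of the integral is
  never computed; its independence of the direction suffices.\<close>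

lemma sphere_measure_inner_integral:
  fixes a b :: "real ^ 'n::{finite,wellorder}"
  assumes "norm a = norm b"
  shows "(LINT x|sphere_measure. (a \<bullet> x) ^ k) = (LINT x|sphere_measure. (b \<bullet> x) ^ k)"
proof -
  obtain T where T: "orthogonal_transformation T" "T a = b" using orthogonal_transformation_exists[OF assms] by blast
  define M where "M = uniform_measure lborel (ball 0 1 :: (real, 'n) vec set)"
  have Tm: "T \<in> borel_measurable borel"
    using T(1) by (intro borel_measurable_continuous_onI linear_continuous_on linear_conv_bounded_linear[THEN iffD1] orthogonal_transformation_linear)
  have Tm': "T \<in> measurable M borel" unfolding M_def using Tm by simp
  have inv: "distr M borel T = M"
  proof (rule measure_eqI)
    fix A assume "A \<in> sets (distr M borel T)"
    then have A: "A \<in> sets borel" by simp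
    have "emeasure (distr M borel T) A = emeasure M (T -` A)"
      using emeasure_distr[OF Tm' A] by (simp add: M_def)
    also have "\<dots> = emeasure lborel (ball 0 1 \<inter> T -` A) / emeasure lborel (ball 0 1 :: (real, 'n) vec set)"
      unfolding M_def using measurable_sets[OF Tm A] by (intro emeasure_uniform_measure) auto
    also have "ball 0 1 \<inter> T -` A = T -` (ball 0 1 \<inter> A)"
      using T(1) by (auto simp: orthogonal_transformation)
    also have "emeasure lborel (T -` (ball 0 1 \<inter> A)) = emeasure lborel (ball 0 1 \<inter> A)"
      by (rule emeasure_lborel_orthogonal_vimage[OF T(1)]) (use A in \<open>auto intro: bounded_subset[OF bounded_ball]\<close>)
    also have "emeasure lborel (ball 0 1 \<inter> A) / emeasure lborel (ball 0 1 :: (real, 'n) vec set) = emeasure M A"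
      unfolding M_def using A by (intro emeasure_uniform_measure[symmetric]) auto
    finally show "emeasure (distr M borel T) A = emeasure M A" .
  qed (simp add: M_def)
  have g: "(\<lambda>x :: (real, 'n) vec. x /\<^sub>R norm x) \<in> borel_measurable borel" by measurable
  have gM: "(\<lambda>x :: (real, 'n) vec. x /\<^sub>R norm x) \<in> measurable M borel" unfolding M_def using g by simp
  have I: "(LINT x|sphere_measure. (c \<bullet> x) ^ k) = (LINT x|M. (c \<bullet> (x /\<^sub>R norm x)) ^ k)" for c :: "(real, 'n) vec"
    unfolding sphere_measure_def M_def[symmetric] by (rule integral_distr[OF gM]) measurable
  have "(LINT x|sphere_measure. (b \<bullet> x) ^ k) = (LINT x|distr M borel T. (b \<bullet> (x /\<^sub>R norm x)) ^ k)"
    unfolding I inv ..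
  also have "\<dots> = (LINT x|M. (b \<bullet> (T x /\<^sub>R norm (T x))) ^ k)"
    by (rule integral_distr[OF Tm']) measurable
  also have "\<dots> = (LINT x|M. (a \<bullet> (x /\<^sub>R norm x)) ^ k)"
    using T by (intro Bochner_Integration.integral_cong refl)
      (auto simp: orthogonal_transformation_norm orthogonal_transformation_def)
  also have "\<dots> = (LINT x|sphere_measure. (a \<bullet> x) ^ k)" unfolding I ..
  finally show ?thesis by simp
qed

section \<open>Inversion of theta series\<close>

text \<open>Uniqueness of Fourier series for even functions. An even 1-periodic function is a
  continuous function of \<open>cos (2 * pi * x)\<close>, hence by Weierstrass a uniform limit of
  polynomials in this cosine. \<open>f\<close> is orthogonal to all of those, and therefore to
  itself.\<close>

lemma even_periodic_cos_coeffs_zero: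
  fixes f :: "real \<Rightarrow> real"
  assumes cont: "continuous_on UNIV f" and per: "\<And>x. f (x + 1) = f x" and even: "\<And>x. f (- x) = f x"
    and coeffs: "\<And>l::int. integral {0..1} (\<lambda>x. f x * cos (2 * pi * l * x)) = 0"
  shows "f x = 0"
proof -
  have contS: "continuous_on S f" for S using cont continuous_on_subset by blast
  \<comment> \<open>The product formula for cosines turns the vanishing of all cosine coefficients
    into orthogonality to the powers of one cosine.\<close>
  have int0: "integral {0..1} (\<lambda>x. f x * (cos (2 * pi * x) ^ k * cos (2 * pi * real_of_int l * x))) = 0" for k l
  proof (induction k arbitrary: l)
    case 0 then show ?case using coeffs[of l] by simp
  next
    case (Suc k)
    have eq: "f x * (cos (2 * pi * x) ^ Suc k * cos (2 * pi * real_of_int l * x)) =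
      1/2 * (f x * (cos (2 * pi * x) ^ k * cos (2 * pi * real_of_int (l + 1) * x)))
      + 1/2 * (f x * (cos (2 * pi * x) ^ k * cos (2 * pi * real_of_int (l - 1) * x)))" for x
    proof -
      have "2 * (cos (2 * pi * x) * cos (2 * pi * real_of_int l * x)) =
         cos (2 * pi * real_of_int (l + 1) * x) + cos (2 * pi * real_of_int (l - 1) * x)"
        using cos_times_cos[of "2 * pi * real_of_int l * x" "2 * pi * x"] by (simp add: algebra_simps)
      then have h: "cos (2 * pi * x) * cos (2 * pi * real_of_int l * x) =
         1/2 * cos (2 * pi * real_of_int (l + 1) * x) + 1/2 * cos (2 * pi * real_of_int (l - 1) * x)" by simp
      have "f x * (cos (2 * pi * x) ^ Suc k * cos (2 * pi * real_of_int l * x)) =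
         f x * cos (2 * pi * x) ^ k * (cos (2 * pi * x) * cos (2 * pi * real_of_int l * x))" by simp
      then show ?thesis unfolding h distrib_left by (simp only: mult_ac)
    qed
    have intg: "(\<lambda>x. 1/2 * (f x * (cos (2 * pi * x) ^ k * cos (2 * pi * real_of_int l * x)))) integrable_on {0..1}" for l
      by (intro integrable_continuous_real continuous_intros contS)
    show ?case unfolding eq
      by (subst Henstock_Kurzweil_Integration.integral_add[OF intg intg]) (simp only: integral_mult_right Suc.IH)
  qed
  \<comment> \<open>\<open>E\<close> expresses \<open>f\<close> as a function of the cosine; on the
    second half of the period this uses that \<open>f\<close> is even and periodic.\<close>
  define E where "E c = f (arccos c / (2 * pi))" for c
  have E: "E (cos (2 * pi * x)) = f x" if "x \<in> {0..1}" for x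
  proof (cases "x \<le> 1/2")
    case True
    have "arccos (cos (2 * pi * x)) = 2 * pi * x" using that True by (intro arccos_cos) auto
    then show ?thesis by (simp add: E_def)
  next
    case False
    have "cos (2 * pi * x) = cos (2 * pi * (1 - x))"
      using cos_2pi_minus[of "2 * pi * x"] by (simp add: algebra_simps)
    moreover have "arccos (cos (2 * pi * (1 - x))) = 2 * pi * (1 - x)"
      using that False by (intro arccos_cos) auto
    moreover have "f (1 - x) = f x" using per[of "- x"] even[of x] by (simp add: algebra_simps)
    ultimately show ?thesis by (simp add: E_def)
  qed
  have contE: "continuous_on {-1..1} E"
    unfolding E_def
    by (rule continuous_on_compose2[OF cont]) (auto intro!: continuous_intros continuous_on_arccos')
  define K where "K = integral {0..1} (\<lambda>x. \<bar>f x\<bar>)"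
  have sq0: "integral {0..1} (\<lambda>x. f x * f x) \<le> e * K" if e: "e > 0" for e
  proof -
    obtain p where p: "real_polynomial_function p" "\<And>c. c \<in> {-1..1} \<Longrightarrow> \<bar>E c - p c\<bar> < e"
      using Stone_Weierstrass_real_polynomial_function[OF _ contE e] by auto
    obtain a n where p_eq: "p = (\<lambda>c. \<Sum>i\<le>n. a i * c ^ i)"
      using p(1) unfolding real_polynomial_function_iff_sum by blast
    have pc: "integral {0..1} (\<lambda>x. f x * p (cos (2 * pi * x))) = 0"
    proof -
      have "integral {0..1} (\<lambda>x. f x * p (cos (2 * pi * x)))
          = integral {0..1} (\<lambda>x. \<Sum>i\<le>n. a i * (f x * cos (2 * pi * x) ^ i))"
        by (intro Henstock_Kurzweil_Integration.integral_cong) (simp add: p_eq sum_distrib_left mult_ac)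
      also have "\<dots> = (\<Sum>i\<le>n. integral {0..1} (\<lambda>x. a i * (f x * cos (2 * pi * x) ^ i)))"
        by (intro Henstock_Kurzweil_Integration.integral_sum integrable_continuous_real continuous_intros contS) auto
      also have "\<dots> = 0" using int0[of _ 0] by simp
      finally show ?thesis .
    qed
    have contp: "continuous_on {0..1} (\<lambda>x. p (cos (2 * pi * x)))"
      unfolding p_eq by (intro continuous_intros)
    have "integral {0..1} (\<lambda>x. f x * f x) = integral {0..1} (\<lambda>x. f x * f x - f x * p (cos (2 * pi * x)))"
      using pc contp by (subst Henstock_Kurzweil_Integration.integral_diff)
        (auto intro!: integrable_continuous_real continuous_intros contS)
    also have "\<dots> \<le> integral {0..1} (\<lambda>x. e * \<bar>f x\<bar>)"
    proof (rule integral_le)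
      show "(\<lambda>x. f x * f x - f x * p (cos (2 * pi * x))) integrable_on {0..1}"
        using contp by (intro integrable_continuous_real continuous_intros contS)
      show "(\<lambda>x. e * \<bar>f x\<bar>) integrable_on {0..1}"
        by (intro integrable_continuous_real continuous_intros contS)
      fix x :: real assume x: "x \<in> {0..1}"
      have "\<bar>f x - p (cos (2 * pi * x))\<bar> \<le> e"
        using p(2)[of "cos (2 * pi * x)"] E[OF x] by auto
      then have "\<bar>f x\<bar> * \<bar>f x - p (cos (2 * pi * x))\<bar> \<le> \<bar>f x\<bar> * e" by (intro mult_left_mono) auto
      then show "f x * f x - f x * p (cos (2 * pi * x)) \<le> e * \<bar>f x\<bar>"
        by (simp add: abs_mult[symmetric] algebra_simps)
    qed
    also have "\<dots> = e * K" by (simp add: K_def)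
    finally show ?thesis .
  qed
  have Knn: "K \<ge> 0" unfolding K_def
    by (intro Henstock_Kurzweil_Integration.integral_nonneg integrable_continuous_real continuous_intros contS) auto
  have "integral {0..1} (\<lambda>x. f x * f x) \<le> 0"
  proof (rule field_le_epsilon)
    fix e :: real assume "e > 0"
    then have "integral {0..1} (\<lambda>x. f x * f x) \<le> e / (K + 1) * K" using Knn by (intro sq0) auto
    also have "\<dots> \<le> e" using Knn \<open>e > 0\<close> by (simp add: divide_simps)
    finally show "integral {0..1} (\<lambda>x. f x * f x) \<le> 0 + e" by simp
  qed
  moreover have "integral {0..1} (\<lambda>x. f x * f x) \<ge> 0"
    by (intro Henstock_Kurzweil_Integration.integral_nonneg integrable_continuous_real continuous_intros contS) auto
  ultimately have "integral {0..1} (\<lambda>x. f x * f x) = 0" by simp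
  then have f0: "f x = 0" if "x \<in> {0..1}" for x
    using that by (subst (asm) integral_eq_0_iff) (auto intro!: continuous_intros contS)
  have pern: "f (x + real n) = f x" for x n
    by (induction n) (use per in \<open>auto simp: add.assoc[symmetric] add.commute[of 1]\<close>)
  have "f (frac x) = f x"
  proof (cases "\<lfloor>x\<rfloor> \<ge> 0")
    case True
    then show ?thesis using pern[of "frac x" "nat \<lfloor>x\<rfloor>"] by (simp add: frac_def)
  next
    case False
    then show ?thesis using pern[of x "nat (- \<lfloor>x\<rfloor>)"] by (simp add: frac_def)
  qed
  then show ?thesis using f0[of "frac x"] frac_lt_1[of x] by (simp add: less_imp_le)
qed

section \<open>Poisson summation for one-dimensional Gaussians\<close>

lemma summable_on_abs_le:
  fixes f g :: "'a \<Rightarrow> real"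
  assumes "g summable_on A" "\<And>x. x \<in> A \<Longrightarrow> \<bar>f x\<bar> \<le> g x"
  shows "f summable_on A"
proof -
  have "(\<lambda>x. norm (f x)) summable_on A"
    by (rule summable_on_comparison_test[OF assms(1)]) (use assms(2) in auto)
  then show ?thesis by (rule abs_summable_summable)
qed

lemma summable_on_int_gaussian:
  fixes c :: real assumes "c > 0"
  shows "(\<lambda>n::int. exp (- c * (real_of_int n)^2)) summable_on UNIV"
proof -
  have s: "(\<lambda>n::nat. exp (- c * (real n)^2)) summable_on UNIV"
  proof (rule summable_on_comparison_test)
    have "summable (\<lambda>n. exp (- c) ^ n)" using assms by (intro summable_geometric) auto
    then show "(\<lambda>n. exp (- c) ^ n) summable_on UNIV"
      by (intro norm_summable_imp_summable_on) auto
    fix n :: nat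
    have "real n \<le> (real n)^2" by (cases n) (auto simp: power2_eq_square)
    then have "- c * (real n)^2 \<le> real n * (- c)" using assms by simp
    then show "exp (- c * (real n)^2) \<le> exp (- c) ^ n"
      by (simp only: exp_of_nat_mult[symmetric] exp_le_cancel_iff)
  qed auto
  have "range int \<union> range (\<lambda>n. - int n) = UNIV"
  proof (intro UNIV_eq_I[symmetric])
    fix x :: int show "x \<in> range int \<union> range (\<lambda>n. - int n)" by (cases x rule: int_cases2) auto
  qed
  moreover have "(\<lambda>n::int. exp (- c * (real_of_int n)^2)) summable_on range int"
    by (subst summable_on_reindex) (use s in \<open>auto simp: o_def\<close>)
  moreover have "(\<lambda>n::int. exp (- c * (real_of_int n)^2)) summable_on range (\<lambda>n. - int n)"
    by (subst summable_on_reindex) (use s in \<open>auto simp: o_def inj_on_def\<close>)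
  ultimately show ?thesis by (metis summable_on_union)
qed

text \<open>The integral is the real part of the characteristic function of the standard normal
  distribution, after rescaling \<open>x\<close> by \<open>k = sqrt (2 * pi * a)\<close>.\<close>

lemma gaussian_cos_integral:
  fixes a l :: real assumes "a > 0"
  shows "integrable lborel (\<lambda>x. exp (- pi * a * x^2) * cos (2 * pi * l * x))"
    "(LINT x|lborel. exp (- pi * a * x^2) * cos (2 * pi * l * x)) = exp (- pi * l^2 / a) / sqrt a"
proof -
  define k where "k = sqrt (2 * pi * a)"
  have k: "k > 0" "k^2 = 2 * pi * a" using assms by (auto simp: k_def)
  define t where "t = 2 * pi * l / k"
  interpret real_distribution std_normal_distribution by (rule real_dist_normal_dist)
  have "integrable lborel (\<lambda>x. std_normal_density x)" by simp
  then have int1: "integrable lborel (\<lambda>x. std_normal_density x * cos (t * x))"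
    by (rule Bochner_Integration.integrable_bound) (auto simp: abs_mult mult_left_le)
  have "Re (char std_normal_distribution t) = (LINT x|std_normal_distribution. cos (t * x))"
    unfolding char_def
    by (subst integral_Re[symmetric]) (auto intro!: integrable_iexp simp: Re_exp)
  then have L: "(LINT x|lborel. std_normal_density x * cos (t * x)) = exp (- (t^2) / 2)"
    unfolding char_std_normal_distribution
    by (subst (asm) integral_density) (auto simp: normal_density_nonneg)
  have eq: "std_normal_density (k * x) * cos (t * (k * x)) = (1 / sqrt (2 * pi)) * (exp (- pi * a * x^2) * cos (2 * pi * l * x))" for x
    using k by (simp add: normal_density_def t_def power_mult_distrib mult.assoc)
  have int2: "integrable lborel (\<lambda>x. std_normal_density (0 + k * x) * cos (t * (0 + k * x)))"
    using k by (subst lborel_integrable_real_affine_iff) (use int1 in auto)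
  show i: "integrable lborel (\<lambda>x. exp (- pi * a * x^2) * cos (2 * pi * l * x))"
  proof -
    have "integrable lborel (\<lambda>x. sqrt (2 * pi) * ((1 / sqrt (2 * pi)) * (exp (- pi * a * x^2) * cos (2 * pi * l * x))))"
      using int2 unfolding add_0 eq by (rule integrable_mult_right)
    then show ?thesis by simp
  qed
  have "exp (- (t^2) / 2) = k * (LINT x|lborel. std_normal_density (0 + k * x) * cos (t * (0 + k * x)))"
    using lborel_integral_real_affine[of k "\<lambda>x. std_normal_density x * cos (t * x)" 0] k L by simp
  also have "\<dots> = k / sqrt (2 * pi) * (LINT x|lborel. exp (- pi * a * x^2) * cos (2 * pi * l * x))"
    unfolding add_0 eq by simp
  also have "k / sqrt (2 * pi) = sqrt a" by (simp add: k_def real_sqrt_mult)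
  finally have fin: "exp (- (t^2) / 2) = sqrt a * (LINT x|lborel. exp (- pi * a * x^2) * cos (2 * pi * l * x))" .
  have ex: "- (t^2) / 2 = - pi * l^2 / a"
    using k by (simp add: t_def power_divide power_mult_distrib power2_eq_square[of pi])
  have sa: "sqrt a \<noteq> 0" using assms by simp
  show "(LINT x|lborel. exp (- pi * a * x^2) * cos (2 * pi * l * x)) = exp (- pi * l^2 / a) / sqrt a"
    by (rule eq_divide_imp[OF sa]) (simp only: ex[symmetric] fin mult.commute)
qed

text \<open>From \<open>n^2 \<le> 2 * (n + x)^2 + 2 * x^2\<close>. At the price of half the exponent
  the majorant is uniform on bounded sets of \<open>x\<close>, as the Weierstrass test
  requires.\<close>

lemma gaussian_shift_bound:
  fixes a x R :: real and n :: int
  assumes "a > 0" "\<bar>x\<bar> \<le> R"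
  shows "exp (- pi * a * (n + x)^2) \<le> exp (pi * a * R^2) * exp (- (pi * a / 2) * n^2)"
proof -
  have "x^2 \<le> R^2" using assms(2) by (metis abs_le_square_iff abs_of_nonneg abs_ge_zero order.trans)
  moreover have "(real_of_int n)^2 \<le> 2 * (n + x)^2 + 2 * x^2"
    using zero_le_power2[of "real_of_int n + 2 * x"] by (simp add: power2_eq_square algebra_simps)
  ultimately have "(real_of_int n)^2 \<le> 2 * (n + x)^2 + 2 * R^2" by linarith
  then have "pi * a * (real_of_int n)^2 \<le> pi * a * (2 * (n + x)^2 + 2 * R^2)"
    using assms(1) by (intro mult_left_mono) auto
  then have "- pi * a * (n + x)^2 \<le> pi * a * R^2 + (- (pi * a / 2) * n^2)"
    by (simp add: algebra_simps)
  then show ?thesis by (simp only: exp_add[symmetric] exp_le_cancel_iff)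
qed

lemma summable_on_gaussian_bound:
  fixes a R :: real assumes "a > 0"
  shows "(\<lambda>n::int. exp (pi * a * R^2) * exp (- (pi * a / 2) * n^2)) summable_on UNIV"
  using assms by (intro summable_on_cmult_right summable_on_int_gaussian) auto

lemma summable_on_gaussian_shift:
  fixes a x :: real assumes "a > 0"
  shows "(\<lambda>n::int. exp (- pi * a * (n + x)^2)) summable_on UNIV"
  by (rule summable_on_comparison_test[OF summable_on_gaussian_bound[OF assms, of "\<bar>x\<bar>"]])
     (use gaussian_shift_bound[OF assms order.refl] in auto)

definition gauss_theta :: "real \<Rightarrow> real \<Rightarrow> real" where
  "gauss_theta a x = (\<Sum>\<^sub>\<infinity>n\<in>(UNIV::int set). exp (- pi * a * (real_of_int n + x)^2))"

lemma gauss_theta_periodic: "gauss_theta a (x + 1) = gauss_theta a x"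
  unfolding gauss_theta_def
  by (rule infsum_reindex_bij_witness[of _ "\<lambda>n. n - 1" "\<lambda>n. n + 1"]) (auto simp: algebra_simps)

lemma gauss_theta_even: "gauss_theta a (- x) = gauss_theta a x"
  unfolding gauss_theta_def
  by (rule infsum_reindex_bij_witness[of _ "\<lambda>n. - n" "\<lambda>n. - n"]) (auto simp: power2_eq_square algebra_simps)

lemma continuous_on_gauss_theta:
  assumes "a > 0" shows "continuous_on UNIV (gauss_theta a)"
proof -
  have "continuous_on {-R..R} (gauss_theta a)" for R
  proof (rule uniform_limit_theorem)
    show "uniform_limit {-R..R} (\<lambda>X x. \<Sum>n\<in>X. exp (- pi * a * (real_of_int n + x)^2)) (gauss_theta a) (finite_subsets_at_top UNIV)"
      unfolding gauss_theta_def[abs_def]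
      by (rule Weierstrass_m_test_general[OF _ summable_on_gaussian_bound[OF assms, of R]])
         (use gaussian_shift_bound[OF assms, of _ R] in auto)
  qed (auto intro!: always_eventually continuous_intros)
  then have "isCont (gauss_theta a) x" for x
    by (rule continuous_on_interior[of "{-(\<bar>x\<bar>+1)..\<bar>x\<bar>+1}"]) auto
  then show ?thesis by (simp add: continuous_at_imp_continuous_on)
qed

lemma cos_int_integral:
  "integral {0..1} (\<lambda>x. cos (2 * pi * real_of_int k * x)) = (if k = 0 then 1 else 0)"
proof (cases "k = 0")
  case False
  have "((\<lambda>x. cos (2 * pi * real_of_int k * x)) has_integral
     sin (2 * pi * real_of_int k * 1) / (2 * pi * k) - sin (2 * pi * real_of_int k * 0) / (2 * pi * k)) {0..1}"
    using False by (intro fundamental_theorem_of_calculus)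
      (auto intro!: derivative_eq_intros simp flip: has_real_derivative_iff_has_vector_derivative)
  moreover have "sin (2 * pi * real_of_int k * 1) = 0"
    using sin_int_2pin[of k] by simp
  ultimately show ?thesis using False by (simp add: integral_unique)
qed simp

text \<open>For \<open>m = l = 0\<close> both conditions hold and the two halves add up to
  1.\<close>

lemma cos_cos_int_integral:
  "integral {0..1} (\<lambda>x. cos (2 * pi * real_of_int m * x) * cos (2 * pi * real_of_int l * x)) =
     (if m = l then 1/2 else 0) + (if m = - l then 1/2 else 0)"
proof -
  have "cos (2 * pi * real_of_int m * x) * cos (2 * pi * real_of_int l * x) =
     (1/2) * cos (2 * pi * real_of_int (m - l) * x) + (1/2) * cos (2 * pi * real_of_int (m + l) * x)" for x
    using cos_times_cos[of "2 * pi * real_of_int m * x" "2 * pi * real_of_int l * x"] by (simp add: algebra_simps)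
  then have "integral {0..1} (\<lambda>x. cos (2 * pi * real_of_int m * x) * cos (2 * pi * real_of_int l * x)) =
    (1/2) * integral {0..1} (\<lambda>x. cos (2 * pi * real_of_int (m - l) * x)) + (1/2) * integral {0..1} (\<lambda>x. cos (2 * pi * real_of_int (m + l) * x))"
    by (simp only:) (subst Henstock_Kurzweil_Integration.integral_add,
       auto intro!: integrable_continuous_real continuous_intros simp del: of_int_add of_int_diff)
  then show ?thesis unfolding cos_int_integral by auto
qed

lemma int_unit_integrals:
  fixes f :: "real \<Rightarrow> real"
  assumes "continuous_on UNIV f"
  shows "(\<Sum>n\<in>{- int N..int N}. integral {of_int n..of_int n + 1} f) = integral {- real N..real N + 1} f"
proof (induction N)
  case (Suc N)
  have int: "f integrable_on {c..d}" for c d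
    using assms by (intro integrable_continuous_real) (auto intro: continuous_on_subset)
  have set: "{- int (Suc N)..int (Suc N)} = insert (- int (Suc N)) (insert (int (Suc N)) {- int N..int N})" by auto
  have "integral {- real (Suc N)..real (Suc N) + 1} f = integral {- real (Suc N)..- real N} f
     + (integral {- real N..real N + 1} f + integral {real N + 1..real (Suc N) + 1} f)"
    using int by (simp add: Henstock_Kurzweil_Integration.integral_combine)
  then show ?case unfolding set using Suc.IH by (simp add: add.commute algebra_simps)
qed simp

lemma integral_intervals_tendsto:
  fixes f :: "real \<Rightarrow> real"
  assumes "continuous_on UNIV f" "integrable lborel f"
  shows "(\<lambda>N. integral {- real N..real N + 1} f) \<longlonglongrightarrow> (LINT x|lborel. f x)"
proof -
  have "(\<lambda>N. LINT x|lborel. indicator {- real N..real N + 1} x * f x) \<longlonglongrightarrow> (LINT x|lborel. f x)"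
  proof (rule integral_dominated_convergence[where w = "\<lambda>x. \<bar>f x\<bar>"])
    show "AE x in lborel. (\<lambda>N. indicator {- real N..real N + 1} x * f x) \<longlonglongrightarrow> f x"
    proof (rule AE_I2)
      fix x :: real
      have "eventually (\<lambda>N. indicator {- real N..real N + 1} x * f x = f x) sequentially"
        using eventually_ge_at_top[of "nat \<lceil>\<bar>x\<bar>\<rceil>"]
        by eventually_elim (auto simp: indicator_def abs_le_iff nat_le_iff ceiling_le_iff)
      then show "(\<lambda>N. indicator {- real N..real N + 1} x * f x) \<longlonglongrightarrow> f x" by (rule tendsto_eventually)
    qed
  qed (use assms in \<open>auto simp: indicator_def borel_measurable_continuous_onI\<close>)
  moreover have "(LINT x|lborel. indicator {- real N..real N + 1} x * f x) = integral {- real N..real N + 1} f" for N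
  proof -
    have "set_integrable lborel {- real N..real N + 1} f"
      using assms(2) unfolding set_integrable_def by (intro integrable_mult_indicator) auto
    from set_borel_integral_eq_integral(2)[OF this] show ?thesis
      by (simp add: set_lebesgue_integral_def)
  qed
  ultimately show ?thesis by simp
qed

lemma filterlim_int_intervals:
  "filterlim (\<lambda>N::nat. {- int N..int N}) (finite_subsets_at_top UNIV) sequentially"
  unfolding filterlim_finite_subsets_at_top
proof (intro allI impI)
  fix X :: "int set" assume X: "finite X \<and> X \<subseteq> UNIV"
  then obtain B where B: "\<And>x. x \<in> X \<Longrightarrow> \<bar>x\<bar> \<le> B"
    by (metis finite_imageI Max_ge imageI)
  show "\<forall>\<^sub>F N in sequentially. finite {- int N..int N} \<and> X \<subseteq> {- int N..int N} \<and> {- int N..int N} \<subseteq> UNIV"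
    using eventually_ge_at_top[of "nat B"]
    by eventually_elim (use B in \<open>force simp: nat_le_iff abs_le_iff\<close>)
qed

text \<open>Unfolding: the integrals of the summands over the unit interval are those of one
  Gaussian times a cosine over consecutive unit intervals, and add up to an integral over the line.
  The sine part drops out because it is odd, which leaves the factor
  \<open>cos (2 * pi * l * x0)\<close>.\<close>

lemma gauss_theta_coeff:
  fixes l :: int
  assumes "a > 0"
  shows "integral {0..1} (\<lambda>x. gauss_theta a (x0 + x) * cos (2 * pi * l * x)) =
    exp (- pi * l^2 / a) / sqrt a * cos (2 * pi * l * x0)"
proof -
  define p where "p n x = exp (- pi * a * (real_of_int n + (x0 + x))^2) * cos (2 * pi * real_of_int l * x)" for n x
  define q where "q x = exp (- pi * a * x^2) * cos (2 * pi * real_of_int l * (x - x0))" for x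
  have ul: "uniform_limit {0..1} (\<lambda>X x. \<Sum>n\<in>X. p n x) (\<lambda>x. \<Sum>\<^sub>\<infinity>n. p n x) (finite_subsets_at_top UNIV)"
  proof (rule Weierstrass_m_test_general[OF _ summable_on_gaussian_bound[OF assms, of "\<bar>x0\<bar> + 1"]])
    fix n :: int and x :: real assume "x \<in> {0..1}"
    then have "\<bar>x0 + x\<bar> \<le> \<bar>x0\<bar> + 1" by auto
    from gaussian_shift_bound[OF assms this, of n]
    show "norm (p n x) \<le> exp (pi * a * (\<bar>x0\<bar> + 1)\<^sup>2) * exp (- (pi * a / 2) * (real_of_int n)\<^sup>2)"
      unfolding p_def real_norm_def abs_mult
      by (intro order.trans[OF mult_left_le]) auto
  qed
  have sum_eq: "(\<Sum>\<^sub>\<infinity>n. p n x) = gauss_theta a (x0 + x) * cos (2 * pi * l * x)" for x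
    unfolding gauss_theta_def p_def by (subst infsum_cmult_left') simp
  have cp: "continuous_on {0..1} (p n)" for n unfolding p_def by (intro continuous_intros)
  have cs: "continuous_on {0..1} (\<lambda>x. \<Sum>n\<in>X. p n x)" for X by (intro continuous_on_sum cp)
  obtain I J where IJ: "\<And>X. ((\<lambda>x. \<Sum>n\<in>X. p n x) has_integral I X) {0..1}"
    "((\<lambda>x. \<Sum>\<^sub>\<infinity>n. p n x) has_integral J) {0..1}" "(I \<longlongrightarrow> J) (finite_subsets_at_top UNIV)"
    by (rule uniform_limit_integral[OF ul cs finite_subsets_at_top_neq_bot]) blast
  have cq: "continuous_on S q" for S unfolding q_def by (intro continuous_intros)
  have pq: "integral {0..1} (p n) = integral {real_of_int n + x0..real_of_int n + x0 + 1} q" for n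
  proof -
    have "p n x = q (x + (real_of_int n + x0))" for x
    proof -
      have "cos (2 * pi * real_of_int l * (x + real_of_int n)) = cos (2 * pi * real_of_int l * x + 2 * pi * real_of_int (l * n))"
        by (simp add: algebra_simps)
      also have "\<dots> = cos (2 * pi * real_of_int l * x)"
        using cos_int_2pin[of "l * n"] sin_int_2pin[of "l * n"] by (simp add: cos_add)
      finally show ?thesis by (simp add: p_def q_def algebra_simps)
    qed
    then have "integral {0..1} (p n) = integral {0..1} (\<lambda>x. q (x + (real_of_int n + x0)))" by presburger
    also have "\<dots> = integral {real_of_int n + x0..real_of_int n + x0 + 1} q"
      using integral_shift_Icc_real[where f = q and a = 0 and b = 1 and c = "real_of_int n + x0"]
      by (simp add: o_def add.commute)
    finally show ?thesis .
  qed
  \<comment> \<open>The offset \<open>x0\<close> is moved into the function so that the unit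
    intervals begin at integers.\<close>
  define q' where "q' x = q (x + x0)" for x
  have cq': "continuous_on UNIV q'" unfolding q'_def q_def by (intro continuous_intros)
  have pq': "integral {0..1} (p n) = integral {of_int n..of_int n + 1} q'" for n
    using integral_shift_Icc_real[where f = q and a = "of_int n" and b = "of_int n + 1" and c = x0]
    unfolding pq q'_def[abs_def] by (simp add: o_def algebra_simps)
  have "I X = (\<Sum>n\<in>X. integral {of_int n..of_int n + 1} q')" for X
  proof -
    have "I X = integral {0..1} (\<lambda>x. \<Sum>n\<in>X. p n x)" using integral_unique[OF IJ(1)] by simp
    also have "\<dots> = (\<Sum>n\<in>X. integral {0..1} (p n))"
    proof (cases "finite X")
      case True then show ?thesis
        by (intro Henstock_Kurzweil_Integration.integral_sum integrable_continuous_real cp)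
    qed simp
    finally show ?thesis by (simp add: pq')
  qed
  then have "(\<lambda>N. integral {- real N..real N + 1} q') \<longlonglongrightarrow> J"
    using filterlim_compose[OF IJ(3) filterlim_int_intervals] by (simp add: int_unit_integrals[OF cq'])
  moreover
  have q_eq: "q x = cos (2 * pi * l * x0) * (exp (- pi * a * x^2) * cos (2 * pi * l * x)) + sin (2 * pi * l * x0) * (exp (- pi * a * x^2) * sin (2 * pi * l * x))" for x
    unfolding q_def by (simp add: right_diff_distrib cos_diff algebra_simps)
  have intc: "integrable lborel (\<lambda>x. exp (- pi * a * x^2) * cos (2 * pi * real_of_int l * x))"
    by (rule gaussian_cos_integral(1)[OF assms])
  have ints: "integrable lborel (\<lambda>x. exp (- pi * a * x^2) * sin (2 * pi * real_of_int l * x))"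
    using gaussian_cos_integral(1)[OF assms, of 0]
    by (rule Bochner_Integration.integrable_bound) (auto simp: abs_mult mult_left_le)
  have odd: "(LINT x|lborel. exp (- pi * a * x^2) * sin (2 * pi * real_of_int l * x)) = 0"
    using lborel_integral_real_affine[of "-1" "\<lambda>x. exp (- pi * a * x^2) * sin (2 * pi * real_of_int l * x)" 0] by simp
  have intq: "integrable lborel q" unfolding q_eq[abs_def] using intc ints by auto
  have Lq: "(LINT x|lborel. q x) = exp (- pi * l^2 / a) / sqrt a * cos (2 * pi * l * x0)"
    unfolding q_eq using intc ints odd gaussian_cos_integral(2)[OF assms, of "real_of_int l"] by simp
  have intq': "integrable lborel q'"
    using lborel_integrable_real_affine[OF intq, of 1 x0] by (simp add: q'_def[abs_def] add.commute)
  have "(LINT x|lborel. q' x) = (LINT x|lborel. q x)"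
    using lborel_integral_real_affine[of 1 q x0] by (simp add: q'_def add.commute)
  then have "(\<lambda>N. integral {- real N..real N + 1} q') \<longlonglongrightarrow> exp (- pi * l^2 / a) / sqrt a * cos (2 * pi * l * x0)"
    using integral_intervals_tendsto[OF cq' intq'] Lq by simp
  ultimately have "J = exp (- pi * l^2 / a) / sqrt a * cos (2 * pi * l * x0)" by (rule LIMSEQ_unique)
  then show ?thesis using IJ(2) unfolding sum_eq by (simp add: integral_unique)
qed

text \<open>The translates of the theta function by \<open>x0\<close> and \<open>- x0\<close> are
  added to obtain an even function of \<open>x\<close>, which its cosine coefficients determine.
  These already carry the factor \<open>cos (2 * pi * l * x0)\<close>, so comparison with the series
  \<open>G\<close> at \<open>x = 0\<close> yields the formula at \<open>x0\<close>.\<close>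

theorem gauss_theta_inversion:
  assumes a: "a > 0"
  shows "((\<lambda>l::int. exp (- pi * l^2 / a) / sqrt a * cos (2 * pi * l * x0)) has_sum gauss_theta a x0) UNIV"
proof -
  define c where "c l = exp (- pi * (real_of_int l)^2 / a) / sqrt a * cos (2 * pi * real_of_int l * x0)" for l
  define M where "M l = exp (- (pi / a) * (real_of_int l)^2) * (1 / sqrt a)" for l
  have M: "M summable_on UNIV"
    unfolding M_def by (intro summable_on_cmult_left summable_on_int_gaussian) (use a in auto)
  have cM: "\<bar>c l\<bar> \<le> M l" for l
  proof -
    have "\<bar>c l\<bar> = M l * \<bar>cos (2 * pi * real_of_int l * x0)\<bar>"
      using a by (simp add: c_def M_def abs_mult)
    moreover have "M l \<ge> 0" using a by (simp add: M_def)
    ultimately show ?thesis by (simp add: mult_left_le)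
  qed
  have ccM: "norm (c l * cos y) \<le> M l" for l y
    using cM[of l] mult_left_le[of "\<bar>cos y\<bar>" "\<bar>c l\<bar>"] by (auto simp: abs_mult)
  define G where "G x = (\<Sum>\<^sub>\<infinity>m. c m * cos (2 * pi * real_of_int m * x))" for x
  have contG: "continuous_on UNIV G"
  proof (rule uniform_limit_theorem)
    show "uniform_limit UNIV (\<lambda>X x. \<Sum>m\<in>X. c m * cos (2 * pi * real_of_int m * x)) G (finite_subsets_at_top UNIV)"
      unfolding G_def[abs_def] by (rule Weierstrass_m_test_general[OF _ M]) (rule ccM)
  qed (auto intro!: always_eventually continuous_intros)
  have coeffG: "integral {0..1} (\<lambda>x. G x * cos (2 * pi * real_of_int l * x)) = c l" for l
  proof -
    define p where "p m x = c m * cos (2 * pi * real_of_int m * x) * cos (2 * pi * real_of_int l * x)" for m x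
    have ul: "uniform_limit {0..1} (\<lambda>X x. \<Sum>n\<in>X. p n x) (\<lambda>x. \<Sum>\<^sub>\<infinity>n. p n x) (finite_subsets_at_top UNIV)"
      by (rule Weierstrass_m_test_general[OF _ M]) (use ccM in \<open>auto simp: p_def abs_mult intro: order.trans[OF mult_left_le]\<close>)
    have sum_eq: "(\<Sum>\<^sub>\<infinity>n. p n x) = G x * cos (2 * pi * real_of_int l * x)" for x
      unfolding G_def p_def by (subst infsum_cmult_left') simp
    have cp: "continuous_on {0..1} (p n)" for n unfolding p_def by (intro continuous_intros)
    have cs: "continuous_on {0..1} (\<lambda>x. \<Sum>n\<in>X. p n x)" for X by (intro continuous_on_sum cp)
    obtain I J where IJ: "\<And>X. ((\<lambda>x. \<Sum>n\<in>X. p n x) has_integral I X) {0..1}"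
      "((\<lambda>x. \<Sum>\<^sub>\<infinity>n. p n x) has_integral J) {0..1}" "(I \<longlongrightarrow> J) (finite_subsets_at_top UNIV)"
      by (rule uniform_limit_integral[OF ul cs finite_subsets_at_top_neq_bot]) blast
    have ip: "integral {0..1} (p m) = c m * ((if m = l then 1/2 else 0) + (if m = - l then 1/2 else 0))" for m
    proof -
      have "integral {0..1} (p m) = integral {0..1} (\<lambda>x. c m * (cos (2 * pi * real_of_int m * x) * cos (2 * pi * real_of_int l * x)))"
        by (simp add: p_def[abs_def] mult.assoc)
      then show ?thesis unfolding integral_mult_right cos_cos_int_integral .
    qed
    have "I X = (\<Sum>n\<in>X. integral {0..1} (p n))" if "finite X" for X
    proof -
      have "I X = integral {0..1} (\<lambda>x. \<Sum>n\<in>X. p n x)" using integral_unique[OF IJ(1)] by simp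
      also have "\<dots> = (\<Sum>n\<in>X. integral {0..1} (p n))"
        using that by (intro Henstock_Kurzweil_Integration.integral_sum integrable_continuous_real cp)
      finally show ?thesis .
    qed
    note IX = this
    \<comment> \<open>Once \<open>X\<close> contains both \<open>l\<close> and \<open>- l\<close>,
      the partial sums are constant: the two halves from the orthogonality relations add up to
      \<open>c l\<close>.\<close>
    have "I X = c l" if X: "finite X \<and> {l, - l} \<subseteq> X" for X
    proof -
      have ev: "c (- l) = c l" by (simp add: c_def)
      have "I X = (\<Sum>m\<in>X. if m = l then c m / 2 else 0) + (\<Sum>m\<in>X. if m = - l then c m / 2 else 0)"
        using X unfolding sum.distrib[symmetric] by (subst IX) (auto intro!: sum.cong simp: ip algebra_simps)
      then show ?thesis using X by (simp add: sum.delta ev)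
    qed
    then have "eventually (\<lambda>X. I X = c l) (finite_subsets_at_top UNIV)"
      unfolding eventually_finite_subsets_at_top by (intro exI[of _ "{l, - l}"]) auto
    then have "(I \<longlongrightarrow> c l) (finite_subsets_at_top UNIV)" by (rule tendsto_eventually)
    then have "J = c l" by (rule tendsto_unique[OF finite_subsets_at_top_neq_bot IJ(3)])
    then show ?thesis using IJ(2) unfolding sum_eq by (simp add: integral_unique)
  qed
  define e where "e x = gauss_theta a (x0 + x) + gauss_theta a (- x0 + x) - 2 * G x" for x
  have ct: "continuous_on S (\<lambda>x. gauss_theta a (y + x))" for S y
    by (rule continuous_on_compose2[OF continuous_on_gauss_theta[OF a]]) (auto intro!: continuous_intros)
  have cG: "continuous_on S G" for S using contG continuous_on_subset by blast
  have G1: "G (x + 1) = G x" for x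
    unfolding G_def
  proof (rule infsum_cong)
    fix m :: int
    have "2 * pi * real_of_int m * (x + 1) = 2 * pi * real_of_int m * x + 2 * pi * real_of_int m" by (simp add: algebra_simps)
    then show "c m * cos (2 * pi * real_of_int m * (x + 1)) = c m * cos (2 * pi * real_of_int m * x)"
      using cos_int_2pin[of m] sin_int_2pin[of m] by (simp add: cos_add)
  qed
  have "e 0 = 0"
  proof (rule even_periodic_cos_coeffs_zero[where f = e])
    show "continuous_on UNIV e" unfolding e_def[abs_def] by (intro continuous_intros ct cG)
    show "e (x + 1) = e x" for x
      by (simp only: e_def add.assoc[symmetric] gauss_theta_periodic G1)
    show "e (- x) = e x" for x
      using gauss_theta_even[of a "x0 + x"] gauss_theta_even[of a "- x0 + x"] by (simp add: e_def G_def algebra_simps)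
    fix l :: int
    have "integral {0..1} (\<lambda>x. e x * cos (2 * pi * real_of_int l * x)) =
      integral {0..1} (\<lambda>x. gauss_theta a (x0 + x) * cos (2 * pi * real_of_int l * x))
      + integral {0..1} (\<lambda>x. gauss_theta a (- x0 + x) * cos (2 * pi * real_of_int l * x))
      - integral {0..1} (\<lambda>x. 2 * (G x * cos (2 * pi * real_of_int l * x)))"
      unfolding e_def left_diff_distrib distrib_right mult.assoc
      by (subst Henstock_Kurzweil_Integration.integral_diff Henstock_Kurzweil_Integration.integral_add;
          (intro integrable_continuous_real continuous_intros ct cG)?)+ simp
    also have "\<dots> = 0" unfolding gauss_theta_coeff[OF a] integral_mult_right coeffG by (simp add: c_def)
    finally show "integral {0..1} (\<lambda>x. e x * cos (2 * pi * real_of_int l * x)) = 0" .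
  qed
  then have "gauss_theta a x0 = G 0" using gauss_theta_even[of a x0] by (simp add: e_def)
  moreover have "c summable_on UNIV"
    using cM by (intro summable_on_abs_le[OF M]) auto
  ultimately show ?thesis unfolding G_def c_def[symmetric] by simp
qed

section \<open>Poisson summation for self-dual lattices\<close>

locale unimodular_lattice =
  fixes \<Lambda> :: "'a::euclidean_space set"
  assumes zero_mem: "0 \<in> \<Lambda>"
    and add_mem: "x \<in> \<Lambda> \<Longrightarrow> y \<in> \<Lambda> \<Longrightarrow> x + y \<in> \<Lambda>"
    and uminus_mem: "x \<in> \<Lambda> \<Longrightarrow> - x \<in> \<Lambda>"
    and integral_mem: "x \<in> \<Lambda> \<Longrightarrow> y \<in> \<Lambda> \<Longrightarrow> x \<bullet> y \<in> \<int>"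
    and dual_mem: "(\<And>y. y \<in> \<Lambda> \<Longrightarrow> x \<bullet> y \<in> \<int>) \<Longrightarrow> x \<in> \<Lambda>"
    and span_lattice: "span \<Lambda> = UNIV"
begin

lemma diff_mem: "x \<in> \<Lambda> \<Longrightarrow> y \<in> \<Lambda> \<Longrightarrow> x - y \<in> \<Lambda>"
  using add_mem[of x "- y"] uminus_mem[of y] by simp

lemma of_int_scale_mem: "x \<in> \<Lambda> \<Longrightarrow> of_int k *\<^sub>R x \<in> \<Lambda>"
  by (rule dual_mem) (auto intro!: Ints_mult integral_mem)

lemma sum_mem: "(\<And>i. i \<in> I \<Longrightarrow> f i \<in> \<Lambda>) \<Longrightarrow> (\<Sum>i\<in>I. f i) \<in> \<Lambda>"
  by (induction I rule: infinite_finite_induct) (auto intro: zero_mem add_mem)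

text \<open>Gram-Schmidt over the integers. If a largest orthogonal set in the lattice did not span,
  some lattice vector would have a nonzero component orthogonal to it. Multiplication by
  \<open>D\<close> clears the denominators of the projection, so a multiple of that component is a
  lattice vector that enlarges the set.\<close>

lemma orthogonal_sublattice:
  obtains M where "finite M" "M \<subseteq> \<Lambda>" "pairwise orthogonal M" "0 \<notin> M" "span M = UNIV"
proof -
  define P where "P M \<longleftrightarrow> finite M \<and> M \<subseteq> \<Lambda> \<and> pairwise orthogonal M \<and> 0 \<notin> M" for M
  have card: "card M \<le> DIM('a)" if "P M" for M
    using that independent_bound[OF pairwise_orthogonal_independent, of M] by (auto simp: P_def)
  have "P {}" by (simp add: P_def)
  then obtain M where M: "P M" "\<And>M'. P M' \<Longrightarrow> card M' \<le> card M"
    using ex_has_greatest_nat[of P "{}" card "DIM('a) + 1"] card by (force simp: less_Suc_eq_le)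
  have M': "finite M" "M \<subseteq> \<Lambda>" "pairwise orthogonal M" "0 \<notin> M" using M(1) by (auto simp: P_def)
  have "\<Lambda> \<subseteq> span M"
  proof
    fix y assume y: "y \<in> \<Lambda>"
    show "y \<in> span M"
    proof (rule ccontr)
      assume ny: "y \<notin> span M"
      define D where "D = (\<Prod>m\<in>M. m \<bullet> m)"
      have D0: "D \<noteq> 0" using M' by (auto simp: D_def)
      define z where "z = D *\<^sub>R y - (\<Sum>m\<in>M. (D * (y \<bullet> m) / (m \<bullet> m)) *\<^sub>R m)"
      have Dint: "D / (m \<bullet> m) \<in> \<int>" if "m \<in> M" for m
      proof -
        have "D = (m \<bullet> m) * (\<Prod>m\<in>M - {m}. m \<bullet> m)" unfolding D_def using that M' by (intro prod.remove)
        moreover have "(\<Prod>m\<in>M - {m}. m \<bullet> m) \<in> \<int>"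
          using M' by (intro Ints_prod) (auto intro!: integral_mem)
        moreover have "m \<bullet> m \<noteq> 0" using that M' by auto
        ultimately show ?thesis by simp
      qed
      have "D \<in> \<int>" unfolding D_def using M' by (intro Ints_prod) (auto intro!: integral_mem)
      then have "D *\<^sub>R y \<in> \<Lambda>" using y by (auto elim!: Ints_cases intro: of_int_scale_mem)
      moreover have "(D * (y \<bullet> m) / (m \<bullet> m)) *\<^sub>R m \<in> \<Lambda>" if "m \<in> M" for m
      proof -
        have "(D / (m \<bullet> m)) * (y \<bullet> m) \<in> \<int>" using Dint[OF that] integral_mem[OF y, of m] that M' by (intro Ints_mult) auto
        then obtain z where "D * (y \<bullet> m) / (m \<bullet> m) = of_int z" by (auto elim!: Ints_cases)
        then show ?thesis using of_int_scale_mem[of m z] that M' by auto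
      qed
      ultimately have z: "z \<in> \<Lambda>" unfolding z_def by (intro diff_mem sum_mem)
      have orth: "z \<bullet> m = 0" if m: "m \<in> M" for m
      proof -
        have "(\<Sum>m'\<in>M. (D * (y \<bullet> m') / (m' \<bullet> m')) * (m' \<bullet> m)) = (\<Sum>m'\<in>M. if m' = m then D * (y \<bullet> m) else 0)"
        proof (intro sum.cong refl)
          fix m' assume m': "m' \<in> M"
          show "(D * (y \<bullet> m') / (m' \<bullet> m')) * (m' \<bullet> m) = (if m' = m then D * (y \<bullet> m) else 0)"
            using m m' M' by (auto simp: pairwise_def orthogonal_def)
        qed
        then show ?thesis using m M' by (simp add: z_def inner_diff_left inner_sum_left)
      qed
      have "z \<noteq> 0"
      proof
        assume "z = 0"
        then have "D *\<^sub>R y = (\<Sum>m\<in>M. (D * (y \<bullet> m) / (m \<bullet> m)) *\<^sub>R m)" by (simp add: z_def)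
        then have "D *\<^sub>R y \<in> span M" by (metis (no_types, lifting) span_sum span_scale span_base)
        then have "(1 / D) *\<^sub>R (D *\<^sub>R y) \<in> span M" by (rule span_scale)
        then show False using D0 ny by simp
      qed
      moreover have "z \<notin> M" using orth[of z] \<open>z \<noteq> 0\<close> by auto
      ultimately have "P (insert z M)" "card (insert z M) = Suc (card M)"
        using M' z orth by (auto simp: P_def pairwise_insert orthogonal_def inner_commute)
      then show False using M(2) by force
    qed
  qed
  then have "span M = UNIV" using span_lattice span_minimal[of \<Lambda> "span M"] by auto
  then show ?thesis using that M' by blast
qed

end

lemma orthogonal_expansion:
  fixes M :: "'a::euclidean_space set"
  assumes M: "finite M" "pairwise orthogonal M" "0 \<notin> M" "span M = UNIV"
  shows "x = (\<Sum>m\<in>M. (x \<bullet> m / (m \<bullet> m)) *\<^sub>R m)"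
    "x \<bullet> y = (\<Sum>m\<in>M. (x \<bullet> m) * (y \<bullet> m) / (m \<bullet> m))"
    "card M = DIM('a)"
    "m \<in> M \<Longrightarrow> (\<Sum>m'\<in>M. c m' *\<^sub>R m') \<bullet> m = c m * (m \<bullet> m)"
proof -
  show comb: "(\<Sum>m'\<in>M. c m' *\<^sub>R m') \<bullet> m = c m * (m \<bullet> m)" if "m \<in> M" for c m
  proof -
    have "(\<Sum>m'\<in>M. c m' * (m' \<bullet> m)) = (\<Sum>m'\<in>M. if m' = m then c m * (m \<bullet> m) else 0)"
      using that M(2) by (intro sum.cong refl) (auto simp: pairwise_def orthogonal_def)
    then show ?thesis using that M(1) by (simp add: inner_sum_left)
  qed
  define z where "z = x - (\<Sum>m\<in>M. (x \<bullet> m / (m \<bullet> m)) *\<^sub>R m)"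
  have "z \<bullet> m = 0" if "m \<in> M" for m
    using comb[OF that, of "\<lambda>m. x \<bullet> m / (m \<bullet> m)"] that M(3) by (auto simp: z_def inner_diff_left)
  then have "orthogonal z z"
    using M(4) by (intro orthogonal_to_span[of z M]) (auto simp: orthogonal_def inner_commute)
  then show x: "x = (\<Sum>m\<in>M. (x \<bullet> m / (m \<bullet> m)) *\<^sub>R m)" by (simp add: z_def orthogonal_self)
  show "x \<bullet> y = (\<Sum>m\<in>M. (x \<bullet> m) * (y \<bullet> m) / (m \<bullet> m))"
    using arg_cong[OF x, of "\<lambda>v. v \<bullet> y"] by (simp add: inner_sum_left inner_commute[of y])
  have "independent M" using M by (intro pairwise_orthogonal_independent) auto
  then show "card M = DIM('a)" using M(4) dim_eq_card[of M UNIV] by (simp add: dim_UNIV)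
qed

text \<open>The inversion formula with characters in place of cosines, because characters multiply
  across coordinates and cosines do not. The added imaginary part sums to zero, being odd in
  \<open>l\<close>.\<close>

lemma complex_theta_sum:
  fixes a x :: real assumes "a > 0"
  shows "((\<lambda>l::int. of_real (exp (- pi * l^2 / a) / sqrt a) * cis (2 * pi * l * x)) has_sum of_real (gauss_theta a x)) UNIV"
    "(\<lambda>l::int. norm (of_real (exp (- pi * l^2 / a) / sqrt a) * cis (2 * pi * l * x))) summable_on UNIV"
proof -
  define c where "c l = exp (- pi * (real_of_int l)^2 / a) / sqrt a" for l :: int
  have c: "c summable_on UNIV" "\<And>l. c l \<ge> 0"
    using summable_on_cmult_left[OF summable_on_int_gaussian[of "pi / a"], of "1 / sqrt a"] assms
    by (auto simp: c_def[abs_def])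
  show n: "(\<lambda>l::int. norm (of_real (exp (- pi * l^2 / a) / sqrt a) * cis (2 * pi * l * x))) summable_on UNIV"
    using c assms unfolding c_def[symmetric] by (simp add: norm_mult)
  have cos: "((\<lambda>l. c l * cos (2 * pi * real_of_int l * x)) has_sum gauss_theta a x) UNIV"
    using gauss_theta_inversion[OF assms, of x] by (simp add: c_def)
  have "(\<lambda>l. c l * sin (2 * pi * real_of_int l * x)) summable_on UNIV"
    by (rule summable_on_abs_le[OF c(1)]) (auto simp: abs_mult mult_left_le c)
  then obtain S where S: "((\<lambda>l. c l * sin (2 * pi * real_of_int l * x)) has_sum S) UNIV"
    by (auto simp: summable_on_def)
  then have "((\<lambda>l. c (- l) * sin (2 * pi * real_of_int (- l) * x)) has_sum S) UNIV"
    by (subst has_sum_reindex_bij_witness[of _ uminus uminus UNIV "\<lambda>l. c l * sin (2 * pi * real_of_int l * x)"]) auto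
  then have "((\<lambda>l. - (c l * sin (2 * pi * real_of_int l * x))) has_sum S) UNIV" by (simp add: c_def)
  moreover have "((\<lambda>l. - (c l * sin (2 * pi * real_of_int l * x))) has_sum - S) UNIV"
    using S by (rule has_sum_uminusI)
  ultimately have "S = - S" by (rule has_sum_unique)
  with S have sin: "((\<lambda>l. c l * sin (2 * pi * real_of_int l * x)) has_sum 0) UNIV" by simp
  have "((\<lambda>l. of_real (c l * cos (2 * pi * real_of_int l * x)) + \<i> * of_real (c l * sin (2 * pi * real_of_int l * x))) has_sum
     of_real (gauss_theta a x) + \<i> * of_real 0) UNIV"
    by (intro has_sum_add has_sum_cmult_right has_sum_of_real cos sin)
  moreover have "of_real (c l * cos (2 * pi * real_of_int l * x)) + \<i> * of_real (c l * sin (2 * pi * real_of_int l * x))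
     = of_real (c l) * cis (2 * pi * real_of_int l * x)" for l
    by (simp add: complex_eq_iff)
  ultimately show "((\<lambda>l::int. of_real (exp (- pi * l^2 / a) / sqrt a) * cis (2 * pi * l * x)) has_sum of_real (gauss_theta a x)) UNIV"
    by (simp add: c_def)
qed

lemma has_sum_finite_sum:
  fixes f :: "'i \<Rightarrow> 'b \<Rightarrow> 'c::{topological_comm_monoid_add}"
  assumes "\<And>i. i \<in> I \<Longrightarrow> (f i has_sum s i) A"
  shows "((\<lambda>x. \<Sum>i\<in>I. f i x) has_sum (\<Sum>i\<in>I. s i)) A"
  using assms by (induction I rule: infinite_finite_induct) (auto intro: has_sum_add)

lemma norm_summable_on_prod_PiE:
  fixes f :: "'i \<Rightarrow> int \<Rightarrow> complex"
  assumes "finite A" "\<And>x. x \<in> A \<Longrightarrow> (\<lambda>n. norm (f x n)) summable_on UNIV"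
  shows "(\<lambda>g. norm (\<Prod>x\<in>A. f x (g x))) summable_on (PiE A (\<lambda>_. UNIV))"
    "((\<lambda>g. \<Prod>x\<in>A. f x (g x)) has_sum (\<Prod>x\<in>A. infsum (f x) UNIV)) (PiE A (\<lambda>_. UNIV))"
proof -
  show s: "(\<lambda>g. norm (\<Prod>x\<in>A. f x (g x))) summable_on (PiE A (\<lambda>_. UNIV))"
    using abs_summable_on_prod_PiE[of A "\<lambda>_. UNIV" f] assms by (simp add: abs_summable_equivalent)
  then show "((\<lambda>g. \<Prod>x\<in>A. f x (g x)) has_sum (\<Prod>x\<in>A. infsum (f x) UNIV)) (PiE A (\<lambda>_. UNIV))"
    using infsum_prod_PiE_abs[of A f "\<lambda>_. UNIV"] assms abs_summable_summable by (metis has_sum_infsum)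
qed

context unimodular_lattice
begin

text \<open>The lattice splits into finitely many cosets of the orthogonal sublattice generated by
  \<open>M\<close>. On each coset the Gaussian factors over \<open>M\<close> and the one-dimensional
  inversion applies, which produces a sum over the dual of the sublattice. Summation over the cosets
  leaves only those dual vectors that have integral inner products with the whole lattice, that is,
  the lattice itself by self-duality. \<open>K\<close> collects the index and the lengths of the
  members of \<open>M\<close>.\<close>

theorem theta_transformation_aux:
  obtains K where "\<And>t v. t > 0 \<Longrightarrow> (\<lambda>y. exp (- pi * t * (norm (y + v))^2)) summable_on \<Lambda>"
    "\<And>t v. t > 0 \<Longrightarrow> (\<Sum>\<^sub>\<infinity>y\<in>\<Lambda>. exp (- pi * t * (norm (y + v))^2)) =
      K / sqrt t ^ DIM('a) * (\<Sum>\<^sub>\<infinity>y\<in>\<Lambda>. exp (- pi * (norm y)^2 / t) * cos (2 * pi * (y \<bullet> v)))"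
proof -
  obtain M where M: "finite M" "M \<subseteq> \<Lambda>" "pairwise orthogonal M" "0 \<notin> M" "span M = UNIV"
    by (rule orthogonal_sublattice)
  note ex = orthogonal_expansion[OF M(1,3,4,5)]
  define q where "q m = m \<bullet> m" for m :: 'a
  have q: "q m > 0" "q m \<in> \<int>" if "m \<in> M" for m
    using that M integral_mem[of m m] by (auto simp: q_def)
  define P where "P = PiE M (\<lambda>_. UNIV :: int set)"
  define comb where "comb n = (\<Sum>m\<in>M. of_int (n m) *\<^sub>R m)" for n :: "'a \<Rightarrow> int"
  have comb_inner: "comb n \<bullet> m = of_int (n m) * q m" if "m \<in> M" for n m
    using ex(4)[OF that] by (simp add: comb_def q_def)
  have comb_mem: "comb n \<in> \<Lambda>" for n
    unfolding comb_def using M(2) by (intro sum_mem of_int_scale_mem) auto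
  \<comment> \<open>Coset representatives in the half-open box spanned by \<open>M\<close>. Below,
    \<open>rep\<close> reduces a vector into the box and \<open>fl\<close> gives the integral
    quotients.\<close>
  define R where "R = {r \<in> \<Lambda>. \<forall>m\<in>M. 0 \<le> r \<bullet> m \<and> r \<bullet> m < q m}"
  have eqI: "x = y" if "\<And>m. m \<in> M \<Longrightarrow> x \<bullet> m = y \<bullet> m" for x y :: 'a
    using ex(1)[of x] ex(1)[of y] that by (metis (no_types, lifting) sum.cong)
  have finR: "finite R"
  proof -
    define F where "F r = (\<lambda>m\<in>M. r \<bullet> m)" for r :: 'a
    have "inj_on F R"
    proof (rule inj_onI)
      fix x y assume "F x = F y"
      then have "x \<bullet> m = y \<bullet> m" if "m \<in> M" for m using that unfolding F_def by (metis restrict_apply)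
      then show "x = y" by (rule eqI)
    qed
    moreover have "F ` R \<subseteq> PiE M (\<lambda>m. {k \<in> \<int>. \<bar>k\<bar> \<le> q m})"
      using M(2) by (auto simp: F_def R_def intro!: integral_mem)
    moreover have "finite (PiE M (\<lambda>m. {k \<in> \<int>. \<bar>k\<bar> \<le> q m}))"
      using M(1) by (intro finite_PiE finite_abs_int_segment)
    ultimately show ?thesis by (rule inj_on_finite)
  qed
  define fl where "fl y = (\<lambda>m\<in>M. \<lfloor>y \<bullet> m / q m\<rfloor>)" for y :: 'a
  define rep where "rep y = y - comb (fl y)" for y
  have rep_inner: "rep y \<bullet> m = (y \<bullet> m / q m - of_int \<lfloor>y \<bullet> m / q m\<rfloor>) * q m" if "m \<in> M" for y m
    using q[OF that] comb_inner[OF that] that by (simp add: rep_def fl_def inner_diff_left field_simps)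
  have rep_R: "rep y \<in> R" if "y \<in> \<Lambda>" for y
  proof -
    have "0 \<le> rep y \<bullet> m \<and> rep y \<bullet> m < q m" if m: "m \<in> M" for m
    proof -
      have f: "0 \<le> y \<bullet> m / q m - of_int \<lfloor>y \<bullet> m / q m\<rfloor>" "y \<bullet> m / q m - of_int \<lfloor>y \<bullet> m / q m\<rfloor> < 1"
        by linarith+
      then show ?thesis unfolding rep_inner[OF m] using q[OF m] by (simp add: mult_less_cancel_right)
    qed
    moreover have "rep y \<in> \<Lambda>" unfolding rep_def using that comb_mem by (rule diff_mem)
    ultimately show ?thesis by (simp add: R_def)
  qed
  have fl_comb: "fl (r + comb n) = n" if "r \<in> R" "n \<in> P" for r n
  proof
    fix m
    show "fl (r + comb n) m = n m"
    proof (cases "m \<in> M")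
      case True
      have "0 \<le> r \<bullet> m / q m" "r \<bullet> m / q m < 1" using that q[OF True] True by (auto simp: R_def)
      then have "\<lfloor>r \<bullet> m / q m\<rfloor> = 0" by linarith
      moreover have "(r + comb n) \<bullet> m / q m = r \<bullet> m / q m + of_int (n m)"
        using q[OF True] comb_inner[OF True] by (simp add: inner_add_left field_simps)
      ultimately show ?thesis using True by (simp add: fl_def)
    next
      case False then show ?thesis using that(2) by (auto simp: fl_def P_def PiE_def extensional_def)
    qed
  qed
  have rep_comb: "rep (r + comb n) = r" if "r \<in> R" "n \<in> P" for r n
    using fl_comb[OF that] by (simp add: rep_def)
  have bij: "bij_betw (\<lambda>(r, n). r + comb n) (R \<times> P) \<Lambda>"
    by (rule bij_betw_byWitness[where f' = "\<lambda>y. (rep y, fl y)"])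
       (use fl_comb rep_comb rep_R comb_mem in \<open>auto simp: R_def rep_def fl_def P_def intro!: add_mem\<close>)
  have prodsum: "exp (- pi * t * (norm x)^2) = (\<Prod>m\<in>M. exp (- pi * (t * q m) * (x \<bullet> m / q m)^2))" if "t > 0" for t x
  proof -
    have "(norm x)^2 = (\<Sum>m\<in>M. q m * (x \<bullet> m / q m)^2)"
      unfolding power2_norm_eq_inner ex(2)[of x x]
      by (intro sum.cong refl) (use q in \<open>auto simp: q_def[symmetric] power2_eq_square field_simps\<close>)
    then show ?thesis using M(1) by (simp add: exp_sum[symmetric] sum_distrib_left mult.assoc)
  qed
  have theta_hs: "((\<lambda>n. exp (- pi * t * (norm (r + comb n + v))^2)) has_sum (\<Prod>m\<in>M. gauss_theta (t * q m) ((r + v) \<bullet> m / q m))) P" if t: "t > 0" for t r v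
  proof -
    define f :: "'a \<Rightarrow> int \<Rightarrow> complex" where "f m n = of_real (exp (- pi * (t * q m) * (of_int n + (r + v) \<bullet> m / q m)^2))" for m n
    have s: "(\<lambda>n. norm (f m n)) summable_on UNIV" if "m \<in> M" for m
      using summable_on_gaussian_shift[of "t * q m" "(r + v) \<bullet> m / q m"] t q[OF that] by (simp add: f_def)
    have "((\<lambda>g. \<Prod>m\<in>M. f m (g m)) has_sum (\<Prod>m\<in>M. infsum (f m) UNIV)) P"
      unfolding P_def by (rule norm_summable_on_prod_PiE(2)[OF M(1) s])
    moreover have "(\<Prod>m\<in>M. f m (g m)) = of_real (exp (- pi * t * (norm (r + comb g + v))^2))" for g
    proof -
      have "(r + comb g + v) \<bullet> m / q m = of_int (g m) + (r + v) \<bullet> m / q m" if "m \<in> M" for m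
        using comb_inner[OF that] q[OF that] by (simp add: inner_add_left field_simps)
      then show ?thesis unfolding prodsum[OF t] by (simp add: f_def)
    qed
    moreover have "infsum (f m) UNIV = of_real (gauss_theta (t * q m) ((r + v) \<bullet> m / q m))" if "m \<in> M" for m
      unfolding f_def gauss_theta_def using t q[OF that]
      by (intro infsumI has_sum_of_real has_sum_infsum summable_on_gaussian_shift) auto
    ultimately have "((\<lambda>n. complex_of_real (exp (- pi * t * (norm (r + comb n + v))^2))) has_sum of_real (\<Prod>m\<in>M. gauss_theta (t * q m) ((r + v) \<bullet> m / q m))) P"
      by simp
    then show ?thesis by (simp only: has_sum_of_real_iff)
  qed
  have sum_prod: "(\<lambda>(r, n). exp (- pi * t * (norm (r + comb n + v))^2)) summable_on R \<times> P" if t: "t > 0" for t v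
    using theta_hs[OF t] finR by (intro summable_on_SigmaI) auto
  have summ: "(\<lambda>y. exp (- pi * t * (norm (y + v))^2)) summable_on \<Lambda>" if t: "t > 0" for t v
    using sum_prod[OF t, of v] summable_on_reindex_bij_betw[OF bij, of "\<lambda>y. exp (- pi * t * (norm (y + v))^2)"]
    by (simp add: case_prod_unfold)
  have sum1: "((\<lambda>y. exp (- pi * t * (norm (y + v))^2)) has_sum (\<Sum>r\<in>R. \<Prod>m\<in>M. gauss_theta (t * q m) ((r + v) \<bullet> m / q m))) \<Lambda>" if t: "t > 0" for t v
  proof -
    have "((\<lambda>(r, n). exp (- pi * t * (norm (r + comb n + v))^2)) has_sum (\<Sum>r\<in>R. \<Prod>m\<in>M. gauss_theta (t * q m) ((r + v) \<bullet> m / q m))) (R \<times> P)"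
      using theta_hs[OF t] finR sum_prod[OF t] by (intro has_sum_SigmaI) auto
    then show ?thesis
      using has_sum_reindex_bij_betw[OF bij, of "\<lambda>y. exp (- pi * t * (norm (y + v))^2)"] by (simp add: case_prod_unfold)
  qed
  \<comment> \<open>\<open>z l\<close> runs through the dual of the sublattice: its inner products
    with the members \<open>m\<close> of \<open>M\<close> are the integers
    \<open>l m\<close>.\<close>
  define z where "z l = (\<Sum>m\<in>M. (of_int (l m) / q m) *\<^sub>R m)" for l :: "'a \<Rightarrow> int"
  have z_inner: "z l \<bullet> m = of_int (l m)" if "m \<in> M" for l m
    using ex(4)[OF that, of "\<lambda>m. of_int (l m) / q m"] q[OF that] by (simp add: z_def q_def)
  have z_dot: "z l \<bullet> x = (\<Sum>m\<in>M. of_int (l m) * (x \<bullet> m / q m))" for l x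
    unfolding ex(2)[of "z l" x] by (intro sum.cong refl) (simp add: z_inner q_def)
  have z_norm: "(norm (z l))^2 = (\<Sum>m\<in>M. (of_int (l m))^2 / q m)" for l
    unfolding power2_norm_eq_inner ex(2)[of "z l" "z l"] by (intro sum.cong refl) (simp add: z_inner q_def power2_eq_square)
  define K0 where "K0 = (\<Prod>m\<in>M. 1 / sqrt (q m))"
  have dual_hs: "((\<lambda>l. of_real (K0 / sqrt t ^ DIM('a) * exp (- pi * (norm (z l))^2 / t)) * cis (2 * pi * (z l \<bullet> x)))
      has_sum of_real (\<Prod>m\<in>M. gauss_theta (t * q m) (x \<bullet> m / q m))) P"
    "(\<lambda>l. norm (of_real (K0 / sqrt t ^ DIM('a) * exp (- pi * (norm (z l))^2 / t)) * cis (2 * pi * (z l \<bullet> x)))) summable_on P"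
    if t: "t > 0" for t x
  proof -
    define f :: "'a \<Rightarrow> int \<Rightarrow> complex" where
      "f m l = of_real (exp (- pi * (of_int l)^2 / (t * q m)) / sqrt (t * q m)) * cis (2 * pi * of_int l * (x \<bullet> m / q m))" for m l
    have s: "(\<lambda>n. norm (f m n)) summable_on UNIV" "infsum (f m) UNIV = of_real (gauss_theta (t * q m) (x \<bullet> m / q m))" if "m \<in> M" for m
      using complex_theta_sum[of "t * q m" "x \<bullet> m / q m"] t q[OF that] by (auto simp: f_def[abs_def] dest: infsumI)
    have fp: "(\<Prod>m\<in>M. f m (l m)) = of_real (K0 / sqrt t ^ DIM('a) * exp (- pi * (norm (z l))^2 / t)) * cis (2 * pi * (z l \<bullet> x))" for l
    proof -
      have "(\<Prod>m\<in>M. exp (- pi * (of_int (l m))^2 / (t * q m)) / sqrt (t * q m)) =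
        (\<Prod>m\<in>M. exp (- pi * (of_int (l m))^2 / (t * q m))) * ((\<Prod>m\<in>M. 1 / sqrt (q m)) / (\<Prod>m\<in>M. sqrt t))"
        unfolding prod.distrib[symmetric] prod_dividef[symmetric] by (intro prod.cong refl) (simp add: real_sqrt_mult)
      also have "(\<Prod>m\<in>M. sqrt t) = sqrt t ^ DIM('a)" using ex(3) by simp
      also have "(\<Prod>m\<in>M. exp (- pi * (of_int (l m))^2 / (t * q m))) = exp (- pi * (norm (z l))^2 / t)"
        unfolding exp_sum[OF M(1), symmetric] z_norm sum_distrib_left sum_divide_distrib
        by (intro arg_cong[of _ _ exp] sum.cong refl) (use t q in \<open>simp add: field_simps\<close>)
      finally have a: "(\<Prod>m\<in>M. exp (- pi * (of_int (l m))^2 / (t * q m)) / sqrt (t * q m)) = K0 / sqrt t ^ DIM('a) * exp (- pi * (norm (z l))^2 / t)"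
        by (simp add: K0_def)
      have "(\<Prod>m\<in>M. cis (2 * pi * of_int (l m) * (x \<bullet> m / q m))) = cis (\<Sum>m\<in>M. 2 * pi * of_int (l m) * (x \<bullet> m / q m))"
        using M(1) by (simp add: cis_conv_exp exp_sum[symmetric] sum_distrib_left)
      also have "(\<Sum>m\<in>M. 2 * pi * of_int (l m) * (x \<bullet> m / q m)) = 2 * pi * (z l \<bullet> x)"
        by (simp add: z_dot sum_distrib_left mult.assoc)
      finally show ?thesis unfolding f_def prod.distrib a[symmetric] by simp
    qed
    show "((\<lambda>l. of_real (K0 / sqrt t ^ DIM('a) * exp (- pi * (norm (z l))^2 / t)) * cis (2 * pi * (z l \<bullet> x)))
      has_sum of_real (\<Prod>m\<in>M. gauss_theta (t * q m) (x \<bullet> m / q m))) P"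
      using norm_summable_on_prod_PiE(2)[of M f, OF M(1) s(1)] s(2) by (simp add: fp P_def[symmetric])
    show "(\<lambda>l. norm (of_real (K0 / sqrt t ^ DIM('a) * exp (- pi * (norm (z l))^2 / t)) * cis (2 * pi * (z l \<bullet> x)))) summable_on P"
      using norm_summable_on_prod_PiE(1)[of M f, OF M(1) s(1)] by (simp only: fp P_def[symmetric])
  qed
  \<comment> \<open>Orthogonality of characters on the quotient by the sublattice: if some lattice
    vector \<open>y\<close> has a non-integral inner product with \<open>z l\<close>, shifting the
    representatives by \<open>y\<close> multiplies the sum by a number other than 1.\<close>
  have chars: "(\<Sum>r\<in>R. cis (2 * pi * (z l \<bullet> r))) = (if z l \<in> \<Lambda> then of_nat (card R) else 0)" for l
  proof (cases "z l \<in> \<Lambda>")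
    case True
    have "cis (2 * pi * (z l \<bullet> r)) = 1" if "r \<in> R" for r
      using integral_mem[OF True, of r] that by (auto simp: R_def elim!: Ints_cases intro: cis_multiple_2pi)
    then show ?thesis using True by simp
  next
    case False
    then obtain y where y: "y \<in> \<Lambda>" "z l \<bullet> y \<notin> \<int>" using dual_mem by blast
    have zc: "z l \<bullet> comb n \<in> \<int>" for n
    proof -
      have "z l \<bullet> comb n = (\<Sum>m\<in>M. of_int (n m) * of_int (l m))"
        by (simp add: comb_def inner_sum_right z_inner)
      then show ?thesis by (auto intro!: Ints_sum)
    qed
    have cz: "cis (2 * pi * (z l \<bullet> rep x)) = cis (2 * pi * (z l \<bullet> x))" for x
    proof -
      obtain k where k: "z l \<bullet> comb (fl x) = of_int k" using zc[of "fl x"] by (auto elim: Ints_cases)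
      have "cis (2 * pi * (z l \<bullet> rep x)) = cis (2 * pi * (z l \<bullet> x) - 2 * pi * of_int k)"
        by (simp add: rep_def inner_diff_right k algebra_simps)
      also have "\<dots> = cis (2 * pi * (z l \<bullet> x)) / cis (2 * pi * of_int k)" by (rule cis_divide[symmetric])
      also have "cis (2 * pi * of_int k) = 1" by (rule cis_multiple_2pi) auto
      finally show ?thesis by simp
    qed
    have rep_shift: "rep (rep (x + y) - y) = x" if "x \<in> R" for x
    proof -
      have "rep (x + y) - y = x + comb (\<lambda>m\<in>M. - fl (x + y) m)"
        by (simp add: rep_def comb_def sum_negf)
      then show ?thesis using rep_comb[OF that, of "\<lambda>m\<in>M. - fl (x + y) m"] by (simp add: P_def)
    qed
    have rep_shift': "rep (rep (x - y) + y) = x" if "x \<in> R" for x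
    proof -
      have "rep (x - y) + y = x + comb (\<lambda>m\<in>M. - fl (x - y) m)"
        by (simp add: rep_def comb_def sum_negf)
      then show ?thesis using rep_comb[OF that, of "\<lambda>m\<in>M. - fl (x - y) m"] by (simp add: P_def)
    qed
    have RL: "x \<in> \<Lambda>" if "x \<in> R" for x using that by (simp add: R_def)
    have "(\<Sum>r\<in>R. cis (2 * pi * (z l \<bullet> r))) = (\<Sum>r\<in>R. cis (2 * pi * (z l \<bullet> rep (r + y))))"
      by (rule sum.reindex_bij_witness[of _ "\<lambda>x. rep (x + y)" "\<lambda>x. rep (x - y)"])
         (use rep_shift rep_shift' rep_R RL y(1) add_mem diff_mem in auto)
    also have "\<dots> = (\<Sum>r\<in>R. cis (2 * pi * (z l \<bullet> r))) * cis (2 * pi * (z l \<bullet> y))"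
      unfolding cz sum_distrib_right by (simp add: inner_add_right cis_mult algebra_simps)
    finally have "(\<Sum>r\<in>R. cis (2 * pi * (z l \<bullet> r))) * (cis (2 * pi * (z l \<bullet> y)) - 1) = 0" by (simp add: algebra_simps)
    moreover have "cis (2 * pi * (z l \<bullet> y)) \<noteq> 1"
    proof
      assume "cis (2 * pi * (z l \<bullet> y)) = 1"
      then have "cos (2 * pi * (z l \<bullet> y)) = 1" by (simp add: complex_eq_iff)
      then obtain n :: int where "2 * pi * (z l \<bullet> y) = real_of_int n * 2 * pi" by (auto simp: cos_one_2pi_int)
      then show False using y(2) by auto
    qed
    ultimately show ?thesis using False by simp
  qed
  have injz: "inj_on z P"
  proof (rule inj_onI)
    fix l l' assume l: "l \<in> P" "l' \<in> P" "z l = z l'"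
    have "l m = l' m" if "m \<in> M" for m using z_inner[OF that, of l] z_inner[OF that, of l'] l(3) by simp
    then show "l = l'" using l unfolding P_def by (intro PiE_ext) auto
  qed
  have zsurj: "\<Lambda> \<subseteq> z ` P"
  proof
    fix y assume y: "y \<in> \<Lambda>"
    define l where "l = (\<lambda>m\<in>M. \<lfloor>y \<bullet> m\<rfloor>)"
    have "y = z l"
    proof (rule eqI)
      fix m assume m: "m \<in> M"
      have "y \<bullet> m \<in> \<int>" using integral_mem[OF y, of m] m M(2) by auto
      then show "y \<bullet> m = z l \<bullet> m" unfolding z_inner[OF m] using m by (auto simp: l_def elim!: Ints_cases)
    qed
    then show "y \<in> z ` P" by (auto simp: l_def P_def)
  qed
  have main: "(\<Sum>\<^sub>\<infinity>y\<in>\<Lambda>. exp (- pi * t * (norm (y + v))^2)) =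
      (K0 * card R) / sqrt t ^ DIM('a) * (\<Sum>\<^sub>\<infinity>y\<in>\<Lambda>. exp (- pi * (norm y)^2 / t) * cos (2 * pi * (y \<bullet> v)))" if t: "t > 0" for t v
  proof -
    define E where "E y = of_real (exp (- pi * (norm y)^2 / t)) * cis (2 * pi * (y \<bullet> v))" for y :: 'a
    define c where "c = complex_of_real (K0 / sqrt t ^ DIM('a))"
    define S where "S = (\<Sum>\<^sub>\<infinity>y\<in>\<Lambda>. exp (- pi * t * (norm (y + v))^2))"
    have "((\<lambda>l. \<Sum>r\<in>R. of_real (K0 / sqrt t ^ DIM('a) * exp (- pi * (norm (z l))^2 / t)) * cis (2 * pi * (z l \<bullet> (r + v))))
       has_sum (\<Sum>r\<in>R. of_real (\<Prod>m\<in>M. gauss_theta (t * q m) ((r + v) \<bullet> m / q m)))) P"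
      by (intro has_sum_finite_sum dual_hs(1) t finR)
    moreover have "(\<Sum>r\<in>R. of_real (K0 / sqrt t ^ DIM('a) * exp (- pi * (norm (z l))^2 / t)) * cis (2 * pi * (z l \<bullet> (r + v))))
      = c * of_nat (card R) * (if z l \<in> \<Lambda> then E (z l) else 0)" for l
    proof -
      have "(\<Sum>r\<in>R. of_real (K0 / sqrt t ^ DIM('a) * exp (- pi * (norm (z l))^2 / t)) * cis (2 * pi * (z l \<bullet> (r + v))))
        = c * E (z l) * (\<Sum>r\<in>R. cis (2 * pi * (z l \<bullet> r)))"
        unfolding sum_distrib_left
        by (intro sum.cong refl) (simp add: c_def E_def inner_add_right distrib_left cis_mult[symmetric] mult_ac)
      then show ?thesis unfolding chars by simp
    qed
    moreover have "(\<Sum>r\<in>R. complex_of_real (\<Prod>m\<in>M. gauss_theta (t * q m) ((r + v) \<bullet> m / q m))) = of_real S"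
      using infsumI[OF sum1[OF t, of v]] by (simp add: S_def)
    ultimately have "((\<lambda>l. c * of_nat (card R) * (if z l \<in> \<Lambda> then E (z l) else 0)) has_sum of_real S) P" by simp
    then have "((\<lambda>y. c * of_nat (card R) * (if y \<in> \<Lambda> then E y else 0)) has_sum of_real S) (z ` P)"
      by (simp add: has_sum_reindex[OF injz] o_def)
    then have "((\<lambda>y. c * of_nat (card R) * E y) has_sum of_real S) \<Lambda>"
      by (rule has_sum_cong_neutral[THEN iffD1, rotated -1]) (use zsurj in auto)
    then have "((\<lambda>y. Re (c * of_nat (card R) * E y)) has_sum Re (of_real S)) \<Lambda>" by (rule has_sum_Re)
    moreover have "Re (c * of_nat (card R) * E y) = (K0 * card R) / sqrt t ^ DIM('a) * (exp (- pi * (norm y)^2 / t) * cos (2 * pi * (y \<bullet> v)))" for y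
      by (simp add: c_def E_def)
    ultimately have "((\<lambda>y. (K0 * card R) / sqrt t ^ DIM('a) * (exp (- pi * (norm y)^2 / t) * cos (2 * pi * (y \<bullet> v)))) has_sum S) \<Lambda>"
      by simp
    from infsumI[OF this] show ?thesis unfolding S_def infsum_cmult_right' by (rule sym)
  qed
  show ?thesis by (rule that[OF summ main])
qed

lemma summable_on_lattice_gaussian:
  "t > 0 \<Longrightarrow> (\<lambda>y. exp (- pi * t * (norm (y + v))^2)) summable_on \<Lambda>"
  by (metis theta_transformation_aux)

text \<open>The constant is found without computing a covolume: at \<open>t = 1\<close> and
  \<open>v = 0\<close> both sides contain the same positive sum.\<close>

theorem theta_transformation:
  assumes t: "t > 0"
  shows "(\<Sum>\<^sub>\<infinity>y\<in>\<Lambda>. exp (- pi * t * (norm (y + v))^2)) =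
    1 / sqrt t ^ DIM('a) * (\<Sum>\<^sub>\<infinity>y\<in>\<Lambda>. exp (- pi * (norm y)^2 / t) * cos (2 * pi * (y \<bullet> v)))"
proof -
  obtain K where K: "\<And>t v. t > 0 \<Longrightarrow> (\<Sum>\<^sub>\<infinity>y\<in>\<Lambda>. exp (- pi * t * (norm (y + v))^2)) =
      K / sqrt t ^ DIM('a) * (\<Sum>\<^sub>\<infinity>y\<in>\<Lambda>. exp (- pi * (norm y)^2 / t) * cos (2 * pi * (y \<bullet> v)))"
    by (rule theta_transformation_aux) blast
  define S where "S = (\<Sum>\<^sub>\<infinity>y\<in>\<Lambda>. exp (- pi * 1 * (norm (y + 0))^2))"
  have "S = K * S" using K[of 1 0] by (simp add: S_def)
  moreover have "S \<noteq> 0"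
    using nonneg_infsum_le_0D[OF _ summable_on_lattice_gaussian[of 1 0] _ zero_mem] by (force simp: S_def)
  ultimately have "K = 1" by simp
  with K[OF t] show ?thesis by simp
qed

end

section \<open>Vanishing of cusp forms of small weight\<close>

text \<open>Translate the real part into a strip of width 1. If the imaginary part is below
  \<open>c\<close>, then \<open>norm w ^ 2 \<le> r < 1\<close>, and inversion raises the imaginary
  part at least by the factor \<open>1 / r\<close>, so finitely many steps suffice. \<open>P\<close>
  is any invariant quantity, which avoids keeping track of group elements.\<close>

lemma upper_half_plane_reduction:
  fixes P :: "complex \<Rightarrow> 'a" and c :: real
  assumes shift: "\<And>z. Im z > 0 \<Longrightarrow> P (z + 1) = P z"
    and inv: "\<And>z. Im z > 0 \<Longrightarrow> P (- 1 / z) = P z"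
    and c: "0 < c" "1/4 + c^2 < 1" and z: "Im z > 0"
  shows "\<exists>z'. Im z' \<ge> c \<and> P z' = P z"
proof -
  define r where "r = 1/4 + c^2"
  have r: "0 < r" "r < 1" using c by (auto simp: r_def intro: add_pos_nonneg)
  have shiftn: "P (z + of_nat n) = P z" if "Im z > 0" for z n
  proof (induction n)
    case (Suc n)
    then show ?case using shift[of "z + of_nat n"] that by (simp add: add_ac)
  qed simp
  have shifti: "P (z + of_int n) = P z" if "Im z > 0" for z n
  proof (cases "n \<ge> 0")
    case True then show ?thesis using shiftn[OF that, of "nat n"] by simp
  next
    case False then show ?thesis using shiftn[of "z + of_int n" "nat (- n)"] that by simp
  qed
  have red: "\<exists>z'. Im z' \<ge> c \<and> P z' = P z" if "Im z > 0" "Im z \<ge> c * r ^ n" for n z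
    using that
  proof (induction n arbitrary: z)
    case 0 then show ?case by auto
  next
    case (Suc n)
    show ?case
    proof (cases "Im z \<ge> c")
      case False
      define w where "w = z + of_int (- \<lfloor>Re z + 1/2\<rfloor>)"
      have "Re w = Re z - of_int \<lfloor>Re z + 1/2\<rfloor>" by (simp add: w_def)
      then have w: "Im w = Im z" "\<bar>Re w\<bar> \<le> 1/2" by (simp add: w_def, linarith)
      have "(Re w)^2 \<le> (1/2)^2" using w(2) by (intro abs_le_square_iff[THEN iffD1]) simp
      moreover have "(Im w)^2 \<le> c^2" using False Suc.prems w by (intro power_mono) auto
      ultimately have nw: "(norm w)^2 \<le> r" unfolding cmod_power2 r_def by (simp add: power_divide)
      have w0: "w \<noteq> 0" using Suc.prems w by auto
      have im: "Im (- 1 / w) = Im z / (norm w)^2" using w(1) by (simp add: Im_divide cmod_power2)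
      have "Im z / (norm w)^2 \<ge> Im z / r" using nw w0 Suc.prems r by (intro divide_left_mono) auto
      moreover have "Im z / r \<ge> c * r ^ n" using Suc.prems(2) r by (simp add: field_simps)
      ultimately have ge: "Im (- 1 / w) \<ge> c * r ^ n" using im by linarith
      moreover have "c * r ^ n > 0" using c r by simp
      ultimately have "Im (- 1 / w) > 0" by linarith
      from Suc.IH[OF this ge] obtain z' where "Im z' \<ge> c" "P z' = P (- 1 / w)" by auto
      moreover have "P (- 1 / w) = P z" using inv[of w] shifti[of z "- \<lfloor>Re z + 1/2\<rfloor>"] w Suc.prems by (simp add: w_def)
      ultimately show ?thesis by auto
    qed auto
  qed
  obtain n where "r ^ n < Im z / c" using real_arch_pow_inv[of "Im z / c" r] z c r by auto
  then have "c * r ^ n \<le> Im z" using c by (simp add: field_simps)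
  then show ?thesis using red z by blast
qed

text \<open>\<open>\<bar>f z\<bar> * Im z ^ k\<close> is invariant under the modular group, hence bounded; on the reduced region the maximum principle
  for \<open>F q / q^2\<close> bounds it by a fixed fraction of its supremum. For \<open>k = 11\<close> this fails near \<open>\<i>\<close>, where
  \<open>f\<close> has a further zero because \<open>k\<close> is odd; this zero is divided out as well.\<close>

lemma cusp_form_vanishes:
  fixes a :: "nat \<Rightarrow> complex" and k :: nat
  assumes conv: "\<And>q. norm q < 1 \<Longrightarrow> summable (\<lambda>n. a n * q ^ n)"
    and a01: "a 0 = 0" "a 1 = 0"
    and k: "k \<le> 11"
    and fun_eq: "\<And>t::real. t > 0 \<Longrightarrow>
      (\<Sum>n. a n * of_real (exp (- 2 * pi / t)) ^ n) = (-1) ^ k * of_real (t ^ (2 * k)) * (\<Sum>n. a n * of_real (exp (- 2 * pi * t)) ^ n)"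
  shows "a n = 0"
proof -
  define F where "F q = (\<Sum>n. a n * q ^ n)" for q
  define g where "g q = (\<Sum>n. a (n + 2) * q ^ n)" for q
  define e where "e z = exp (2 * pi * \<i> * z)" for z :: complex
  define f where "f z = F (e z)" for z
  have norm_e: "norm (e z) = exp (- 2 * pi * Im z)" for z by (simp add: e_def norm_exp_eq_Re)
  have e_lt: "norm (e z) < 1" if "Im z > 0" for z using that by (simp add: norm_e)
  have conv2: "summable (\<lambda>n. a (n + 2) * q ^ n)" if "norm q < 1" for q
  proof (cases "q = 0")
    case False
    have "summable (\<lambda>n. a (n + 2) * q ^ (n + 2))" using conv[OF that] by (subst summable_iff_shift)
    then have "summable (\<lambda>n. q^2 * (a (n + 2) * q ^ n))" by (simp add: power_add mult_ac power2_eq_square)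
    then show ?thesis using False by (subst (asm) summable_cmult_iff) auto
  qed (use summable_0_powser in auto)
  have Fg: "F q = q^2 * g q" if "norm q < 1" for q
  proof -
    have "F q = (\<Sum>n. a (n + 2) * q ^ (n + 2)) + (\<Sum>i<2. a i * q ^ i)"
      unfolding F_def by (rule suminf_split_initial_segment[OF conv[OF that]])
    also have "(\<Sum>i<2. a i * q ^ i) = 0" using a01 by (simp add: numeral_2_eq_2)
    also have "(\<Sum>n. a (n + 2) * q ^ (n + 2)) = (\<Sum>n. q^2 * (a (n + 2) * q ^ n))" by (simp add: power_add mult_ac power2_eq_square)
    also have "\<dots> = q^2 * g q" unfolding g_def using conv2[OF that] by (rule suminf_mult)
    finally show ?thesis by simp
  qed
  have holo: "(\<lambda>q. \<Sum>n. b n * q ^ n) holomorphic_on ball 0 1" if "\<And>q. norm q < 1 \<Longrightarrow> summable (\<lambda>n. b n * q ^ n)" for b :: "nat \<Rightarrow> complex"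
    by (rule power_series_holomorphic[of 0 1 b "\<lambda>q. \<Sum>n. b n * q ^ n"]) (use that in \<open>auto simp: summable_sums\<close>)
  have hF: "F holomorphic_on ball 0 1" unfolding F_def[abs_def] by (rule holo[OF conv])
  have hg: "g holomorphic_on ball 0 1" unfolding g_def[abs_def] by (rule holo[OF conv2])
  have he: "e holomorphic_on A" for A unfolding e_def[abs_def] by (intro holomorphic_intros)
  define H where "H = {z. Im z > 0}"
  have H: "open H" "connected H"
    unfolding H_def by (auto simp: open_halfspace_Im_gt convex_halfspace_Im_gt convex_connected)
  have hf: "f holomorphic_on H"
    unfolding f_def[abs_def] by (rule holomorphic_on_compose_gen[OF he hF, unfolded o_def]) (auto simp: H_def e_lt)
  have inv_H: "- 1 / z \<in> H" if "z \<in> H" for z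
    using that by (auto simp: H_def Im_divide intro!: divide_pos_pos add_nonneg_pos)
  have modular: "f (- 1 / z) = z ^ (2 * k) * f z" if z: "z \<in> H" for z
  proof -
    \<comment> \<open>The functional equation is given on the imaginary axis only; the identity
      theorem extends it to the half plane.\<close>
    define D where "D z = f (- 1 / z) - z ^ (2 * k) * f z" for z
    have "D z = 0"
    proof (rule analytic_continuation[of D H "(\<lambda>t. \<i> * of_real t) ` {0<..}" \<i> z])
      have "(\<lambda>z. - 1 / z) holomorphic_on H" by (intro holomorphic_intros) (auto simp: H_def)
      from holomorphic_on_compose_gen[OF this hf]
      show "D holomorphic_on H" unfolding D_def[abs_def] using hf inv_H
        by (intro holomorphic_intros) (auto simp: o_def image_subset_iff)
      show "\<i> islimpt (\<lambda>t. \<i> * of_real t) ` {0<..}"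
        unfolding islimpt_sequential
      proof (intro exI[of _ "\<lambda>n. \<i> * of_real (1 + 1 / real (Suc n))"] conjI allI)
        show "(\<lambda>n. \<i> * of_real (1 + 1 / real (Suc n))) \<longlonglongrightarrow> \<i>"
          by (rule tendsto_eq_rhs[of _ "\<i> * of_real (1 + 0)"])
            (intro tendsto_intros LIMSEQ_Suc[OF lim_1_over_n], simp)
        fix n
        have "1 + 1 / real (Suc n) > 0" by (intro add_pos_pos) auto
        moreover have "\<i> * of_real (1 + 1 / real (Suc n)) \<noteq> \<i>"
          by (simp add: complex_eq_iff)
        ultimately show "\<i> * of_real (1 + 1 / real (Suc n)) \<in> (\<lambda>t. \<i> * of_real t) ` {0<..} - {\<i>}" by blast
      qed
      fix w assume "w \<in> (\<lambda>t. \<i> * complex_of_real t) ` {0<..}"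
      then obtain t where t: "t > 0" "w = \<i> * of_real t" by auto
      have e1: "e w = of_real (exp (- 2 * pi * t))"
        unfolding e_def t(2) exp_of_real[symmetric] by (simp add: mult_ac)
      have "- 1 / w = \<i> * of_real (1 / t)" using t by (simp add: field_simps)
      then have e2: "e (- 1 / w) = of_real (exp (- 2 * pi / t))"
        unfolding e_def exp_of_real[symmetric] by (simp add: mult_ac)
      have "w ^ (2 * k) = (-1) ^ k * of_real (t ^ (2 * k))"
        by (simp add: t(2) power_mult power_mult_distrib) (rule power_minus)
      then show "D w = 0" using fun_eq[OF t(1)] unfolding D_def f_def F_def e1 e2 by simp
    qed (use H z in \<open>auto simp: H_def\<close>)
    then show ?thesis by (simp add: D_def)
  qed
  define p where "p z = norm (f z) * Im z ^ k" for z
  have p_shift: "p (z + 1) = p z" for z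
    by (simp add: p_def f_def e_def distrib_left exp_add)
  have p_inv: "p (- 1 / z) = p z" if "Im z > 0" for z
  proof -
    have z0: "z \<noteq> 0" using that by auto
    have im: "Im (- 1 / z) = Im z / (norm z)^2" by (simp add: Im_divide cmod_power2)
    have mz: "f (- 1 / z) = z ^ (2 * k) * f z" using that by (intro modular) (simp add: H_def)
    have "p (- 1 / z) = norm z ^ (2 * k) * norm (f z) * (Im z / (norm z)^2) ^ k"
      unfolding p_def im mz by (simp only: norm_mult norm_power)
    also have "\<dots> = p z" using z0 by (simp add: p_def power_divide power_mult)
    finally show ?thesis .
  qed
  have pg: "p z = exp (- 4 * pi * Im z) * norm (g (e z)) * Im z ^ k" if "Im z > 0" for z
    using Fg[OF e_lt[OF that]]
    by (simp add: p_def f_def norm_mult norm_power norm_e exp_of_nat_mult[symmetric])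
  \<comment> \<open>Just below \<open>sqrt 3 / 2\<close>, the lowest height of the usual fundamental
    domain, as the reduction requires \<open>1/4 + c^2 < 1\<close>.\<close>
  define c :: real where "c = 86/100"
  have reduce: "\<exists>z'. Im z' \<ge> c \<and> p z' = p z" if "Im z > 0" for z
    by (rule upper_half_plane_reduction[of p c]) (use p_shift p_inv that in \<open>auto simp: c_def power2_eq_square\<close>)
  obtain A where A: "\<And>q. norm q \<le> exp (- 2 * pi * c) \<Longrightarrow> norm (g q) \<le> A"
  proof -
    have "exp (- 2 * pi * c) < 1" by (simp add: c_def)
    then have "cball 0 (exp (- 2 * pi * c)) \<subseteq> ball (0::complex) 1" by (simp add: cball_subset_ball_iff)
    then have "compact (g ` cball 0 (exp (- 2 * pi * c)))"
      by (intro compact_continuous_image holomorphic_on_imp_continuous_on holomorphic_on_subset[OF hg]) auto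
    then have "bounded (g ` cball 0 (exp (- 2 * pi * c)))" by (rule compact_imp_bounded)
    then obtain A where "\<forall>x\<in>cball 0 (exp (- 2 * pi * c)). norm (g x) \<le> A"
      unfolding bounded_iff by auto
    then show ?thesis by (intro that[of A]) auto
  qed
  have bdd: "p z \<le> A * fact k" if z0: "Im z > 0" for z
  proof -
    obtain z' where z': "Im z' \<ge> c" "p z' = p z" using reduce[OF z0] by auto
    then have y: "Im z' > 0" by (simp add: c_def)
    have "norm (g (e z')) \<le> A" using z'(1) by (intro A) (simp add: norm_e)
    \<comment> \<open>One term of the exponential series is at most its sum. This bounds
      \<open>p\<close> and makes the supremum \<open>M\<close> finite.\<close>
    moreover have "Im z' ^ k \<le> fact k * exp (4 * pi * Im z')"
    proof -
      have "Im z' ^ k \<le> (4 * pi * Im z') ^ k" using y pi_gt3 by (intro power_mono) auto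
      also have "\<dots> = fact k * ((4 * pi * Im z') ^ k / fact k)" by simp
      also have "\<dots> \<le> fact k * exp (4 * pi * Im z')"
      proof (intro mult_left_mono)
        have "(\<Sum>n\<in>{k}. (4 * pi * Im z') ^ n /\<^sub>R fact n) \<le> (\<Sum>n. (4 * pi * Im z') ^ n /\<^sub>R fact n)"
          using y by (intro sum_le_suminf summable_exp_generic) auto
        then show "(4 * pi * Im z') ^ k / fact k \<le> exp (4 * pi * Im z')" by (simp add: exp_def divide_inverse mult.commute)
      qed auto
      finally show ?thesis .
    qed
    ultimately have "norm (g (e z')) * (exp (- 4 * pi * Im z') * Im z' ^ k) \<le> A * (exp (- 4 * pi * Im z') * (fact k * exp (4 * pi * Im z')))"
      using y by (intro mult_mono mult_left_mono) (auto intro: order.trans[OF norm_ge_zero])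
    moreover have "exp (- 4 * pi * Im z') * (fact k * exp (4 * pi * Im z')) = fact k"
      by (simp add: exp_minus)
    moreover have "norm (g (e z')) * (exp (- 4 * pi * Im z') * Im z' ^ k) = p z"
      unfolding z'(2)[symmetric] pg[OF y] by (simp only: mult_ac)
    ultimately show ?thesis by (simp only:)
  qed
  define M where "M = Sup (p ` H)"
  have bddp: "bdd_above (p ` H)" using bdd by (intro bdd_aboveI2[of _ _ "A * fact k"]) (auto simp: H_def)
  have M: "p z \<le> M" if "Im z > 0" for z
    unfolding M_def using that by (intro cSUP_upper bddp) (auto simp: H_def)
  have M0: "M \<ge> 0" using M[of \<i>] by (simp add: p_def) (metis norm_ge_zero order.trans)
  \<comment> \<open>The bound by \<open>M\<close> at height \<open>y\<close>; the horizontal line at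
    that height is mapped by \<open>e\<close> onto this circle.\<close>
  have circle: "norm (g q) \<le> M / y ^ k * exp (4 * pi * y)" if "y > 0" "norm q = exp (- 2 * pi * y)" for q y
  proof -
    define z where "z = Ln q / (2 * pi * \<i>)"
    have q0: "q \<noteq> 0" using that(2) by auto
    have ez: "e z = q" using q0 by (simp add: e_def z_def)
    have "exp (- 2 * pi * Im z) = exp (- 2 * pi * y)" using norm_e[of z] that(2) by (simp add: ez)
    then have im: "Im z = y" by simp
    then have "exp (- 4 * pi * y) * norm (g q) * y ^ k \<le> M" using M[of z] pg[of z] that(1) ez by simp
    then have "norm (g q) * y ^ k \<le> M * exp (4 * pi * y)" by (simp add: exp_minus field_simps)
    then show ?thesis using that(1) by (simp add: field_simps)
  qed
  have max_mod: "norm (h q) \<le> B"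
    if "h holomorphic_on ball 0 1" "y > 0" "norm q \<le> exp (- 2 * pi * y)"
      "\<And>q. norm q = exp (- 2 * pi * y) \<Longrightarrow> norm (h q) \<le> B" for h :: "complex \<Rightarrow> complex" and q y B
  proof (rule maximum_modulus_frontier[of h "cball 0 (exp (- 2 * pi * y))"])
    have "exp (- 2 * pi * y) < 1" using that(2) by simp
    then have sub: "cball 0 (exp (- 2 * pi * y)) \<subseteq> ball (0::complex) 1" by (simp add: cball_subset_ball_iff)
    show "h holomorphic_on interior (cball 0 (exp (- 2 * pi * y)))"
      using sub that(1) by (meson holomorphic_on_subset interior_subset order.trans)
    show "continuous_on (closure (cball 0 (exp (- 2 * pi * y)))) h"
      using sub that(1) by (simp add: holomorphic_on_imp_continuous_on holomorphic_on_subset)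
    show "norm (h z) \<le> B" if "z \<in> frontier (cball 0 (exp (- 2 * pi * y)))" for z
      using that \<open>\<And>q. norm q = exp (- 2 * pi * y) \<Longrightarrow> norm (h q) \<le> B\<close> by simp
  qed (use that in auto)
  \<comment> \<open>Transports a bound for \<open>g\<close> from height \<open>y\<close> up to
    height \<open>Im z\<close>. The growth of the power is estimated by
    \<open>1 + x \<le> exp x\<close>, so the result decays upwards as soon as
    \<open>real k / y < 4 * pi\<close>. The factor \<open>C\<close> leaves room for an additional
    gain.\<close>
  have final: "p z \<le> C * exp ((real k / y - 4 * pi) * (Im z - y)) * M"
    if "0 < y" "y \<le> Im z" "norm (g (e z)) \<le> C * (M / y ^ k * exp (4 * pi * y))" "C \<ge> 0" for z y C
  proof -
    define s where "s = Im z"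
    have s: "s > 0" using that by (simp add: s_def)
    have "p z \<le> exp (- 4 * pi * s) * (C * (M / y ^ k * exp (4 * pi * y))) * s ^ k"
      unfolding s_def pg[OF s[unfolded s_def]]
      by (intro mult_right_mono mult_left_mono that(3)) (use s in \<open>auto simp: s_def\<close>)
    also have "\<dots> = C * M * (exp (- 4 * pi * s) * exp (4 * pi * y)) * (s / y) ^ k"
      by (simp add: power_divide)
    also have "exp (- 4 * pi * s) * exp (4 * pi * y) = exp (- 4 * pi * (s - y))"
      by (simp add: exp_add[symmetric] algebra_simps)
    also have "C * M * exp (- 4 * pi * (s - y)) * (s / y) ^ k \<le> C * M * exp (- 4 * pi * (s - y)) * exp (real k * ((s - y) / y))"
    proof (intro mult_left_mono)
      have "s / y = 1 + (s - y) / y" using that(1) by (simp add: field_simps)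
      then have "s / y \<le> exp ((s - y) / y)" by simp
      then have "(s / y) ^ k \<le> exp ((s - y) / y) ^ k" using s that(1) by (intro power_mono) auto
      then show "(s / y) ^ k \<le> exp (real k * ((s - y) / y))" by (simp only: exp_of_nat_mult)
    qed (use that M0 in auto)
    also have "\<dots> = C * exp (- 4 * pi * (s - y) + real k * ((s - y) / y)) * M"
      by (simp only: exp_add mult_ac)
    also have "- 4 * pi * (s - y) + real k * ((s - y) / y) = (real k / y - 4 * pi) * (s - y)"
      by (simp add: algebra_simps)
    finally show ?thesis by (simp add: s_def)
  qed
  have pi_lb: "pi > (6283/2000)" using pi_approx by simp
  \<comment> \<open>\<open>4 * pi\<close> exceeds 12.566, so the exponential rate is at least
    61/10000, and a height difference of 3/1000 produces the factor
    \<open>exp (- (1/100000))\<close>. The level is 4/5 for \<open>k \<le> 10\<close>, where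
    \<open>real k / y\<close> is at most 12.5, and 877/1000 for \<open>k = 11\<close>.\<close>
  have simple: "p z \<le> exp (- (1/100000)) * M" if "real k / y \<le> (125599/10000)" "0 < y" "y + (3/1000) \<le> Im z" for z y
  proof -
    have "norm (g (e z)) \<le> M / y ^ k * exp (4 * pi * y)"
      by (rule max_mod[OF hg, of y]) (use that circle[of y] in \<open>auto simp: norm_e\<close>)
    then have "p z \<le> 1 * exp ((real k / y - 4 * pi) * (Im z - y)) * M"
      using that by (intro final) auto
    also have "\<dots> \<le> exp (- (1/100000)) * M"
    proof -
      have "(4 * pi - real k / y) * (Im z - y) \<ge> (61/10000) * (3/1000)"
      proof (rule mult_mono)
        show "(61/10000) \<le> 4 * pi - real k / y" using that(1) pi_lb by linarith
        show "(3/1000) \<le> Im z - y" using that(3) by simp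
        show "0 \<le> 4 * pi - real k / y" using that(1) pi_lb by linarith
      qed auto
      then have "(real k / y - 4 * pi) * (Im z - y) \<le> - (1/100000)" by (simp add: algebra_simps)
      then show ?thesis using M0 by (intro mult_right_mono) auto
    qed
    finally show ?thesis .
  qed
  have key: "p z \<le> exp (- (1/100000)) * M" if z: "Im z \<ge> c" for z
  proof (cases "k = 11 \<and> Im z < (22/25)")
    case False
    show ?thesis
    proof (cases "k = 11")
      case True then show ?thesis using False by (intro simple[of "(877/1000)"]) auto
    next
      case False
      then show ?thesis using k z by (intro simple[of "(4/5)"]) (auto simp: c_def)
    qed
  next
    \<comment> \<open>For \<open>k = 11\<close> the rate at level 4/5 has the wrong sign, and the
      level 877/1000 is above the bottom of the reduced region. The missing factor comes from the
      zero at \<open>\<i>\<close>, through a Blaschke factor for the disc of radius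
      \<open>r\<close>.\<close>
    case True
    then have k11: "k = 11" and zu: "Im z < (22/25)" by auto
    define r where "r = exp (- 2 * pi * (4/5))"
    define b where "b = exp (- 2 * pi * (1/5))"
    define qi where "qi = exp (- 2 * pi)"
    have r: "r > 0" by (simp add: r_def)
    have qib: "qi = r * b" by (simp add: qi_def r_def b_def exp_add[symmetric])
    have b: "b > 0" "b \<le> (33/100)"
    proof -
      have "exp (2 * pi * (1/5)) \<ge> 1 + 2 * pi * (1/5) + (2 * pi * (1/5))^2 / 2" by (rule exp_lower_Taylor_quadratic) auto
      moreover have "(2 * pi * (1/5))^2 \<ge> ((157/125)::real)^2" using pi_lb by (intro power_mono) auto
      ultimately have "exp (2 * pi * (1/5)) \<ge> 1 / (33/100)" using pi_lb by (simp add: power2_eq_square)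
      then show "b \<le> (33/100)" by (simp add: b_def exp_minus field_simps)
      show "b > 0" by (simp add: b_def)
    qed
    \<comment> \<open>\<open>\<i>\<close> is fixed by the inversion and
      \<open>\<i> ^ 22 = - 1\<close>, so \<open>f \<i> = - f \<i>\<close>.\<close>
    have "f \<i> = 0" using modular[of \<i>] k11 by (simp add: H_def)
    moreover have ei: "e \<i> = of_real qi"
      unfolding e_def qi_def exp_of_real[symmetric] by (simp add: mult_ac)
    ultimately have gqi: "g (of_real qi) = 0" using Fg[of "e \<i>"] e_lt[of \<i>] by (auto simp: f_def qi_def)
    define h where "h q = (if q = of_real qi then deriv g (of_real qi) else (g q - g (of_real qi)) / (q - of_real qi))" for q
    have hh: "h holomorphic_on ball 0 1" unfolding h_def[abs_def] by (rule pole_lemma_open[OF hg]) auto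
    have gh: "g q = h q * (q - of_real qi)" for q using gqi by (auto simp: h_def)
    define q0 where "q0 = e z"
    define K where "K = M / (4/5) ^ k * exp (4 * pi * (4/5))"
    have K0: "K \<ge> 0" using M0 by (simp add: K_def)
    define u where "u = q0 / of_real r"
    have q0u: "q0 = of_real r * u" using r by (simp add: u_def)
    have a: "norm u \<le> (7/10)"
    proof -
      have "norm u = exp (- (2 * pi * (Im z - (4/5))))"
        using r by (simp add: u_def q0_def norm_divide norm_e r_def exp_diff[symmetric] algebra_simps)
      moreover have "exp (2 * pi * (Im z - (4/5))) \<ge> 1 / (7/10)"
      proof -
        define x where "x = 2 * pi * (Im z - (4/5))"
        have x: "x \<ge> 2 * (6283/2000) * (3/50)" unfolding x_def using pi_lb z by (intro mult_mono) (auto simp: c_def)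
        then have "exp x \<ge> 1 + x + x^2 / 2" by (intro exp_lower_Taylor_quadratic) auto
        moreover have "x^2 \<ge> (2 * (6283/2000) * (3/50))^2" using x by (intro power_mono) auto
        ultimately show ?thesis using x by (simp add: x_def[symmetric] power2_eq_square)
      qed
      ultimately have "norm u * exp (2 * pi * (Im z - (4/5))) = 1" "exp (2 * pi * (Im z - (4/5))) \<ge> 10/7"
        by (simp_all add: exp_minus)
      moreover have "norm u * (10/7) \<le> norm u * exp (2 * pi * (Im z - (4/5)))"
        using calculation(2) by (intro mult_left_mono) auto
      ultimately show ?thesis by linarith
    qed
    \<comment> \<open>On the circle of radius \<open>r\<close> the modulus of
      \<open>r^2 - qi * q\<close> is \<open>r\<close> times that of \<open>q - qi\<close>.
      Exchanging these factors of \<open>g\<close> therefore keeps the boundary estimate, up to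
      \<open>r\<close>, while inside the disc the new factor is larger; this is the gain.\<close>
    have "norm (h q0 * (of_real (r^2) - of_real qi * q0)) \<le> r * K"
    proof (rule max_mod[of "\<lambda>q. h q * (of_real (r^2) - of_real qi * q)" "(4/5)"])
      show "(\<lambda>q. h q * (of_real (r^2) - of_real qi * q)) holomorphic_on ball 0 1"
        by (intro holomorphic_intros hh)
      show "norm q0 \<le> exp (- 2 * pi * (4/5))" using z by (simp add: q0_def norm_e c_def)
      fix q :: complex assume q: "norm q = exp (- 2 * pi * (4/5))"
      have rq: "r = norm q" using q by (simp add: r_def)
      have "of_real (r^2) = q * cnj q" unfolding rq by (rule complex_norm_square)
      then have "of_real (r^2) - of_real qi * q = q * (cnj (q - of_real qi))" by (simp add: algebra_simps)
      then have "norm (h q * (of_real (r^2) - of_real qi * q)) = r * norm (g q)"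
        unfolding gh[of q] rq by (simp add: norm_mult norm_minus_commute complex_mod_cnj flip: complex_cnj_diff)
      also have "\<dots> \<le> r * K" using circle[of "4/5" q] q r by (intro mult_left_mono) (auto simp: K_def)
      finally show "norm (h q * (of_real (r^2) - of_real qi * q)) \<le> r * K" .
    qed auto
    moreover have "of_real (r^2) - of_real qi * q0 = of_real (r^2) * (1 - of_real b * u)"
      by (simp add: qib q0u algebra_simps power2_eq_square)
    ultimately have hb: "norm (h q0) * r * norm (1 - of_real b * u) \<le> K"
      using r by (simp add: norm_mult power2_eq_square)
    \<comment> \<open>The quotient of the two norms is the modulus of a Blaschke factor of the unit
      disc with zero \<open>b\<close>. For \<open>norm u \<le> 7/10\<close> and
      \<open>b \<le> 33/100\<close> its square is at most 3/4, and 867/1000 exceeds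
      \<open>sqrt (3/4)\<close>.\<close>
    have bl: "norm (u - of_real b) \<le> (867/1000) * norm (1 - of_real b * u)"
    proof -
      have n1: "(norm (u - of_real b))^2 = (norm u)^2 + b^2 - 2 * b * Re u"
        unfolding cmod_power2 by (simp add: power2_eq_square algebra_simps)
      have n2: "(norm (1 - of_real b * u))^2 = 1 + b^2 * (norm u)^2 - 2 * b * Re u"
        unfolding cmod_power2 by (simp add: power2_eq_square algebra_simps)
      have "- Re u \<le> (7/10)" using a abs_Re_le_cmod[of u] by linarith
      then have "b * (- Re u) \<le> b * (7/10)" using b by (intro mult_left_mono) auto
      then have "b * (- Re u) \<le> (33/100) * (7/10)" using b by linarith
      moreover have "(norm u)^2 \<le> (7/10)^2" "b^2 \<le> (33/100)^2" using a b by (auto intro!: power_mono)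
      moreover have "b^2 * (norm u)^2 \<ge> 0" by simp
      ultimately have "(norm (u - of_real b))^2 \<le> (3/4) * (norm (1 - of_real b * u))^2"
        unfolding n1 n2 by (simp add: power2_eq_square algebra_simps)
      also have "\<dots> \<le> ((867/1000) * norm (1 - of_real b * u))^2" by (simp add: power_mult_distrib power2_eq_square mult_right_mono)
      finally show ?thesis by (rule power2_le_imp_le) auto
    qed
    have "norm (g q0) = norm (h q0) * r * norm (u - of_real b)"
    proof -
      have "q0 - of_real qi = of_real r * (u - of_real b)" by (simp add: q0u qib algebra_simps)
      then show ?thesis unfolding gh[of q0] using r by (simp add: norm_mult)
    qed
    also have "\<dots> \<le> norm (h q0) * r * ((867/1000) * norm (1 - of_real b * u))" using bl r by (intro mult_left_mono) auto
    also have "\<dots> \<le> (867/1000) * K" using hb by (simp add: mult_ac)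
    finally have "p z \<le> (867/1000) * exp ((real k / (4/5) - 4 * pi) * (Im z - (4/5))) * M"
      using z by (intro final) (auto simp: q0_def K_def c_def)
    also have "(867/1000) * exp ((real k / (4/5) - 4 * pi) * (Im z - (4/5))) \<le> exp (- (1/100000))"
    proof -
      \<comment> \<open>From level 4/5 the exponential may grow, but at most to
        \<open>exp (1/10)\<close> below height 22/25, which the factor 867/1000 outweighs.\<close>
      have "(real k / (4/5) - 4 * pi) * (Im z - (4/5)) \<le> (6/5) * (2/25)"
        using z zu k11 pi_lb pi_less_4 by (intro mult_mono) (auto simp: c_def)
      then have "exp ((real k / (4/5) - 4 * pi) * (Im z - (4/5))) \<le> exp (1/10)" by simp
      also have "exp ((1/10)::real) \<le> 1 / (1 - (1/10))"
        using exp_ge_add_one_self[of "- ((1/10)::real)"] by (simp add: exp_minus field_simps)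
      finally have "(867/1000) * exp ((real k / (4/5) - 4 * pi) * (Im z - (4/5))) \<le> 1 - (1/100000)" by simp
      also have "\<dots> \<le> exp (- ((1/100000)::real))" using exp_ge_add_one_self[of "- ((1/100000)::real)"] by simp
      finally show ?thesis .
    qed
    then have "(867/1000) * exp ((real k / (4/5) - 4 * pi) * (Im z - (4/5))) * M \<le> exp (- (1/100000)) * M"
      using M0 by (rule mult_right_mono)
    finally show ?thesis .
  qed
  \<comment> \<open>Every value of \<open>p\<close> is attained in the reduced region, so the
    supremum is bounded by a proper fraction of itself.\<close>
  have "M \<le> exp (- (1/100000)) * M"
    unfolding M_def
  proof (rule cSUP_least)
    show "H \<noteq> {}" by (auto simp: H_def intro: exI[of _ \<i>])
    fix z assume "z \<in> H"
    then obtain z' where "Im z' \<ge> c" "p z' = p z" using reduce[of z] by (auto simp: H_def)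
    then show "p z \<le> exp (- (1/100000)) * Sup (p ` H)" using key[of z'] by (simp add: M_def)
  qed
  moreover have "exp (- (1/100000) :: real) < 1" by simp
  ultimately have "M \<le> 0" using M0 by (smt (verit) mult_less_cancel_right2)
  then have M00: "M = 0" using M0 by simp
  have pz: "p z = 0" if z: "Im z > 0" for z
  proof (rule antisym)
    show "p z \<le> 0" using M[OF z] M00 by simp
    show "0 \<le> p z" using z by (simp add: p_def)
  qed
  have gz: "F q = 0" if q: "norm q < 1" "q \<noteq> 0" for q
  proof -
    define z where "z = Ln q / (2 * pi * \<i>)"
    have ez: "e z = q" using q by (simp add: e_def z_def)
    have "exp (- 2 * pi * Im z) < 1" using norm_e[of z] q by (simp add: ez)
    then have "Im z > 0" by (simp add: zero_less_mult_iff)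
    from pz[OF this] show ?thesis using \<open>Im z > 0\<close> by (simp add: p_def f_def ez)
  qed
  have F0: "F q = 0" if "norm q < 1" for q
    using gz[OF that] Fg[OF that] by (cases "q = 0") auto
  show "a n = 0"
  proof (rule ccontr)
    assume an: "a n \<noteq> 0"
    then have "n > 0" using a01 by (cases n) auto
    have sm: "(\<lambda>n. a n * (q - 0) ^ n) sums F q" if "norm (q - 0) < 1" for q
      using conv[of q] that unfolding F_def by (simp add: summable_sums)
    obtain s where s: "0 < s" "\<And>z. z \<in> cball 0 s - {0} \<Longrightarrow> F z \<noteq> 0"
      using powser_0_nonzero[OF zero_less_one sm F0[of 0] an \<open>n > 0\<close>] by auto
    define q :: complex where "q = of_real (min s (1/2))"
    have "q \<in> cball 0 s - {0}" "norm q < 1" using s(1) by (auto simp: q_def)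
    then show False using s(2) F0 by blast
  qed
qed

section \<open>Moments of lattice shells\<close>

text \<open>Arguments are restricted to nonnegative numbers because the argument will be the square
  of a real parameter. A nonzero coefficient of the difference would leave a punctured neighbourhood
  of 0 without zeros.\<close>

lemma powser_unique_nonneg:
  fixes a b :: "nat \<Rightarrow> real"
  assumes a: "\<And>x. x \<ge> 0 \<Longrightarrow> (\<lambda>m. a m * x ^ m) sums S x" and b: "\<And>x. x \<ge> 0 \<Longrightarrow> (\<lambda>m. b m * x ^ m) sums S x"
  shows "a m = b m"
proof (rule ccontr)
  assume ne: "a m \<noteq> b m"
  define d where "d m = a m - b m" for m
  have ds: "(\<lambda>m. d m * x ^ m) sums 0" if "x \<ge> 0" for x
    using sums_diff[OF a[OF that] b[OF that]] by (simp add: d_def left_diff_distrib)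
  define f where "f x = (\<Sum>m. d m * x ^ m)" for x
  have sm: "(\<lambda>m. d m * (x - 0) ^ m) sums f x" if "norm (x - 0) < 1" for x
    using powser_inside[of d 1 x] sums_summable[OF ds[of 1]] that by (simp add: f_def summable_sums)
  have f0: "f x = 0" if "x \<ge> 0" for x using sums_unique[OF ds[OF that]] by (simp add: f_def)
  have d0: "d 0 = 0" using f0[of 0] powser_zero[of d] by (simp add: f_def)
  have "d m \<noteq> 0" using ne by (simp add: d_def)
  moreover from this d0 have "m > 0" by (cases m) auto
  ultimately obtain s where s: "0 < s" "\<And>z. z \<in> cball 0 s - {0} \<Longrightarrow> f z \<noteq> 0"
    using powser_0_nonzero[OF zero_less_one sm f0[OF order.refl], of m] by auto
  then have "f s \<noteq> 0" by simp
  then show False using f0[of s] s(1) by simp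
qed

lemma has_sum_swap_abs:
  fixes f :: "'a \<Rightarrow> 'b \<Rightarrow> real"
  assumes abs: "(\<lambda>(x, y). \<bar>f x y\<bar>) summable_on A \<times> B"
    and g: "\<And>x. x \<in> A \<Longrightarrow> (f x has_sum g x) B" and h: "\<And>y. y \<in> B \<Longrightarrow> ((\<lambda>x. f x y) has_sum h y) A"
  shows "(h has_sum infsum g A) B"
proof -
  have "(\<lambda>p. norm ((\<lambda>(x, y). f x y) p)) summable_on A \<times> B" using abs by (simp add: case_prod_unfold)
  then have "(\<lambda>(x, y). f x y) summable_on A \<times> B" by (rule abs_summable_summable)
  then obtain S where S: "((\<lambda>(x, y). f x y) has_sum S) (A \<times> B)" by (auto simp: summable_on_def)
  have "(g has_sum S) A" by (rule has_sum_SigmaD[OF S]) (use g in auto)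
  moreover have "((\<lambda>(y, x). f x y) has_sum S) (B \<times> A)"
  proof -
    have "bij_betw prod.swap (B \<times> A) (A \<times> B)" by (auto simp: bij_betw_def inj_on_def product_swap)
    from has_sum_reindex_bij_betw[OF this, of "\<lambda>(x, y). f x y" S] S show ?thesis by (simp add: case_prod_unfold)
  qed
  then have "(h has_sum S) B" by (rule has_sum_SigmaD) (use h in auto)
  ultimately show ?thesis by (simp add: infsumI)
qed

lemma cosh_paired: "(\<lambda>n. x ^ (2 * n) / fact (2 * n)) sums cosh (x::real)"
proof -
  have "(\<lambda>n. (\<lambda>n. if even n then x ^ n /\<^sub>R fact n else 0) (2 * n)) sums cosh x"
    by (subst sums_mono_reindex) (auto simp: strict_mono_def cosh_converges elim!: evenE)
  then show ?thesis by (simp add: divide_inverse mult.commute)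
qed

lemma power_le_fact_exp:
  fixes x :: real assumes "x \<ge> 0" shows "x ^ m \<le> fact m * exp x"
proof -
  have "(\<Sum>n\<in>{m}. x ^ n /\<^sub>R fact n) \<le> (\<Sum>n. x ^ n /\<^sub>R fact n)"
    using assms by (intro sum_le_suminf summable_exp_generic) auto
  then show ?thesis by (simp add: exp_def field_simps)
qed

section \<open>Theta series weighted by even powers of a linear form\<close>

context unimodular_lattice
begin

text \<open>The power is bounded by an exponential, and the square is completed against half of the
  Gaussian.\<close>

lemma gaussian_moment_summable:
  assumes t: "t > 0"
  shows "(\<lambda>y. norm y ^ j * exp (- pi * t * (norm y)^2)) summable_on \<Lambda>"
proof (rule summable_on_comparison_test)
  show "(\<lambda>y. (fact j * exp (1 / (2 * pi * t))) * exp (- pi * (t / 2) * (norm y)^2)) summable_on \<Lambda>"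
    using summable_on_lattice_gaussian[of "t / 2" 0] t by (intro summable_on_cmult_right) simp
  fix y :: 'a
  define x where "x = norm y"
  have "0 \<le> (pi * t * x - 1)^2 / (2 * pi * t)" using t by simp
  also have "\<dots> = pi * (t / 2) * x^2 - x + 1 / (2 * pi * t)"
    using t by (simp add: power2_eq_square field_simps)
  finally have le: "x + - pi * t * x^2 \<le> 1 / (2 * pi * t) + - pi * (t / 2) * x^2" by (simp add: field_simps)
  have "x ^ j * exp (- pi * t * x^2) \<le> fact j * exp x * exp (- pi * t * x^2)"
    by (intro mult_right_mono power_le_fact_exp) (auto simp: x_def)
  also have "\<dots> = fact j * exp (x + - pi * t * x^2)" by (simp only: exp_add mult.assoc)
  also have "\<dots> \<le> fact j * exp (1 / (2 * pi * t) + - pi * (t / 2) * x^2)"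
    using le by (intro mult_left_mono) auto
  also have "\<dots> = (fact j * exp (1 / (2 * pi * t))) * exp (- pi * (t / 2) * x^2)"
    by (simp only: exp_add mult.assoc)
  finally show "norm y ^ j * exp (- pi * t * (norm y)^2) \<le> (fact j * exp (1 / (2 * pi * t))) * exp (- pi * (t / 2) * (norm y)^2)"
    by (simp add: x_def)
qed auto

text \<open>Infinitely many equal positive terms would contradict the summability of the
  Gaussian.\<close>

lemma finite_shell: "finite {y \<in> \<Lambda>. y \<bullet> y = r}"
proof (rule ccontr)
  define S where "S = {y \<in> \<Lambda>. y \<bullet> y = r}"
  assume "infinite {y \<in> \<Lambda>. y \<bullet> y = r}"
  then have inf: "infinite S" by (simp add: S_def)
  define f where "f y = exp (- pi * 1 * (norm (y + 0))^2)" for y :: 'a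
  have s: "f summable_on \<Lambda>" unfolding f_def by (rule summable_on_lattice_gaussian) simp
  obtain N where N: "real N > infsum f \<Lambda> / exp (- pi * r)" using reals_Archimedean2 by blast
  obtain F where F: "finite F" "card F = N" "F \<subseteq> S" using infinite_arbitrarily_large[OF inf] by blast
  have "(\<Sum>y\<in>F. exp (- pi * r)) = sum f F"
    using F(3) by (intro sum.cong) (auto simp: S_def f_def power2_norm_eq_inner)
  also have "\<dots> \<le> infsum f \<Lambda>" by (rule finite_sum_le_infsum[OF s F(1)]) (use F in \<open>auto simp: S_def f_def\<close>)
  finally show False using N F(2) by (simp add: field_simps)
qed

definition moment_theta :: "'a \<Rightarrow> nat \<Rightarrow> real \<Rightarrow> real" where
  "moment_theta u m t = (\<Sum>\<^sub>\<infinity>y\<in>\<Lambda>. (y \<bullet> u) ^ (2 * m) * exp (- pi * t * (norm y)^2))"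

lemma moment_theta_has_sum:
  assumes "t > 0" "norm u = 1"
  shows "((\<lambda>y. (y \<bullet> u) ^ (2 * m) * exp (- pi * t * (norm y)^2)) has_sum moment_theta u m t) \<Lambda>"
  unfolding moment_theta_def
proof (rule has_sum_infsum, rule summable_on_abs_le[OF gaussian_moment_summable[OF assms(1), of "2 * m"]])
  fix y
  have "\<bar>y \<bullet> u\<bar> \<le> norm y" using Cauchy_Schwarz_ineq2[of y u] assms(2) by simp
  then have "\<bar>y \<bullet> u\<bar> ^ (2 * m) \<le> norm y ^ (2 * m)" by (intro power_mono) auto
  then show "\<bar>(y \<bullet> u) ^ (2 * m) * exp (- pi * t * (norm y)\<^sup>2)\<bar> \<le> norm y ^ (2 * m) * exp (- pi * t * (norm y)\<^sup>2)"
    by (simp add: abs_mult power_abs)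
qed

text \<open>Completing the square turns the terms into those of a shifted Gaussian, up to a constant
  factor.\<close>

lemma exp_inner_summable:
  assumes "t > 0" "norm u = 1"
  shows "(\<lambda>y. exp (- pi * t * (norm y)^2) * exp (2 * pi * s * (y \<bullet> u))) summable_on \<Lambda>"
proof -
  have "(\<lambda>y. exp (pi * s^2 / t) * exp (- pi * t * (norm (y + (- s / t) *\<^sub>R u))^2)) summable_on \<Lambda>"
    by (intro summable_on_cmult_right summable_on_lattice_gaussian assms)
  moreover have "exp (pi * s^2 / t) * exp (- pi * t * (norm (y + (- s / t) *\<^sub>R u))^2) = exp (- pi * t * (norm y)^2) * exp (2 * pi * s * (y \<bullet> u))" for y
  proof -
    have "(norm (y + (- s / t) *\<^sub>R u))^2 = (norm y)^2 - 2 * (s / t) * (y \<bullet> u) + (s / t)^2"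
      using assms(2) unfolding power2_norm_eq_inner by (simp add: inner_simps inner_commute norm_eq_1 power2_eq_square algebra_simps)
    moreover have "pi * s^2 / t + - pi * t * ((norm y)^2 - 2 * (s / t) * (y \<bullet> u) + (s / t)^2) = - pi * t * (norm y)^2 + 2 * pi * s * (y \<bullet> u)"
      using assms(1) by (simp add: power2_eq_square field_simps)
    ultimately have "pi * s^2 / t + - pi * t * (norm (y + (- s / t) *\<^sub>R u))^2 = - pi * t * (norm y)^2 + 2 * pi * s * (y \<bullet> u)"
      by (simp only:)
    then show ?thesis by (simp only: exp_add[symmetric])
  qed
  ultimately show ?thesis by simp
qed

lemma cosh_inner_summable:
  assumes "t > 0" "norm u = 1"
  shows "(\<lambda>y. exp (- pi * t * (norm y)^2) * cosh (2 * pi * s * (y \<bullet> u))) summable_on \<Lambda>"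
proof -
  have "(\<lambda>y. (1/2) * (exp (- pi * t * (norm y)^2) * exp (2 * pi * s * (y \<bullet> u)) + exp (- pi * t * (norm y)^2) * exp (2 * pi * (- s) * (y \<bullet> u)))) summable_on \<Lambda>"
    by (intro summable_on_cmult_right summable_on_add exp_inner_summable assms)
  moreover have "exp (- pi * t * (norm y)^2) * cosh (2 * pi * s * (y \<bullet> u)) =
    (1/2) * (exp (- pi * t * (norm y)^2) * exp (2 * pi * s * (y \<bullet> u)) + exp (- pi * t * (norm y)^2) * exp (2 * pi * (- s) * (y \<bullet> u)))" for y
    by (simp add: cosh_field_def distrib_left)
  ultimately show ?thesis by (simp only:)
qed

text \<open>The sign \<sigma> covers both uses: -1 gives the cosine and 1 the hyperbolic cosine. In
  either case the double series is dominated by that of the hyperbolic cosine, which permits the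
  interchange. The weighted theta series thus become the coefficients of a generating function in
  \<open>s\<close>.\<close>

lemma moment_theta_expansion:
  assumes t: "t > 0" and u: "norm u = 1" and \<sigma>: "\<bar>\<sigma>\<bar> = 1"
    and E: "\<And>x::real. (\<lambda>m. \<sigma> ^ m / fact (2 * m) * x ^ (2 * m)) sums E x"
  shows "(\<lambda>m. \<sigma> ^ m * (2 * pi * s) ^ (2 * m) / fact (2 * m) * moment_theta u m t) sums
    (\<Sum>\<^sub>\<infinity>y\<in>\<Lambda>. exp (- pi * t * (norm y)^2) * E (2 * pi * s * (y \<bullet> u)))"
proof -
  define c where "c y = exp (- pi * t * (norm y)^2)" for y :: 'a
  define f where "f y m = c y * (\<sigma> ^ m / fact (2 * m) * (2 * pi * s * (y \<bullet> u)) ^ (2 * m))" for y m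
  have abs_f: "\<bar>f y m\<bar> = c y * ((2 * pi * s * (y \<bullet> u)) ^ (2 * m) / fact (2 * m))" for y m
  proof -
    have z: "\<bar>z ^ (2 * m)\<bar> = z ^ (2 * m)" for z :: real by (simp add: abs_of_nonneg)
    show ?thesis unfolding f_def abs_mult abs_divide z power_abs[of \<sigma>] \<sigma> power_one by (simp add: c_def)
  qed
  have ch: "((\<lambda>m. c y * ((2 * pi * s * (y \<bullet> u)) ^ (2 * m) / fact (2 * m))) has_sum c y * cosh (2 * pi * s * (y \<bullet> u))) UNIV" for y
    by (intro has_sum_cmult_right sums_nonneg_imp_has_sum cosh_paired) auto
  have abs: "(\<lambda>(y, m). \<bar>f y m\<bar>) summable_on \<Lambda> \<times> UNIV"
    unfolding abs_f by (rule summable_on_SigmaI[where g = "\<lambda>y. c y * cosh (2 * pi * s * (y \<bullet> u))"])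
      (use ch cosh_inner_summable[OF t u] in \<open>auto simp: c_def\<close>)
  have g: "(f y has_sum c y * E (2 * pi * s * (y \<bullet> u))) UNIV" for y
  proof (rule norm_summable_imp_has_sum)
    have "summable (\<lambda>m. c y * ((2 * pi * s * (y \<bullet> u)) ^ (2 * m) / fact (2 * m)))"
      by (intro summable_mult sums_summable[OF cosh_paired])
    then show "summable (\<lambda>m. norm (f y m))" using abs_f by simp
    show "f y sums (c y * E (2 * pi * s * (y \<bullet> u)))" unfolding f_def by (intro sums_mult E)
  qed
  have h: "((\<lambda>y. f y m) has_sum \<sigma> ^ m * (2 * pi * s) ^ (2 * m) / fact (2 * m) * moment_theta u m t) \<Lambda>" for m
  proof -
    have "f y m = \<sigma> ^ m * (2 * pi * s) ^ (2 * m) / fact (2 * m) * ((y \<bullet> u) ^ (2 * m) * exp (- pi * t * (norm y)^2))" for y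
      by (simp add: f_def c_def power_mult_distrib)
    then show ?thesis using has_sum_cmult_right[OF moment_theta_has_sum[OF t u, of m]] by presburger
  qed
  show ?thesis
    using has_sum_imp_sums[OF has_sum_swap_abs[OF abs g h]] by (simp add: c_def)
qed

text \<open>Poisson summation with the shift \<open>s *\<^sub>R u\<close> at the parameter
  \<open>1 / t\<close>. Expanding the norm of the shifted vector produces the prefactor and an
  exponential, which the symmetry of the lattice under negation replaces by its even part.\<close>

lemma moment_theta_functional:
  assumes t: "t > 0" and u: "norm u = 1" and dim: "DIM('a) = 24"
  shows "(\<Sum>\<^sub>\<infinity>y\<in>\<Lambda>. exp (- pi * t * (norm y)^2) * cos (2 * pi * s * (y \<bullet> u))) =
    1 / t ^ 12 * exp (- pi * s^2 / t) * (\<Sum>\<^sub>\<infinity>y\<in>\<Lambda>. exp (- pi * (1 / t) * (norm y)^2) * cosh (2 * pi * (s / t) * (y \<bullet> u)))"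
proof -
  define c where "c y = exp (- pi * (1 / t) * (norm y)^2)" for y :: 'a
  have t': "1 / t > 0" using t by simp
  have sm: "(\<lambda>y. c y * exp (2 * pi * s * (y \<bullet> u))) summable_on \<Lambda>" for s
    unfolding c_def by (rule exp_inner_summable[OF t' u])
  have sym_exp: "(\<Sum>\<^sub>\<infinity>y\<in>\<Lambda>. c y * exp (2 * pi * (s / t) * (y \<bullet> u))) = (\<Sum>\<^sub>\<infinity>y\<in>\<Lambda>. c y * exp (2 * pi * (- s / t) * (y \<bullet> u)))"
    by (rule infsum_reindex_bij_witness[of _ uminus uminus]) (auto simp: c_def intro: uminus_mem)
  have "(\<Sum>\<^sub>\<infinity>y\<in>\<Lambda>. c y * cosh (2 * pi * (s / t) * (y \<bullet> u)))
     = (\<Sum>\<^sub>\<infinity>y\<in>\<Lambda>. (1/2) * (c y * exp (2 * pi * (s / t) * (y \<bullet> u)) + c y * exp (2 * pi * (- s / t) * (y \<bullet> u))))"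
    by (intro infsum_cong) (simp add: cosh_field_def distrib_left)
  also have "\<dots> = (1/2) * ((\<Sum>\<^sub>\<infinity>y\<in>\<Lambda>. c y * exp (2 * pi * (s / t) * (y \<bullet> u))) + (\<Sum>\<^sub>\<infinity>y\<in>\<Lambda>. c y * exp (2 * pi * (- s / t) * (y \<bullet> u))))"
    unfolding infsum_cmult_right' by (subst infsum_add[OF sm sm]) (rule refl)
  also have "\<dots> = (\<Sum>\<^sub>\<infinity>y\<in>\<Lambda>. c y * exp (2 * pi * (- s / t) * (y \<bullet> u)))" using sym_exp by simp
  finally have ch: "(\<Sum>\<^sub>\<infinity>y\<in>\<Lambda>. c y * cosh (2 * pi * (s / t) * (y \<bullet> u))) = (\<Sum>\<^sub>\<infinity>y\<in>\<Lambda>. c y * exp (2 * pi * (- s / t) * (y \<bullet> u)))" .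
  have "(\<Sum>\<^sub>\<infinity>y\<in>\<Lambda>. exp (- pi * (1 / t) * (norm (y + s *\<^sub>R u))^2)) =
    1 / sqrt (1 / t) ^ 24 * (\<Sum>\<^sub>\<infinity>y\<in>\<Lambda>. exp (- pi * (norm y)^2 / (1 / t)) * cos (2 * pi * (y \<bullet> (s *\<^sub>R u))))"
    using theta_transformation[OF t', of "s *\<^sub>R u"] by (simp add: dim)
  also have "sqrt (1 / t) ^ 24 = 1 / t ^ 12"
  proof -
    have "sqrt (1 / t) ^ 24 = (sqrt (1 / t) ^ 2) ^ 12" by (simp add: power_mult[symmetric])
    then show ?thesis using t by (simp add: power_divide)
  qed
  also have "(\<Sum>\<^sub>\<infinity>y\<in>\<Lambda>. exp (- pi * (norm y)^2 / (1 / t)) * cos (2 * pi * (y \<bullet> (s *\<^sub>R u)))) =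
     (\<Sum>\<^sub>\<infinity>y\<in>\<Lambda>. exp (- pi * t * (norm y)^2) * cos (2 * pi * s * (y \<bullet> u)))"
    by (intro infsum_cong) (simp add: mult_ac)
  also have "(\<Sum>\<^sub>\<infinity>y\<in>\<Lambda>. exp (- pi * (1 / t) * (norm (y + s *\<^sub>R u))^2)) = (\<Sum>\<^sub>\<infinity>y\<in>\<Lambda>. exp (- pi * s^2 / t) * (c y * exp (2 * pi * (- s / t) * (y \<bullet> u))))"
  proof (intro infsum_cong)
    fix y
    have "(norm (y + s *\<^sub>R u))^2 = (norm y)^2 + 2 * s * (y \<bullet> u) + s^2"
      using u unfolding power2_norm_eq_inner by (simp add: inner_simps inner_commute norm_eq_1 power2_eq_square algebra_simps)
    then have "- pi * (1 / t) * (norm (y + s *\<^sub>R u))^2 = - pi * s^2 / t + (- pi * (1 / t) * (norm y)^2 + 2 * pi * (- s / t) * (y \<bullet> u))"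
      using t by (simp add: field_simps)
    then show "exp (- pi * (1 / t) * (norm (y + s *\<^sub>R u))^2) = exp (- pi * s^2 / t) * (c y * exp (2 * pi * (- s / t) * (y \<bullet> u)))"
      by (simp only: exp_add c_def)
  qed
  also have "\<dots> = exp (- pi * s^2 / t) * (\<Sum>\<^sub>\<infinity>y\<in>\<Lambda>. c y * cosh (2 * pi * (s / t) * (y \<bullet> u)))"
    unfolding infsum_cmult_right' ch ..
  finally show ?thesis using t by (simp add: c_def field_simps)
qed

text \<open>Coefficients of powers of \<open>s^2\<close> are compared in the functional equation;
  the Cauchy product with the series of \<open>exp (- pi * x / t)\<close> brings in all moments of
  order up to \<open>m\<close>. The term for \<open>i = 0\<close> is the transformation of a modular
  form of weight \<open>12 + 2 * m\<close>, and the others measure the defect from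
  modularity.\<close>

lemma moment_theta_transformation:
  assumes t: "t > 0" and u: "norm u = 1" and dim: "DIM('a) = 24"
  shows "(-1) ^ m * (4 * pi^2) ^ m / fact (2 * m) * moment_theta u m t =
    1 / t ^ 12 * (\<Sum>i\<le>m. (- pi / t) ^ i / fact i * ((4 * pi^2 / t^2) ^ (m - i) / fact (2 * (m - i)) * moment_theta u (m - i) (1 / t)))"
proof -
  define l where "l m = (-1) ^ m * (4 * pi^2) ^ m / fact (2 * m) * moment_theta u m t" for m
  define r where "r m = (4 * pi^2 / t^2) ^ m / fact (2 * m) * moment_theta u m (1 / t)" for m
  define e where "e i = (- pi / t) ^ i / fact i" for i
  define S where "S x = (\<Sum>\<^sub>\<infinity>y\<in>\<Lambda>. exp (- pi * t * (norm y)^2) * cos (2 * pi * sqrt x * (y \<bullet> u)))" for x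
  have t': "1 / t > 0" using t by simp
  have L: "(\<lambda>m. l m * x ^ m) sums S x" if "x \<ge> 0" for x
  proof -
    have "(\<lambda>m. (-1) ^ m * (2 * pi * sqrt x) ^ (2 * m) / fact (2 * m) * moment_theta u m t) sums S x"
      unfolding S_def by (rule moment_theta_expansion[OF t u _ cos_paired]) simp
    moreover have "(2 * pi * sqrt x) ^ (2 * m) = (4 * pi^2) ^ m * x ^ m" for m
      unfolding power_mult using that by (simp add: power_mult_distrib)
    ultimately show ?thesis by (simp add: l_def mult_ac)
  qed
  have R: "(\<lambda>m. (1 / t ^ 12 * (\<Sum>i\<le>m. e i * r (m - i))) * x ^ m) sums S x" if x: "x \<ge> 0" for x
  proof -
    define Q where "Q = (\<Sum>\<^sub>\<infinity>y\<in>\<Lambda>. exp (- pi * (1 / t) * (norm y)^2) * cosh (2 * pi * (sqrt x / t) * (y \<bullet> u)))"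
    have "(\<lambda>m. 1 ^ m * (2 * pi * (sqrt x / t)) ^ (2 * m) / fact (2 * m) * moment_theta u m (1 / t)) sums Q"
      unfolding Q_def using cosh_paired by (intro moment_theta_expansion[OF t' u]) auto
    moreover have "(2 * pi * (sqrt x / t)) ^ (2 * m) = (4 * pi^2 / t^2) ^ m * x ^ m" for m
      unfolding power_mult power_mult_distrib[symmetric] using x by (simp add: power_mult_distrib power_divide)
    ultimately have rs: "(\<lambda>m. r m * x ^ m) sums Q" by (simp add: r_def mult_ac)
    have mnn: "moment_theta u m (1 / t) \<ge> 0" for m
      unfolding moment_theta_def by (intro infsum_nonneg) auto
    have rn: "summable (\<lambda>m. norm (r m * x ^ m))"
      using sums_summable[OF rs] x mnn by (simp add: r_def abs_mult)
    have em: "e m * x ^ m = (- pi * x / t) ^ m /\<^sub>R fact m" for m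
    proof -
      have "- pi * x / t = (- pi / t) * x" by simp
      then have "(- pi * x / t) ^ m = (- pi / t) ^ m * x ^ m" by (simp only: power_mult_distrib)
      then show ?thesis by (simp add: e_def divide_inverse)
    qed
    have es: "(\<lambda>m. e m * x ^ m) sums exp (- pi * x / t)" unfolding em by (rule exp_converges)
    have en: "summable (\<lambda>m. norm (e m * x ^ m))" unfolding em by (rule summable_norm_exp)
    have "(\<lambda>k. \<Sum>i\<le>k. (e i * x ^ i) * (r (k - i) * x ^ (k - i))) sums (exp (- pi * x / t) * Q)"
      using Cauchy_product_sums[OF en rn] sums_unique[OF es] sums_unique[OF rs] by simp
    moreover have "(\<Sum>i\<le>k. (e i * x ^ i) * (r (k - i) * x ^ (k - i))) = (\<Sum>i\<le>k. e i * r (k - i)) * x ^ k" for k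
      unfolding sum_distrib_right by (intro sum.cong refl) (simp add: power_add[symmetric] mult_ac)
    ultimately have "(\<lambda>k. 1 / t ^ 12 * ((\<Sum>i\<le>k. e i * r (k - i)) * x ^ k)) sums (1 / t ^ 12 * (exp (- pi * x / t) * Q))"
      by (intro sums_mult) simp
    moreover have "S x = 1 / t ^ 12 * (exp (- pi * x / t) * Q)"
      using moment_theta_functional[OF t u dim, of "sqrt x"] x by (simp add: S_def Q_def)
    ultimately show ?thesis by (simp only: mult.assoc)
  qed
  have "l m = 1 / t ^ 12 * (\<Sum>i\<le>m. e i * r (m - i))"
    by (rule powser_unique_nonneg[OF L R])
  then show ?thesis by (simp only: l_def r_def e_def)
qed

end

section \<open>Shells of an even lattice without vectors of norm 2\<close>

locale rootless_lattice = unimodular_lattice +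
  assumes dim24: "DIM('a) = 24"
    and even_mem: "x \<in> \<Lambda> \<Longrightarrow> \<exists>k::int. x \<bullet> x = 2 * of_int k"
    and min_mem: "x \<in> \<Lambda> \<Longrightarrow> x \<noteq> 0 \<Longrightarrow> x \<bullet> x \<ge> 4"
begin

definition shell :: "nat \<Rightarrow> 'a set" where "shell n = {y \<in> \<Lambda>. y \<bullet> y = 2 * real n}"

lemma finite_shell': "finite (shell n)" unfolding shell_def by (rule finite_shell)

lemma moment_theta_shells:
  assumes "t > 0" "norm u = 1"
  shows "((\<lambda>n. (\<Sum>y\<in>shell n. (y \<bullet> u) ^ (2 * m)) * exp (- 2 * pi * t) ^ n) has_sum moment_theta u m t) UNIV"
proof -
  define f where "f y = (y \<bullet> u) ^ (2 * m) * exp (- pi * t * (norm y)^2)" for y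
  have bij: "bij_betw snd (Sigma UNIV shell) \<Lambda>"
  proof (rule bij_betw_byWitness[where f' = "\<lambda>y. (nat \<lfloor>y \<bullet> y / 2\<rfloor>, y)"])
    show "(\<lambda>y. (nat \<lfloor>y \<bullet> y / 2\<rfloor>, y)) ` \<Lambda> \<subseteq> Sigma UNIV shell"
    proof safe
      fix y assume y: "y \<in> \<Lambda>"
      then obtain k :: int where k: "y \<bullet> y = 2 * of_int k" using even_mem by blast
      then have "k \<ge> 0" using inner_ge_zero[of y] by simp
      then show "y \<in> shell (nat \<lfloor>y \<bullet> y / 2\<rfloor>)" using y k by (simp add: shell_def)
    qed auto
  qed (auto simp: shell_def)
  have "(f has_sum moment_theta u m t) \<Lambda>" using moment_theta_has_sum[OF assms, of m] by (simp add: f_def[abs_def])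
  then have "((\<lambda>p. f (snd p)) has_sum moment_theta u m t) (Sigma UNIV shell)"
    using has_sum_reindex_bij_betw[OF bij, of f] by simp
  then have "((\<lambda>n. sum f (shell n)) has_sum moment_theta u m t) UNIV"
    by (rule has_sum_SigmaD) (auto intro: has_sum_finite finite_shell')
  moreover have "sum f (shell n) = (\<Sum>y\<in>shell n. (y \<bullet> u) ^ (2 * m)) * exp (- 2 * pi * t) ^ n" for n
    unfolding sum_distrib_right f_def
  proof (intro sum.cong refl)
    fix y assume "y \<in> shell n"
    then have "(norm y)^2 = 2 * real n" by (simp add: shell_def power2_norm_eq_inner)
    then have "- pi * t * (norm y)^2 = real n * (- 2 * pi * t)" by simp
    then show "(y \<bullet> u) ^ (2 * m) * exp (- pi * t * (norm y)\<^sup>2) = (y \<bullet> u) ^ (2 * m) * exp (- 2 * pi * t) ^ n"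
      by (simp only: exp_of_nat_mult)
  qed
  ultimately show ?thesis by simp
qed

lemma shell_0: "shell 0 = {0}" using zero_mem by (auto simp: shell_def)

lemma shell_1: "shell 1 = {}" using min_mem by (force simp: shell_def)

theorem shell_moment_unit:
  assumes "m \<le> 5" "norm u = 1" "norm v = 1"
  shows "(\<Sum>y\<in>shell n. (y \<bullet> u) ^ (2 * m)) = (\<Sum>y\<in>shell n. (y \<bullet> v) ^ (2 * m))"
  using assms(1)
proof (induction m arbitrary: n rule: less_induct)
  case (less m)
  show ?case
  proof (cases "m = 0")
    case False
    define a where "a n = (\<Sum>y\<in>shell n. (y \<bullet> u) ^ (2 * m)) - (\<Sum>y\<in>shell n. (y \<bullet> v) ^ (2 * m))" for n
    define f where "f t = moment_theta u m t - moment_theta v m t" for t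
    have hs: "((\<lambda>n. a n * exp (- 2 * pi * t) ^ n) has_sum f t) UNIV" if "t > 0" for t
      using has_sum_add[OF moment_theta_shells[OF that assms(2), of m] has_sum_uminusI[OF moment_theta_shells[OF that assms(3), of m]]]
      by (simp add: a_def f_def left_diff_distrib)
    \<comment> \<open>By induction the lower moments agree for \<open>u\<close> and
      \<open>v\<close>, so the non-modular terms cancel in the difference, and \<open>f\<close>
      transforms with weight \<open>2 * (6 + m)\<close>.\<close>
    have lower: "moment_theta u k t = moment_theta v k t" if "k < m" "t > 0" for k t
    proof -
      have "(\<Sum>y\<in>shell n. (y \<bullet> u) ^ (2 * k)) = (\<Sum>y\<in>shell n. (y \<bullet> v) ^ (2 * k))" for n
        using less.IH[OF that(1)] less.prems that(1) by simp
      then show ?thesis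
        using moment_theta_shells[OF that(2) assms(2), of k] moment_theta_shells[OF that(2) assms(3), of k]
        by (auto intro: has_sum_unique)
    qed
    have feq: "f (1 / t) = (-1) ^ (6 + m) * t ^ (2 * (6 + m)) * f t" if t: "t > 0" for t
    proof -
      define X where "X w i = (- pi / t) ^ i / fact i * ((4 * pi^2 / t^2) ^ (m - i) / fact (2 * (m - i)) * moment_theta w (m - i) (1 / t))" for w i
      have sum: "(\<Sum>i\<le>m. X w i) = X w 0 + (\<Sum>i\<in>{1..m}. X w i)" for w
      proof -
        have "{..m} = insert 0 {1..m}" by auto
        then show ?thesis by simp
      qed
      have rest: "(\<Sum>i\<in>{1..m}. X u i) = (\<Sum>i\<in>{1..m}. X v i)"
        using lower[of _ "1 / t"] t by (intro sum.cong refl) (auto simp: X_def)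
      have "(-1) ^ m * (4 * pi^2) ^ m / fact (2 * m) * f t = 1 / t ^ 12 * (X u 0 - X v 0)"
        using moment_theta_transformation[OF t assms(2) dim24, of m] moment_theta_transformation[OF t assms(3) dim24, of m] rest
        unfolding X_def[symmetric] sum f_def by (simp add: right_diff_distrib distrib_left)
      also have "X u 0 - X v 0 = (4 * pi^2) ^ m / fact (2 * m) * (f (1 / t) / t ^ (2 * m))"
      proof -
        have "(4 * pi^2 / t^2) ^ m = (4 * pi^2) ^ m / t ^ (2 * m)" unfolding power_mult by (rule power_divide)
        then show ?thesis by (simp add: X_def f_def diff_divide_distrib right_diff_distrib mult_ac)
      qed
      finally have "(4 * pi^2) ^ m / fact (2 * m) * ((-1) ^ m * f t) = (4 * pi^2) ^ m / fact (2 * m) * (f (1 / t) / (t ^ 12 * t ^ (2 * m)))"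
        by (simp add: mult_ac)
      moreover have "(4 * pi^2) ^ m / fact (2 * m) \<noteq> 0" by simp
      ultimately have "(-1) ^ m * f t = f (1 / t) / (t ^ 12 * t ^ (2 * m))" using mult_left_cancel by blast
      moreover have "t ^ (2 * (6 + m)) = t ^ 12 * t ^ (2 * m)" by (simp add: power_add[symmetric])
      moreover have "(-1 :: real) ^ (6 + m) = (-1) ^ m" by (simp add: power_add)
      ultimately show ?thesis using t by (simp add: field_simps)
    qed
    have "complex_of_real (a n) = 0"
    proof (rule cusp_form_vanishes[of "\<lambda>n. complex_of_real (a n)" "6 + m"])
      \<comment> \<open>The origin contributes \<open>0 ^ (2 * m)\<close>, which vanishes because
        \<open>m > 0\<close>; the shell of norm 2 is empty.\<close>
      show "complex_of_real (a 0) = 0" using False by (simp add: a_def shell_0)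
      show "complex_of_real (a 1) = 0" by (simp add: a_def shell_1[simplified])
      show "6 + m \<le> 11" using less.prems by simp
      fix q :: complex assume q: "norm q < 1"
      show "summable (\<lambda>n. complex_of_real (a n) * q ^ n)"
      proof (cases "q = 0")
        case False
        define t where "t = - ln (norm q) / (2 * pi)"
        have t: "t > 0" "exp (- 2 * pi * t) = norm q" using q False by (auto simp: t_def divide_simps)
        have "(\<lambda>n. a n * exp (- 2 * pi * t) ^ n) summable_on UNIV"
          using hs[OF t(1)] by (auto simp: summable_on_def)
        then have "(\<lambda>n. norm (a n * exp (- 2 * pi * t) ^ n)) summable_on UNIV"
          by (rule summable_on_iff_abs_summable_on_real[THEN iffD1])
        then have "summable (\<lambda>n. norm (a n * exp (- 2 * pi * t) ^ n))"
          by (rule summable_on_imp_summable)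
        moreover have "norm (a n * exp (- 2 * pi * t) ^ n) = norm (complex_of_real (a n) * q ^ n)" for n
          unfolding t(2) by (simp add: norm_mult norm_power abs_mult)
        ultimately have "summable (\<lambda>n. norm (complex_of_real (a n) * q ^ n))" by (simp only:)
        then show ?thesis by (rule summable_norm_cancel)
      qed (use summable_0_powser in auto)
    next
      fix t :: real assume t: "t > 0"
      have S: "(\<Sum>n. complex_of_real (a n) * complex_of_real (exp (- 2 * pi * t)) ^ n) = of_real (f t)" if "t > 0" for t
        using sums_unique[OF sums_of_real[OF has_sum_imp_sums[OF hs[OF that]], where 'a = complex]] by simp
      have "exp (- 2 * pi / t) = exp (- 2 * pi * (1 / t))" by simp
      then show "(\<Sum>n. complex_of_real (a n) * complex_of_real (exp (- 2 * pi / t)) ^ n) =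
        (-1) ^ (6 + m) * complex_of_real (t ^ (2 * (6 + m))) * (\<Sum>n. complex_of_real (a n) * complex_of_real (exp (- 2 * pi * t)) ^ n)"
        using S[OF t] S[of "1 / t"] t feq[OF t] by simp
    qed
    then have "a n = 0" by (simp only: of_real_eq_0_iff)
    then show ?thesis by (simp add: a_def)
  qed simp
qed

end

section \<open>The slice of the minimal vectors\<close>

lemma coeff_quadratic_power:
  fixes A B :: real
  shows "coeff ([:A, 0, B:] ^ m) i = (if even i then real (m choose (i div 2)) * B ^ (i div 2) * A ^ (m - i div 2) else 0)"
proof -
  have "[:A, 0, B:] = monom B 2 + [:A:]" by (simp add: monom_altdef power2_eq_square)
  then have "[:A, 0, B:] ^ m = (\<Sum>k\<le>m. of_nat (m choose k) * monom B 2 ^ k * [:A:] ^ (m - k))"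
    by (simp add: binomial_ring)
  also have "\<dots> = (\<Sum>k\<le>m. monom (real (m choose k) * B ^ k * A ^ (m - k)) (2 * k))"
    by (intro sum.cong refl) (simp add: monom_power of_nat_poly poly_const_pow mult_monom monom_0[symmetric] mult_ac)
  finally have "coeff ([:A, 0, B:] ^ m) i = (\<Sum>k\<le>m. if 2 * k = i then real (m choose k) * B ^ k * A ^ (m - k) else 0)"
    by (simp add: coeff_sum)
  also have "\<dots> = (if even i then real (m choose (i div 2)) * B ^ (i div 2) * A ^ (m - i div 2) else 0)"
  proof (cases "even i")
    case True
    then obtain j where i: "i = 2 * j" by (elim evenE)
    have "(\<Sum>k\<le>m. if 2 * k = i then real (m choose k) * B ^ k * A ^ (m - k) else 0) = (\<Sum>k\<le>m. if k = j then real (m choose j) * B ^ j * A ^ (m - j) else 0)"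
      by (intro sum.cong refl) (simp add: i)
    then show ?thesis by (simp add: i binomial_eq_0)
  next
    case False
    then show ?thesis by (intro trans[OF sum.neutral]) auto
  qed
  finally show ?thesis .
qed

lemma poly_ext_all:
  fixes p q :: "real poly"
  assumes "\<And>b. poly p b = poly q b" shows "p = q"
  using assms poly_eq_poly_eq_iff[of p q] by blast

lemma sum_by_values:
  fixes g :: "'b \<Rightarrow> real"
  assumes "finite A" "finite J" "f ` A \<subseteq> J"
  shows "(\<Sum>y\<in>A. g (f y) * h y) = (\<Sum>j\<in>J. g j * (\<Sum>y\<in>{y\<in>A. f y = j}. h y))"
  unfolding sum.group[OF assms, of "\<lambda>y. g (f y) * h y", symmetric] sum_distrib_left
  by (intro sum.cong refl) auto

section \<open>Moments of the minimal vectors up to degree 10\<close>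

context rootless_lattice
begin

abbreviation "minvecs \<equiv> shell 2"

lemma minvecs_iff: "y \<in> minvecs \<longleftrightarrow> y \<in> \<Lambda> \<and> y \<bullet> y = 4"
  by (simp add: shell_def)

definition cm :: "nat \<Rightarrow> real" where
  "cm m = (\<Sum>y\<in>minvecs. (y \<bullet> (SOME b. b \<in> Basis)) ^ (2 * m))"

text \<open>By isotropy the reference direction in \<open>cm\<close> may be replaced by any unit
  vector, and homogeneity gives the general case.\<close>

lemma moment:
  assumes "m \<le> 5" shows "(\<Sum>y\<in>minvecs. (y \<bullet> x) ^ (2 * m)) = cm m * (x \<bullet> x) ^ m"
proof (cases "x = 0")
  case True
  then show ?thesis by (cases m) (simp_all add: cm_def)
next
  case False
  have b: "norm (SOME b. b \<in> (Basis :: 'a set)) = 1" 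
    by (rule norm_Basis, rule someI_ex) (use nonempty_Basis in blast)
  define u where "u = x /\<^sub>R norm x"
  have u: "norm u = 1" using False by (simp add: u_def)
  have "(\<Sum>y\<in>minvecs. (y \<bullet> x) ^ (2 * m)) = (\<Sum>y\<in>minvecs. norm x ^ (2 * m) * (y \<bullet> u) ^ (2 * m))"
  proof (intro sum.cong refl)
    fix y
    have "y \<bullet> x = norm x * (y \<bullet> u)" using False by (simp add: u_def)
    then show "(y \<bullet> x) ^ (2 * m) = norm x ^ (2 * m) * (y \<bullet> u) ^ (2 * m)" by (simp only: power_mult_distrib)
  qed
  also have "\<dots> = norm x ^ (2 * m) * cm m"
    unfolding sum_distrib_left[symmetric] cm_def using shell_moment_unit[OF assms u b] by simp
  also have "norm x ^ (2 * m) = (x \<bullet> x) ^ m" by (simp add: power_mult power2_norm_eq_inner)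
  finally show ?thesis by simp
qed

text \<open>Polarisation: both sides of \<open>moment\<close> at \<open>v + b *\<^sub>R u\<close>
  are polynomials in \<open>b\<close>, and their coefficients of \<open>b ^ i\<close> agree.
  Orthogonality makes the quadratic form even in \<open>b\<close>, so odd mixed moments vanish. The
  binomial coefficient stays on the left to avoid a division.\<close>

lemma mixed_moment:
  assumes m: "m \<le> 5" and orth: "u \<bullet> v = 0" and ik: "i + k = 2 * m"
  shows "real (2 * m choose i) * (\<Sum>y\<in>minvecs. (y \<bullet> u) ^ i * (y \<bullet> v) ^ k) =
    (if even i then cm m * (real (m choose (i div 2)) * (u \<bullet> u) ^ (i div 2) * (v \<bullet> v) ^ (m - i div 2)) else 0)"
proof -
  have "(\<Sum>y\<in>minvecs. [:y \<bullet> v, y \<bullet> u:] ^ (2 * m)) = smult (cm m) ([:v \<bullet> v, 0, u \<bullet> u:] ^ m)"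
  proof (rule poly_ext_all)
    fix b :: real
    have "poly (\<Sum>y\<in>minvecs. [:y \<bullet> v, y \<bullet> u:] ^ (2 * m)) b = (\<Sum>y\<in>minvecs. (y \<bullet> (v + b *\<^sub>R u)) ^ (2 * m))"
      by (simp add: poly_sum poly_power inner_add_right)
    also have "\<dots> = cm m * ((v + b *\<^sub>R u) \<bullet> (v + b *\<^sub>R u)) ^ m" by (rule moment[OF m])
    also have "(v + b *\<^sub>R u) \<bullet> (v + b *\<^sub>R u) = v \<bullet> v + b * (b * (u \<bullet> u))"
      using orth by (simp add: inner_simps inner_commute)
    finally show "poly (\<Sum>y\<in>minvecs. [:y \<bullet> v, y \<bullet> u:] ^ (2 * m)) b = poly (smult (cm m) ([:v \<bullet> v, 0, u \<bullet> u:] ^ m)) b"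
      by (simp add: poly_power)
  qed
  then have "coeff (\<Sum>y\<in>minvecs. [:y \<bullet> v, y \<bullet> u:] ^ (2 * m)) i = coeff (smult (cm m) ([:v \<bullet> v, 0, u \<bullet> u:] ^ m)) i" by simp
  moreover have "coeff (\<Sum>y\<in>minvecs. [:y \<bullet> v, y \<bullet> u:] ^ (2 * m)) i = real (2 * m choose i) * (\<Sum>y\<in>minvecs. (y \<bullet> u) ^ i * (y \<bullet> v) ^ k)"
  proof -
    have "i \<le> 2 * m" "2 * m - i = k" using ik by auto
    then show ?thesis by (simp add: coeff_sum coeff_linear_poly_power sum_distrib_left mult.assoc)
  qed
  ultimately show ?thesis by (simp add: coeff_quadratic_power)
qed

text \<open>The mixed moments of degrees 2 and \<open>2 * m - 2\<close> are summed over an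
  orthonormal basis, and \<open>y \<bullet> y = 4\<close> turns the sum into a relation between
  consecutive moments; it replaces an application of the Laplacian. The constant 22 is the dimension
  minus 2.\<close>

lemma cm_rec:
  assumes "1 \<le> m" "m \<le> 5" shows "cm m * (2 * real m + 22) = 4 * (2 * real m - 1) * cm (m - 1)"
proof -
  obtain u :: 'a where u: "u \<in> Basis" using nonempty_Basis by blast
  define k where "k = 2 * m - 2"
  have mix: "real m * (2 * real m - 1) * (\<Sum>y\<in>minvecs. (y \<bullet> b)^2 * (y \<bullet> u) ^ k) = cm m * real m" if "b \<in> Basis - {u}" for b
  proof -
    have o: "b \<bullet> u = 0" "b \<bullet> b = 1" "u \<bullet> u = 1" using that u by (auto simp: inner_Basis)
    have ch: "real (2 * m choose 2) = real m * (2 * real m - 1)"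
      using assms by (simp add: choose_two of_nat_diff field_simps)
    have "2 + k = 2 * m" using assms by (simp add: k_def)
    from mixed_moment[OF assms(2) o(1) this] show ?thesis by (simp add: ch o)
  qed
  have "(\<Sum>b\<in>Basis - {u}. real m * (2 * real m - 1) * (\<Sum>y\<in>minvecs. (y \<bullet> b)^2 * (y \<bullet> u) ^ k)) = 23 * (cm m * real m)"
  proof -
    have "(\<Sum>b\<in>Basis - {u}. real m * (2 * real m - 1) * (\<Sum>y\<in>minvecs. (y \<bullet> b)^2 * (y \<bullet> u) ^ k)) = (\<Sum>b\<in>Basis - {u}. cm m * real m)"
      by (intro sum.cong refl mix)
    then show ?thesis using u dim24 by (simp add: card_Diff_singleton)
  qed
  moreover have "(\<Sum>b\<in>Basis - {u}. real m * (2 * real m - 1) * (\<Sum>y\<in>minvecs. (y \<bullet> b)^2 * (y \<bullet> u) ^ k)) =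
    real m * (2 * real m - 1) * (\<Sum>y\<in>minvecs. (\<Sum>b\<in>Basis - {u}. (y \<bullet> b)^2) * (y \<bullet> u) ^ k)"
    unfolding sum_distrib_left[symmetric] by (subst sum.swap) (simp add: sum_distrib_right)
  moreover have "(\<Sum>y\<in>minvecs. (\<Sum>b\<in>Basis - {u}. (y \<bullet> b)^2) * (y \<bullet> u) ^ k) = 4 * cm (m - 1) - cm m"
  proof -
    have "(\<Sum>y\<in>minvecs. (\<Sum>b\<in>Basis - {u}. (y \<bullet> b)^2) * (y \<bullet> u) ^ k) = (\<Sum>y\<in>minvecs. 4 * (y \<bullet> u) ^ (2 * (m - 1)) - (y \<bullet> u) ^ (2 * m))"
    proof (intro sum.cong refl)
      fix y assume y: "y \<in> minvecs"
      have "y \<bullet> y = (\<Sum>b\<in>Basis. (y \<bullet> b)^2)" by (subst euclidean_inner) (simp add: power2_eq_square)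
      also have "\<dots> = (y \<bullet> u)^2 + (\<Sum>b\<in>Basis - {u}. (y \<bullet> b)^2)" using u by (intro sum.remove) auto
      finally have "(\<Sum>b\<in>Basis - {u}. (y \<bullet> b)^2) = 4 - (y \<bullet> u)^2" using y by (simp add: minvecs_iff)
      moreover have "k = 2 * (m - 1)" "2 * m = 2 + k" using assms by (auto simp: k_def)
      ultimately show "(\<Sum>b\<in>Basis - {u}. (y \<bullet> b)^2) * (y \<bullet> u) ^ k = 4 * (y \<bullet> u) ^ (2 * (m - 1)) - (y \<bullet> u) ^ (2 * m)"
        by (simp only: power_add left_diff_distrib)
    qed
    also have "\<dots> = 4 * cm (m - 1) - cm m"
      using moment[of "m - 1" u] moment[of m u] assms u by (simp add: sum_subtractf sum_distrib_left[symmetric] inner_Basis)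
    finally show ?thesis .
  qed
  ultimately have "real m * ((2 * real m - 1) * (4 * cm (m - 1) - cm m)) = real m * (23 * cm m)" by simp
  then have "(2 * real m - 1) * (4 * cm (m - 1) - cm m) = 23 * cm m" using assms by simp
  then show ?thesis by (simp add: algebra_simps)
qed

lemma cm_values:
  "cm 1 = cm 0 / 6" "cm 2 = cm 0 / 13" "cm 3 = 5 * cm 0 / 91" "cm 4 = 2 * cm 0 / 39" "cm 5 = 3 * cm 0 / 52"
proof -
  show 1: "cm 1 = cm 0 / 6" using cm_rec[of 1] by simp
  show 2: "cm 2 = cm 0 / 13" using cm_rec[of 2] 1 by simp
  show 3: "cm 3 = 5 * cm 0 / 91" using cm_rec[of 3] 2 by simp
  show 4: "cm 4 = 2 * cm 0 / 39" using cm_rec[of 4] 3 by simp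
  show "cm 5 = 3 * cm 0 / 52" using cm_rec[of 5] 4 by simp
qed

lemma inner_int: "x \<in> \<Lambda> \<Longrightarrow> y \<in> \<Lambda> \<Longrightarrow> \<exists>k::int. x \<bullet> y = of_int k"
  by (metis Ints_cases integral_mem)

lemma diff_norm: "x \<in> \<Lambda> \<Longrightarrow> y \<in> \<Lambda> \<Longrightarrow> x \<noteq> y \<Longrightarrow> x \<bullet> x + y \<bullet> y - 2 * (x \<bullet> y) \<ge> 4"
  using min_mem[of "x - y"] diff_mem[of x y] by (simp add: inner_diff_left inner_diff_right inner_commute)

lemma sum_norm: "x \<in> \<Lambda> \<Longrightarrow> y \<in> \<Lambda> \<Longrightarrow> x \<noteq> - y \<Longrightarrow> x \<bullet> x + y \<bullet> y + 2 * (x \<bullet> y) \<ge> 4"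
  using diff_norm[of x "- y"] uminus_mem[of y] by simp

lemma minvecs_inner:
  assumes "x \<in> minvecs" "y \<in> minvecs" "x \<noteq> y" "x \<noteq> - y"
  shows "y \<bullet> x \<in> {-2, -1, 0, 1, 2}"
proof -
  have L: "x \<in> \<Lambda>" "y \<in> \<Lambda>" "x \<bullet> x = 4" "y \<bullet> y = 4" using assms by (auto simp: minvecs_iff)
  obtain k :: int where k: "y \<bullet> x = of_int k" using inner_int L by blast
  have "4 + 4 - 2 * of_int k \<ge> (4::real)" "4 + 4 + 2 * of_int k \<ge> (4::real)"
    using diff_norm[OF L(1,2) assms(3)] sum_norm[OF L(1,2) assms(4)] L k by (simp_all add: inner_commute)
  then have "k \<le> 2" "k \<ge> -2" by linarith+
  then have "k \<in> {-2, -1, 0, 1, 2}" by auto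
  then show ?thesis using k by auto
qed

text \<open>Apart from \<open>x\<close> and \<open>- x\<close>, minimal vectors have inner products
  with \<open>x\<close> of absolute value at most 2. The moments for \<open>m = 1, 2, 3\<close> are
  three linear equations in \<open>cm 0\<close> and in the numbers of vectors with inner product
  \<plusminus>2 and \<plusminus>1. Starting at \<open>m = 1\<close> keeps the vectors orthogonal to
  \<open>x\<close> out of the equations.\<close>

theorem card_minvecs:
  assumes x: "x \<in> minvecs" shows "cm 0 = 196560"
proof -
  have x4: "x \<bullet> x = 4" "x \<in> \<Lambda>" using x by (auto simp: minvecs_iff)
  then have x0: "x \<noteq> - x" by (auto simp: eq_neg_iff_add_eq_0 scaleR_2[symmetric])
  define A where "A = minvecs - {x, - x}"
  have A: "finite A" "(\<lambda>y. y \<bullet> x) ` A \<subseteq> {-2, -1, 0, 1, 2}"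
  proof -
    show "finite A" using finite_shell' by (simp add: A_def)
    show "(\<lambda>y. y \<bullet> x) ` A \<subseteq> {-2, -1, 0, 1, 2}"
    proof (rule image_subsetI)
      fix y assume y: "y \<in> A"
      then have "x \<noteq> - y" by (auto simp: A_def)
      then show "y \<bullet> x \<in> {-2, -1, 0, 1, 2}" using y by (intro minvecs_inner[OF x]) (auto simp: A_def)
    qed
  qed
  define n where "n j = real (card {y \<in> A. y \<bullet> x = j})" for j
  have mx: "- x \<in> minvecs" using x uminus_mem by (auto simp: minvecs_iff)
  have mom: "2 * 4 ^ (2 * m) + ((n 2 + n (-2)) * 2 ^ (2 * m) + (n 1 + n (-1))) = cm m * 4 ^ m" if "m \<ge> 1" "m \<le> 5" for m
  proof -
    have ins: "minvecs = insert x (insert (- x) A)" and nin: "x \<notin> A" "- x \<notin> A" using x mx by (auto simp: A_def)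
    have "(\<Sum>y\<in>minvecs. (y \<bullet> x) ^ (2 * m)) = 2 * 4 ^ (2 * m) + (\<Sum>y\<in>A. (y \<bullet> x) ^ (2 * m))"
      unfolding ins using A(1) x0 x4 nin by simp
    also have "(\<Sum>y\<in>A. (y \<bullet> x) ^ (2 * m)) = (\<Sum>j\<in>{-2, -1, 0, 1, 2}. j ^ (2 * m) * n j)"
      using sum_by_values[OF A(1) _ A(2), of "\<lambda>j. j ^ (2 * m)" "\<lambda>_. 1"] by (simp add: n_def)
    also have "\<dots> = (n 2 + n (-2)) * 2 ^ (2 * m) + (n 1 + n (-1))"
      using that by (simp add: algebra_simps zero_power)
    finally show ?thesis using moment[OF that(2), of x] x4 by simp
  qed
  show ?thesis using mom[of 1] mom[of 2] mom[of 3] cm_values by simp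
qed

end

section \<open>Minimal vectors having inner product 1 with a vector of norm 6\<close>

locale rootless_lattice_slice = rootless_lattice +
  fixes W :: 'a
  assumes W: "W \<in> \<Lambda>" "W \<bullet> W = 6" and minvecs_nonempty: "minvecs \<noteq> {}"
begin

text \<open>The unscaled form of the code: for the unit vectors \<open>y / 2\<close> and
  \<open>W / sqrt 6\<close>, the inner product \<open>sqrt 6 / 12\<close> means
  \<open>y \<bullet> W = 1\<close>.\<close>

definition slice :: "'a set" where "slice = {y \<in> minvecs. y \<bullet> W = 1}"

lemma cm0: "cm 0 = 196560" using card_minvecs minvecs_nonempty by auto

lemma inner_W: "y \<in> minvecs \<Longrightarrow> y \<bullet> W \<in> {-3, -2, -1, 0, 1, 2, 3}"
proof -
  assume "y \<in> minvecs"
  then have y: "y \<in> \<Lambda>" "y \<bullet> y = 4" by (auto simp: minvecs_iff)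
  obtain k :: int where k: "y \<bullet> W = of_int k" using inner_int[OF y(1) W(1)] by auto
  \<comment> \<open>Since the norms 4 and 6 differ, \<open>y - W\<close> and \<open>y + W\<close>
    are nonzero and have norm at least 4, which limits the inner product to 3.\<close>
  have ne: "y \<noteq> W" "y \<noteq> - W" using y(2) W(2) by auto
  have "4 + 6 - 2 * of_int k \<ge> (4::real)" "4 + 6 + 2 * of_int k \<ge> (4::real)"
    using diff_norm[OF y(1) W(1) ne(1)] sum_norm[OF y(1) W(1) ne(2)] y(2) W(2) k by simp_all
  then have "k \<le> 3" "k \<ge> -3" by linarith+
  then have "k \<in> {-3, -2, -1, 0, 1, 2, 3}" by auto
  then show ?thesis using k by auto
qed

lemma reflect_slice: "(\<Sum>y\<in>{y\<in>minvecs. y \<bullet> W = - j}. (y \<bullet> v) ^ k) = (-1) ^ k * (\<Sum>y\<in>{y\<in>minvecs. y \<bullet> W = j}. (y \<bullet> v) ^ k)"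
proof -
  have "(\<Sum>y\<in>{y\<in>minvecs. y \<bullet> W = - j}. (y \<bullet> v) ^ k) = (\<Sum>y\<in>{y\<in>minvecs. y \<bullet> W = j}. (- (y \<bullet> v)) ^ k)"
    by (rule sum.reindex_bij_witness[of _ uminus uminus]) (auto simp: minvecs_iff uminus_mem)
  also have "\<dots> = (-1) ^ k * (\<Sum>y\<in>{y\<in>minvecs. y \<bullet> W = j}. (y \<bullet> v) ^ k)"
    unfolding sum_distrib_left by (intro sum.cong refl) (rule power_minus)
  finally show ?thesis .
qed

text \<open>The polynomials \<open>p\<close> in the next two proofs vanish at all inner products with \<open>W\<close> other than \<open>\<plusminus>1\<close>, which isolates
  the slice.\<close>

lemma slice_moment_extract:
  assumes "p 0 = 0" "p 2 = 0" "p (-2) = 0" "p 3 = 0" "p (-3) = (0::real)"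
  shows "(\<Sum>y\<in>minvecs. p (y \<bullet> W) * (y \<bullet> v) ^ k) = (p 1 + p (-1) * (-1) ^ k) * (\<Sum>y\<in>slice. (y \<bullet> v) ^ k)"
proof -
  have "(\<Sum>y\<in>minvecs. p (y \<bullet> W) * (y \<bullet> v) ^ k) = (\<Sum>j\<in>{-3, -2, -1, 0, 1, 2, 3}. p j * (\<Sum>y\<in>{y\<in>minvecs. y \<bullet> W = j}. (y \<bullet> v) ^ k))"
    by (rule sum_by_values) (use inner_W finite_shell' in auto)
  then show ?thesis
    using assms reflect_slice[of v k 1] by (simp add: slice_def algebra_simps)
qed

lemma slice_moment_even:
  "48 * (\<Sum>y\<in>slice. (y \<bullet> v) ^ (2 * k)) = (\<Sum>y\<in>minvecs. (y \<bullet> W) ^ 6 * (y \<bullet> v) ^ (2 * k))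
     - 13 * (\<Sum>y\<in>minvecs. (y \<bullet> W) ^ 4 * (y \<bullet> v) ^ (2 * k)) + 36 * (\<Sum>y\<in>minvecs. (y \<bullet> W) ^ 2 * (y \<bullet> v) ^ (2 * k))"
  \<comment> \<open>The polynomial is \<open>j^2 * (j^2 - 4) * (j^2 - 9)\<close>, with the value 24
    at both 1 and -1.\<close>
  using slice_moment_extract[of "\<lambda>j. j ^ 6 - 13 * j ^ 4 + 36 * j ^ 2" v "2 * k"]
  by (simp add: sum.distrib sum_subtractf sum_distrib_left left_diff_distrib distrib_right mult.assoc)

text \<open>Here the isolating polynomial is the odd \<open>j * (j^2 - 4) * (j^2 - 9)\<close>. Its
  terms lead to mixed moments with an odd exponent at \<open>W\<close>, which vanish for
  \<open>v\<close> orthogonal to \<open>W\<close>.\<close>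

lemma slice_moment_odd:
  assumes "W \<bullet> v = 0" "k \<le> 2"
  shows "(\<Sum>y\<in>slice. (y \<bullet> v) ^ (2 * k + 1)) = 0"
proof -
  have z: "(\<Sum>y\<in>minvecs. (y \<bullet> W) ^ i * (y \<bullet> v) ^ (2 * k + 1)) = 0" if i: "i \<in> {1, 3, 5}" for i
  proof -
    obtain m where m: "i + (2 * k + 1) = 2 * m" "m \<le> 5" "i \<le> 2 * m" "odd i"
    proof (rule that[of "(i + (2 * k + 1)) div 2"])
      show "i + (2 * k + 1) = 2 * ((i + (2 * k + 1)) div 2)" by (rule dvd_mult_div_cancel[symmetric]) (use i in auto)
    qed (use i assms(2) in auto)
    have "real (2 * m choose i) * (\<Sum>y\<in>minvecs. (y \<bullet> W) ^ i * (y \<bullet> v) ^ (2 * k + 1)) = 0"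
      using mixed_moment[OF m(2) assms(1) m(1)] m(4) by simp
    then show ?thesis using m(3) by (simp add: binomial_eq_0_iff)
  qed
  have "48 * (\<Sum>y\<in>slice. (y \<bullet> v) ^ (2 * k + 1)) = (\<Sum>y\<in>minvecs. (y \<bullet> W) ^ 5 * (y \<bullet> v) ^ (2 * k + 1))
     - 13 * (\<Sum>y\<in>minvecs. (y \<bullet> W) ^ 3 * (y \<bullet> v) ^ (2 * k + 1)) + 36 * (\<Sum>y\<in>minvecs. (y \<bullet> W) ^ 1 * (y \<bullet> v) ^ (2 * k + 1))"
    using slice_moment_extract[of "\<lambda>j. j ^ 5 - 13 * j ^ 3 + 36 * j ^ 1" v "2 * k + 1"]
    by (simp add: sum.distrib sum_subtractf sum_distrib_left left_diff_distrib distrib_right mult.assoc)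
  then show ?thesis using z[of 1] z[of 3] z[of 5] by simp
qed

text \<open>These are the values of a 5-design: the projections of the slice to the complement of
  \<open>W\<close> have squared length 23/6 in dimension 23, and
  \<open>8100 = 48600 * (23/6) / 23\<close>, \<open>3726 = 48600 * (23/6)^2 * 3 / (23 * 25)\<close>.
  The fourth moment, weighted by the isolating polynomial of degree 6, is where moments of degree 10
  enter.\<close>

lemma slice_moments:
  assumes v: "W \<bullet> v = 0"
  shows "real (card slice) = 48600" "(\<Sum>y\<in>slice. y \<bullet> v) = 0" "(\<Sum>y\<in>slice. (y \<bullet> v)^2) = 8100 * (v \<bullet> v)"
    "(\<Sum>y\<in>slice. (y \<bullet> v)^3) = 0" "(\<Sum>y\<in>slice. (y \<bullet> v)^4) = 3726 * (v \<bullet> v)^2"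
proof -
  note mm = mixed_moment[OF _ v]
  have b: "(4 choose 2) = (6::nat)" "(6 choose 2) = (15::nat)" "(6 choose 4) = (15::nat)" "(8 choose 4) = (70::nat)" "(8 choose 6) = (28::nat)" "(10 choose 6) = (210::nat)"
    "(3 choose 2) = (3::nat)" "(4 choose 3) = (4::nat)" "(5 choose 3) = (10::nat)"
    by (simp_all add: binomial_fact fact_numeral eval_nat_numeral)
  show "real (card slice) = 48600"
    using slice_moment_even[of v 0] moment[of 1 W] moment[of 2 W] moment[of 3 W] cm_values cm0 W(2) by simp
  show "(\<Sum>y\<in>slice. y \<bullet> v) = 0" using slice_moment_odd[OF v, of 0] by simp
  show "(\<Sum>y\<in>slice. (y \<bullet> v)^3) = 0" using slice_moment_odd[OF v, of 1] by simp
  show "(\<Sum>y\<in>slice. (y \<bullet> v)^2) = 8100 * (v \<bullet> v)"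
    using slice_moment_even[of v 1] mm[of 2 2 2] mm[of 3 4 2] mm[of 4 6 2] cm_values cm0 W(2) by (simp add: b)
  show "(\<Sum>y\<in>slice. (y \<bullet> v)^4) = 3726 * (v \<bullet> v)^2"
    using slice_moment_even[of v 2] mm[of 3 2 4] mm[of 4 4 4] mm[of 5 6 4] cm_values cm0 W(2) by (simp add: b)
qed

text \<open>The power sums of degrees 0 to 4 form a Vandermonde system for the five counts. They are
  taken in the direction \<open>v\<close>, the projection of \<open>x\<close> to the complement of
  \<open>W\<close>, for which \<open>y \<bullet> v = y \<bullet> x - 1/6\<close> on the slice;
  \<open>x\<close> itself contributes \<open>(23/6) ^ k\<close>.\<close>

theorem slice_distribution:
  assumes x: "x \<in> slice"
  defines "n \<equiv> \<lambda>j. real (card {y \<in> slice - {x}. y \<bullet> x = j})"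
  shows "n (-2) = 506" "n (-1) = 8855" "n 0 = 23046" "n 1 = 14421" "n 2 = 1771"
    "(\<lambda>y. y \<bullet> x) ` (slice - {x}) \<subseteq> {-2, -1, 0, 1, 2}"
proof -
  have fin: "finite slice" unfolding slice_def using finite_shell' by auto
  have x': "x \<in> minvecs" "x \<bullet> W = 1" "x \<bullet> x = 4" using x by (auto simp: slice_def minvecs_iff)
  have S: "y \<in> minvecs \<and> y \<bullet> W = 1" if "y \<in> slice" for y using that by (auto simp: slice_def)
  show im: "(\<lambda>y. y \<bullet> x) ` (slice - {x}) \<subseteq> {-2, -1, 0, 1, 2}"
  proof (rule image_subsetI)
    fix y assume y: "y \<in> slice - {x}"
    then have "x \<noteq> - y" using S[of y] x'(2) by auto
    then show "y \<bullet> x \<in> {-2, -1, 0, 1, 2}" using y S[of y] by (intro minvecs_inner x') auto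
  qed
  define v where "v = x - (1/6) *\<^sub>R W"
  have v: "W \<bullet> v = 0" "v \<bullet> v = 23/6"
    using x' W by (simp_all add: v_def inner_simps inner_commute)
  have yv: "y \<bullet> v = y \<bullet> x - 1/6" if "y \<in> slice" for y using S[OF that] by (simp add: v_def inner_diff_right)
  have eq: "(\<Sum>y\<in>slice. (y \<bullet> v) ^ k) = (23/6) ^ k + (\<Sum>j\<in>{-2, -1, 0, 1, 2}. (j - 1/6) ^ k * n j)" for k
  proof -
    have "(\<Sum>y\<in>slice. (y \<bullet> v) ^ k) = (\<Sum>y\<in>slice. (y \<bullet> x - 1/6) ^ k)" by (intro sum.cong refl) (simp add: yv)
    also have "\<dots> = (23/6) ^ k + (\<Sum>y\<in>slice - {x}. (y \<bullet> x - 1/6) ^ k)"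
      using sum.remove[OF fin x, of "\<lambda>y. (y \<bullet> x - 1/6) ^ k"] x'(3) by simp
    also have "(\<Sum>y\<in>slice - {x}. (y \<bullet> x - 1/6) ^ k) = (\<Sum>j\<in>{-2, -1, 0, 1, 2}. (j - 1/6) ^ k * n j)"
      using sum_by_values[OF _ _ im, of "\<lambda>j. (j - 1/6) ^ k" "\<lambda>_. 1"] fin by (simp add: n_def)
    finally show ?thesis .
  qed
  have e: "48600 = 1 + (n (-2) + n (-1) + n 0 + n 1 + n 2)"
    "0 = 23/6 + ((-13/6) * n (-2) + (-7/6) * n (-1) + (-1/6) * n 0 + (5/6) * n 1 + (11/6) * n 2)"
    "31050 = 529/36 + ((169/36) * n (-2) + (49/36) * n (-1) + (1/36) * n 0 + (25/36) * n 1 + (121/36) * n 2)"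
    "0 = 12167/216 + ((-2197/216) * n (-2) + (-343/216) * n (-1) + (-1/216) * n 0 + (125/216) * n 1 + (1331/216) * n 2)"
    "3726 * 529/36 = 279841/1296 + ((28561/1296) * n (-2) + (2401/1296) * n (-1) + (1/1296) * n 0 + (625/1296) * n 1 + (14641/1296) * n 2)"
    using eq[of 0] eq[of 1] eq[of 2] eq[of 3] eq[of 4] slice_moments[OF v(1)] v(2)
    by (simp_all add: power_divide)
  show "n (-2) = 506" "n (-1) = 8855" "n 0 = 23046" "n 1 = 14421" "n 2 = 1771"
    using e by linarith+
qed

end

section \<open>Existence of the Leech lattice\<close>

text \<open>Vectors are in standard coordinates multiplied by \<open>sqrt 8\<close>.\<close>

definition leech_rows :: "int list list" where
  "leech_rows = [
    [1, 1, 1, 1, 1, 1, 1, 1, 1, 1, 1, 1, 1, 1, 1, 1, 1, 1, 1, 1, 1, 1, 1, -3],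
    [0, 2, 0, 0, 0, 0, 0, 0, 0, 0, 0, 0, 2, 2, 2, 0, 2, 2, 2, 0, 0, 0, 2, 0],
    [0, 0, 2, 0, 0, 0, 0, 0, 0, 0, 0, 0, 2, 0, 2, 2, 0, 2, 2, 2, 0, 0, 0, 2],
    [0, 0, 0, 2, 0, 0, 0, 0, 0, 0, 0, 0, 2, 2, 0, 2, 2, 0, 2, 2, 2, 0, 0, 0],
    [0, 0, 0, 0, 2, 0, 0, 0, 0, 0, 0, 0, 2, 0, 2, 0, 2, 2, 0, 2, 2, 2, 0, 0],
    [0, 0, 0, 0, 0, 2, 0, 0, 0, 0, 0, 0, 2, 0, 0, 2, 0, 2, 2, 0, 2, 2, 2, 0],
    [0, 0, 0, 0, 0, 0, 2, 0, 0, 0, 0, 0, 2, 0, 0, 0, 2, 0, 2, 2, 0, 2, 2, 2],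
    [0, 0, 0, 0, 0, 0, 0, 2, 0, 0, 0, 0, 2, 2, 0, 0, 0, 2, 0, 2, 2, 0, 2, 2],
    [0, 0, 0, 0, 0, 0, 0, 0, 2, 0, 0, 0, 2, 2, 2, 0, 0, 0, 2, 0, 2, 2, 0, 2],
    [0, 0, 0, 0, 0, 0, 0, 0, 0, 2, 0, 0, 2, 2, 2, 2, 0, 0, 0, 2, 0, 2, 2, 0],
    [0, 0, 0, 0, 0, 0, 0, 0, 0, 0, 2, 0, 2, 0, 2, 2, 2, 0, 0, 0, 2, 0, 2, 2],
    [0, 0, 0, 0, 0, 0, 0, 0, 0, 0, 0, 2, 2, 2, 0, 2, 2, 2, 0, 0, 0, 2, 0, 2],
    [0, 0, 0, 0, 0, 0, 0, 0, 0, 0, 0, 0, 4, 0, 0, 0, 0, 0, 0, 0, 0, 0, 0, 4],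
    [0, 0, 0, 0, 0, 0, 0, 0, 0, 0, 0, 0, 0, 4, 0, 0, 0, 0, 0, 0, 0, 0, 0, 4],
    [0, 0, 0, 0, 0, 0, 0, 0, 0, 0, 0, 0, 0, 0, 4, 0, 0, 0, 0, 0, 0, 0, 0, 4],
    [0, 0, 0, 0, 0, 0, 0, 0, 0, 0, 0, 0, 0, 0, 0, 4, 0, 0, 0, 0, 0, 0, 0, 4],
    [0, 0, 0, 0, 0, 0, 0, 0, 0, 0, 0, 0, 0, 0, 0, 0, 4, 0, 0, 0, 0, 0, 0, 4],
    [0, 0, 0, 0, 0, 0, 0, 0, 0, 0, 0, 0, 0, 0, 0, 0, 0, 4, 0, 0, 0, 0, 0, 4],
    [0, 0, 0, 0, 0, 0, 0, 0, 0, 0, 0, 0, 0, 0, 0, 0, 0, 0, 4, 0, 0, 0, 0, 4],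
    [0, 0, 0, 0, 0, 0, 0, 0, 0, 0, 0, 0, 0, 0, 0, 0, 0, 0, 0, 4, 0, 0, 0, 4],
    [0, 0, 0, 0, 0, 0, 0, 0, 0, 0, 0, 0, 0, 0, 0, 0, 0, 0, 0, 0, 4, 0, 0, 4],
    [0, 0, 0, 0, 0, 0, 0, 0, 0, 0, 0, 0, 0, 0, 0, 0, 0, 0, 0, 0, 0, 4, 0, 4],
    [0, 0, 0, 0, 0, 0, 0, 0, 0, 0, 0, 0, 0, 0, 0, 0, 0, 0, 0, 0, 0, 0, 4, 4],
    [0, 0, 0, 0, 0, 0, 0, 0, 0, 0, 0, 0, 0, 0, 0, 0, 0, 0, 0, 0, 0, 0, 0, 8]]"

text \<open>The dual basis in the same coordinates: 8 times the inverse transpose of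
  \<open>leech_rows\<close>, and lower triangular because \<open>leech_rows\<close> is upper
  triangular.\<close>

definition leech_dual_rows :: "int list list" where
  "leech_dual_rows = [
    [8, 0, 0, 0, 0, 0, 0, 0, 0, 0, 0, 0, 0, 0, 0, 0, 0, 0, 0, 0, 0, 0, 0, 0],
    [-4, 4, 0, 0, 0, 0, 0, 0, 0, 0, 0, 0, 0, 0, 0, 0, 0, 0, 0, 0, 0, 0, 0, 0],
    [-4, 0, 4, 0, 0, 0, 0, 0, 0, 0, 0, 0, 0, 0, 0, 0, 0, 0, 0, 0, 0, 0, 0, 0],
    [-4, 0, 0, 4, 0, 0, 0, 0, 0, 0, 0, 0, 0, 0, 0, 0, 0, 0, 0, 0, 0, 0, 0, 0],
    [-4, 0, 0, 0, 4, 0, 0, 0, 0, 0, 0, 0, 0, 0, 0, 0, 0, 0, 0, 0, 0, 0, 0, 0],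
    [-4, 0, 0, 0, 0, 4, 0, 0, 0, 0, 0, 0, 0, 0, 0, 0, 0, 0, 0, 0, 0, 0, 0, 0],
    [-4, 0, 0, 0, 0, 0, 4, 0, 0, 0, 0, 0, 0, 0, 0, 0, 0, 0, 0, 0, 0, 0, 0, 0],
    [-4, 0, 0, 0, 0, 0, 0, 4, 0, 0, 0, 0, 0, 0, 0, 0, 0, 0, 0, 0, 0, 0, 0, 0],
    [-4, 0, 0, 0, 0, 0, 0, 0, 4, 0, 0, 0, 0, 0, 0, 0, 0, 0, 0, 0, 0, 0, 0, 0],
    [-4, 0, 0, 0, 0, 0, 0, 0, 0, 4, 0, 0, 0, 0, 0, 0, 0, 0, 0, 0, 0, 0, 0, 0],
    [-4, 0, 0, 0, 0, 0, 0, 0, 0, 0, 4, 0, 0, 0, 0, 0, 0, 0, 0, 0, 0, 0, 0, 0],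
    [-4, 0, 0, 0, 0, 0, 0, 0, 0, 0, 0, 4, 0, 0, 0, 0, 0, 0, 0, 0, 0, 0, 0, 0],
    [20, -2, -2, -2, -2, -2, -2, -2, -2, -2, -2, -2, 2, 0, 0, 0, 0, 0, 0, 0, 0, 0, 0, 0],
    [10, -2, 0, -2, 0, 0, 0, -2, -2, -2, 0, -2, 0, 2, 0, 0, 0, 0, 0, 0, 0, 0, 0, 0],
    [10, -2, -2, 0, -2, 0, 0, 0, -2, -2, -2, 0, 0, 0, 2, 0, 0, 0, 0, 0, 0, 0, 0, 0],
    [10, 0, -2, -2, 0, -2, 0, 0, 0, -2, -2, -2, 0, 0, 0, 2, 0, 0, 0, 0, 0, 0, 0, 0],
    [10, -2, 0, -2, -2, 0, -2, 0, 0, 0, -2, -2, 0, 0, 0, 0, 2, 0, 0, 0, 0, 0, 0, 0],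
    [10, -2, -2, 0, -2, -2, 0, -2, 0, 0, 0, -2, 0, 0, 0, 0, 0, 2, 0, 0, 0, 0, 0, 0],
    [10, -2, -2, -2, 0, -2, -2, 0, -2, 0, 0, 0, 0, 0, 0, 0, 0, 0, 2, 0, 0, 0, 0, 0],
    [10, 0, -2, -2, -2, 0, -2, -2, 0, -2, 0, 0, 0, 0, 0, 0, 0, 0, 0, 2, 0, 0, 0, 0],
    [10, 0, 0, -2, -2, -2, 0, -2, -2, 0, -2, 0, 0, 0, 0, 0, 0, 0, 0, 0, 2, 0, 0, 0],
    [10, 0, 0, 0, -2, -2, -2, 0, -2, -2, 0, -2, 0, 0, 0, 0, 0, 0, 0, 0, 0, 2, 0, 0],
    [10, -2, 0, 0, 0, -2, -2, -2, 0, -2, -2, 0, 0, 0, 0, 0, 0, 0, 0, 0, 0, 0, 2, 0],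
    [-51, 7, 5, 7, 7, 7, 5, 5, 5, 7, 5, 5, -1, -1, -1, -1, -1, -1, -1, -1, -1, -1, -1, 1]]"

text \<open>The inverse of the Gram matrix of \<open>leech_rows\<close> (with respect to the inner product divided by 8); it expresses
  the dual basis in terms of the basis.\<close>

definition leech_gram_inverse :: "int list list" where
  "leech_gram_inverse = [
    [8, -4, -4, -4, -4, -4, -4, -4, -4, -4, -4, -4, 20, 10, 10, 10, 10, 10, 10, 10, 10, 10, 10, -51],
    [-4, 4, 2, 2, 2, 2, 2, 2, 2, 2, 2, 2, -11, -6, -6, -5, -6, -6, -6, -5, -5, -5, -6, 29],
    [-4, 2, 4, 2, 2, 2, 2, 2, 2, 2, 2, 2, -11, -5, -6, -6, -5, -6, -6, -6, -5, -5, -5, 28],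
    [-4, 2, 2, 4, 2, 2, 2, 2, 2, 2, 2, 2, -11, -6, -5, -6, -6, -5, -6, -6, -6, -5, -5, 29],
    [-4, 2, 2, 2, 4, 2, 2, 2, 2, 2, 2, 2, -11, -5, -6, -5, -6, -6, -5, -6, -6, -6, -5, 29],
    [-4, 2, 2, 2, 2, 4, 2, 2, 2, 2, 2, 2, -11, -5, -5, -6, -5, -6, -6, -5, -6, -6, -6, 29],
    [-4, 2, 2, 2, 2, 2, 4, 2, 2, 2, 2, 2, -11, -5, -5, -5, -6, -5, -6, -6, -5, -6, -6, 28],
    [-4, 2, 2, 2, 2, 2, 2, 4, 2, 2, 2, 2, -11, -6, -5, -5, -5, -6, -5, -6, -6, -5, -6, 28],
    [-4, 2, 2, 2, 2, 2, 2, 2, 4, 2, 2, 2, -11, -6, -6, -5, -5, -5, -6, -5, -6, -6, -5, 28],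
    [-4, 2, 2, 2, 2, 2, 2, 2, 2, 4, 2, 2, -11, -6, -6, -6, -5, -5, -5, -6, -5, -6, -6, 29],
    [-4, 2, 2, 2, 2, 2, 2, 2, 2, 2, 4, 2, -11, -5, -6, -6, -6, -5, -5, -5, -6, -5, -6, 28],
    [-4, 2, 2, 2, 2, 2, 2, 2, 2, 2, 2, 4, -11, -6, -5, -6, -6, -6, -5, -5, -5, -6, -5, 28],
    [20, -11, -11, -11, -11, -11, -11, -11, -11, -11, -11, -11, 56, 28, 28, 28, 28, 28, 28, 28, 28, 28, 28, -144],
    [10, -6, -5, -6, -5, -5, -5, -6, -6, -6, -5, -6, 28, 16, 14, 14, 14, 14, 14, 14, 14, 14, 14, -73],
    [10, -6, -6, -5, -6, -5, -5, -5, -6, -6, -6, -5, 28, 14, 16, 14, 14, 14, 14, 14, 14, 14, 14, -73],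
    [10, -5, -6, -6, -5, -6, -5, -5, -5, -6, -6, -6, 28, 14, 14, 16, 14, 14, 14, 14, 14, 14, 14, -73],
    [10, -6, -5, -6, -6, -5, -6, -5, -5, -5, -6, -6, 28, 14, 14, 14, 16, 14, 14, 14, 14, 14, 14, -73],
    [10, -6, -6, -5, -6, -6, -5, -6, -5, -5, -5, -6, 28, 14, 14, 14, 14, 16, 14, 14, 14, 14, 14, -73],
    [10, -6, -6, -6, -5, -6, -6, -5, -6, -5, -5, -5, 28, 14, 14, 14, 14, 14, 16, 14, 14, 14, 14, -73],
    [10, -5, -6, -6, -6, -5, -6, -6, -5, -6, -5, -5, 28, 14, 14, 14, 14, 14, 14, 16, 14, 14, 14, -73],
    [10, -5, -5, -6, -6, -6, -5, -6, -6, -5, -6, -5, 28, 14, 14, 14, 14, 14, 14, 14, 16, 14, 14, -73],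
    [10, -5, -5, -5, -6, -6, -6, -5, -6, -6, -5, -6, 28, 14, 14, 14, 14, 14, 14, 14, 14, 16, 14, -73],
    [10, -6, -5, -5, -5, -6, -6, -6, -5, -6, -6, -5, 28, 14, 14, 14, 14, 14, 14, 14, 14, 14, 16, -73],
    [-51, 29, 28, 29, 29, 29, 28, 28, 28, 29, 28, 28, -144, -73, -73, -73, -73, -73, -73, -73, -73, -73, -73, 376]]"

text \<open>A generator matrix of the extended binary Golay code in bordered circulant form; the
  code is self-dual, so the same rows are parity checks. Doubled, the rows 1 to 11 are the rows 1 to
  11 of \<open>leech_rows\<close>.\<close>

definition golay_checks :: "int list list" where
  "golay_checks = [
    [1, 0, 0, 0, 0, 0, 0, 0, 0, 0, 0, 0, 0, 1, 1, 1, 1, 1, 1, 1, 1, 1, 1, 1],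
    [0, 1, 0, 0, 0, 0, 0, 0, 0, 0, 0, 0, 1, 1, 1, 0, 1, 1, 1, 0, 0, 0, 1, 0],
    [0, 0, 1, 0, 0, 0, 0, 0, 0, 0, 0, 0, 1, 0, 1, 1, 0, 1, 1, 1, 0, 0, 0, 1],
    [0, 0, 0, 1, 0, 0, 0, 0, 0, 0, 0, 0, 1, 1, 0, 1, 1, 0, 1, 1, 1, 0, 0, 0],
    [0, 0, 0, 0, 1, 0, 0, 0, 0, 0, 0, 0, 1, 0, 1, 0, 1, 1, 0, 1, 1, 1, 0, 0],
    [0, 0, 0, 0, 0, 1, 0, 0, 0, 0, 0, 0, 1, 0, 0, 1, 0, 1, 1, 0, 1, 1, 1, 0],
    [0, 0, 0, 0, 0, 0, 1, 0, 0, 0, 0, 0, 1, 0, 0, 0, 1, 0, 1, 1, 0, 1, 1, 1],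
    [0, 0, 0, 0, 0, 0, 0, 1, 0, 0, 0, 0, 1, 1, 0, 0, 0, 1, 0, 1, 1, 0, 1, 1],
    [0, 0, 0, 0, 0, 0, 0, 0, 1, 0, 0, 0, 1, 1, 1, 0, 0, 0, 1, 0, 1, 1, 0, 1],
    [0, 0, 0, 0, 0, 0, 0, 0, 0, 1, 0, 0, 1, 1, 1, 1, 0, 0, 0, 1, 0, 1, 1, 0],
    [0, 0, 0, 0, 0, 0, 0, 0, 0, 0, 1, 0, 1, 0, 1, 1, 1, 0, 0, 0, 1, 0, 1, 1],
    [0, 0, 0, 0, 0, 0, 0, 0, 0, 0, 0, 1, 1, 1, 0, 1, 1, 1, 0, 0, 0, 1, 0, 1]]"

definition idot :: "int list \<Rightarrow> int list \<Rightarrow> int" where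
  "idot xs ys = sum_list (map2 (*) xs ys)"

text \<open>Decides whether \<open>s\<close> is a sum modulo 2 of at most \<open>k\<close> members of the list. On the columns of
  \<open>golay_checks\<close> this shows that the Golay code has no nonzero words of weight at most 4.\<close>

fun even_subset :: "nat \<Rightarrow> bool list \<Rightarrow> bool list list \<Rightarrow> bool" where
  "even_subset k s [] = (\<not> list_ex id s)"
| "even_subset 0 s (c # cs) = even_subset 0 s cs"
| "even_subset (Suc k) s (c # cs) = (even_subset (Suc k) s cs \<or> even_subset k (map2 (\<noteq>) s c) cs)"

definition golay_column :: "nat \<Rightarrow> bool list" where
  "golay_column i = map (\<lambda>g. g ! i = 1) golay_checks"

section \<open>Checks of the tables by computation\<close>

lemma leech_rows_biorthogonal:
  "list_all (\<lambda>i. list_all (\<lambda>j. idot (leech_rows ! i) (leech_dual_rows ! j) = (if i = j then 8 else 0)) [0..<24]) [0..<24]"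
  by code_simp

lemma leech_rows_gram:
  "list_all (\<lambda>r. list_all (\<lambda>r'. idot r r' mod 8 = 0) leech_rows \<and> idot r r mod 16 = 0) leech_rows"
  by code_simp

lemma leech_dual_rows_eq:
  "map (\<lambda>n. map (\<lambda>c. idot n (map (\<lambda>r. r ! c) leech_rows)) [0..<24]) leech_gram_inverse = leech_dual_rows"
  by code_simp

text \<open>These congruences are linear, so they pass from the rows to the lattice generated by
  them, where they exclude vectors of norm 2.\<close>

lemma leech_rows_congruences:
  "list_all (\<lambda>r. list_all (\<lambda>x. (x - hd r) mod 2 = 0) r \<and> (sum_list r - 4 * hd r) mod 8 = 0 \<and>
     list_all (\<lambda>g. idot g r mod 4 = 0) golay_checks) leech_rows"
  by code_simp

lemma leech_table_lengths:
  "length leech_rows = 24" "list_all (\<lambda>r. length r = 24) leech_rows"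
  "length leech_dual_rows = 24" "list_all (\<lambda>r. length r = 24) leech_dual_rows"
  "length leech_gram_inverse = 24" "list_all (\<lambda>r. length r = 24) leech_gram_inverse"
  "length golay_checks = 12" "list_all (\<lambda>r. length r = 24) golay_checks"
  by code_simp+

lemma golay_no_even_subset:
  "list_all (\<lambda>m. \<not> even_subset 3 (golay_column m) (map golay_column [Suc m..<24])) [0..<24]"
  by code_simp

text \<open>With coordinates scaled by \<open>sqrt 8\<close>, the values 32 and 48 are the norms 4
  of a minimal vector and 6 of the vector chosen as \<open>W\<close>.\<close>

lemma leech_special_vectors:
  "idot (leech_rows ! 0) (leech_rows ! 0) = 32"
  "idot (map2 (+) (map2 (-) (leech_rows ! 0) (leech_rows ! 1)) (leech_rows ! 2))
     (map2 (+) (map2 (-) (leech_rows ! 0) (leech_rows ! 1)) (leech_rows ! 2)) = 48"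
  by code_simp+

lemma idot_sum: "length xs = n \<Longrightarrow> length ys = n \<Longrightarrow> idot xs ys = (\<Sum>i<n. xs ! i * ys ! i)"
  by (simp add: idot_def sum_list_sum_nth atLeast0LessThan)

text \<open>Turns a failed search into a proof of nonexistence. \<open>odd_at\<close> marks the
  columns that add up to \<open>s\<close> modulo 2; passing a marked column subtracts it from
  \<open>s\<close> and uses up one of the \<open>k\<close> choices.\<close>

lemma even_subset_complete:
  assumes "length s = n" "\<forall>i\<in>set is. length (col i) = n" "length (filter odd_at is) \<le> k"
    "\<And>r. r < n \<Longrightarrow> s ! r = odd (length (filter (\<lambda>i. odd_at i \<and> col i ! r) is))"
  shows "even_subset k s (map col is)"
  using assms
proof (induction "is" arbitrary: k s)
  case Nil
  then have "\<forall>r<n. \<not> s ! r" by simp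
  then show ?case using Nil(1) by (auto simp: list_ex_iff in_set_conv_nth)
next
  case (Cons i "is")
  show ?case
  proof (cases "odd_at i")
    case True
    then obtain k' where k': "k = Suc k'" using Cons.prems(3) by (cases k) auto
    have "even_subset k' (map2 (\<noteq>) s (col i)) (map col is)"
    proof (rule Cons.IH)
      show "map2 (\<noteq>) s (col i) ! r = odd (length (filter (\<lambda>i. odd_at i \<and> col i ! r) is))" if "r < n" for r
        using Cons.prems(4)[OF that] Cons.prems(1,2) that True by auto
    qed (use Cons.prems True k' in auto)
    then show ?thesis by (simp add: k')
  next
    case False
    then have "even_subset k s (map col is)" using Cons.prems by (intro Cons.IH) auto
    then show ?thesis by (cases k) auto
  qed
qed

lemma golay_binary: "list_all (list_all (\<lambda>x. x \<in> {0, 1})) golay_checks"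
  by code_simp

text \<open>\<open>P\<close> is the support of a word of weight at most 4 that satisfies all parity
  checks. If \<open>m\<close> were its least position, column \<open>m\<close> would be the sum of
  the at most 3 remaining columns, which the search for every \<open>m\<close> excludes.\<close>

lemma golay_parity:
  fixes P :: "nat \<Rightarrow> bool"
  assumes ev: "\<And>g. g < 12 \<Longrightarrow> even (card {i\<in>{..<24}. golay_checks ! g ! i = 1 \<and> P i})"
    and card: "card {i\<in>{..<24}. P i} \<le> 4" and i: "i < 24"
  shows "\<not> P i"
proof
  assume "P i"
  define m where "m = (LEAST i. P i)"
  have m: "P m" "m < 24" "\<And>j. P j \<Longrightarrow> m \<le> j"
    using \<open>P i\<close> i by (auto simp: m_def intro: LeastI Least_le le_less_trans)
  have len: "length (filter Q [Suc m..<24]) = card {j\<in>{Suc m..<24}. Q j}" for Q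
    by (subst distinct_card[symmetric]) (auto intro!: arg_cong[of _ _ card])
  have split: "{i\<in>{..<24}. Q i \<and> P i} = (if Q m then insert m {j\<in>{Suc m..<24}. P j \<and> Q j} else {j\<in>{Suc m..<24}. P j \<and> Q j})" for Q
  proof -
    have "x = m \<or> Suc m \<le> x" if "P x" for x using m(3)[OF that] by auto
    then show ?thesis using m(1,2) by auto
  qed
  have "even_subset 3 (golay_column m) (map golay_column [Suc m..<24])"
  proof (rule even_subset_complete[where n = 12 and odd_at = P])
    show "length (golay_column m) = 12" "\<forall>i\<in>set [Suc m..<24]. length (golay_column i) = 12"
      by (simp_all add: golay_column_def leech_table_lengths)
    have "{i\<in>{..<24}. P i} = insert m {j\<in>{Suc m..<24}. P j}" using split[of "\<lambda>_. True"] by simp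
    moreover have "card (insert m {j\<in>{Suc m..<24}. P j}) = Suc (card {j\<in>{Suc m..<24}. P j})"
      by (rule card_insert_disjoint) auto
    ultimately have "card {i\<in>{..<24}. P i} = Suc (card {j\<in>{Suc m..<24}. P j})" by (simp only:)
    then show "length (filter P [Suc m..<24]) \<le> 3" using card unfolding len by linarith
    fix r :: nat assume r: "r < 12"
    have "golay_column j ! r = (golay_checks ! r ! j = 1)" for j using r by (simp add: golay_column_def leech_table_lengths)
    then show "golay_column m ! r = odd (length (filter (\<lambda>i. P i \<and> golay_column i ! r) [Suc m..<24]))"
      using ev[OF r] unfolding split[of "\<lambda>i. golay_checks ! r ! i = 1"] len by (auto split: if_splits)
  qed
  then show False using golay_no_even_subset m(2) by (auto simp: list_all_iff)
qed

text \<open>Self-duality is read off from the tables, because the dual basis is an integral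
  combination of the basis. Vectors of norm 2 are excluded by a descent through the coordinates:
  they turn out to be divisible by 2 and then by 4, which the coordinate sum modulo 8
  contradicts.\<close>

theorem leech_lattice_exists:
  obtains \<Lambda> W where "leech_lattice \<Lambda>" "W \<in> \<Lambda>" "W \<bullet> W = 6"
proof -
  obtain e where e: "bij_betw e {..<24::nat} (Basis :: (real ^ 24) set)"
    using bij_betw_from_nat_into_finite[of "Basis :: (real ^ 24) set"] by auto
  have eB: "e i \<in> Basis" if "i < 24" for i using e that by (auto simp: bij_betw_def)
  have ee: "e i \<bullet> e j = (if i = j then 1 else 0)" if "i < 24" "j < 24" for i j
    using e that by (auto simp: inner_Basis eB bij_betw_def inj_on_def)
  define comb where "comb c = (\<Sum>i<24. (of_int (c i) / sqrt 8) *\<^sub>R e i)" for c :: "nat \<Rightarrow> int"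
  have comb_inner: "comb c \<bullet> comb d = of_int (\<Sum>i<24. c i * d i) / 8" for c d
  proof -
    have ce: "comb c \<bullet> e j = of_int (c j) / sqrt 8" if "j < 24" for j
    proof -
      have "comb c \<bullet> e j = (\<Sum>i<24. if i = j then of_int (c j) / sqrt 8 else 0)"
        unfolding comb_def inner_sum_left by (intro sum.cong refl) (simp add: ee that)
      then show ?thesis using that by simp
    qed
    have "comb c \<bullet> comb d = (\<Sum>j<24. (of_int (d j) / sqrt 8) * (comb c \<bullet> e j))"
      unfolding comb_def[of d] inner_sum_right inner_scaleR_right ..
    also have "\<dots> = (\<Sum>i<24. of_int (c i * d i) / 8)"
      by (intro sum.cong refl) (simp add: ce)
    finally show ?thesis by (simp add: sum_divide_distrib)
  qed
  have comb_sum: "(\<Sum>j\<in>J. of_int (k j) *\<^sub>R comb (c j)) = comb (\<lambda>i. \<Sum>j\<in>J. k j * c j i)" for k :: "nat \<Rightarrow> int" and c J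
    unfolding comb_def scaleR_sum_right by (subst sum.swap) (simp add: scaleR_sum_left[symmetric] sum_divide_distrib)
  define b where "b j = comb (\<lambda>i. leech_rows ! j ! i)" for j
  define d where "d j = comb (\<lambda>i. leech_dual_rows ! j ! i)" for j
  have lenB: "length (leech_rows ! j) = 24" "length (leech_dual_rows ! j) = 24" "length (leech_gram_inverse ! j) = 24" if "j < 24" for j
    using leech_table_lengths that by (auto simp: list_all_length)
  have lenG: "length (golay_checks ! j) = 24" if "j < 12" for j
    using leech_table_lengths that by (auto simp: list_all_length)
  have bb: "b i \<bullet> b j = of_int (idot (leech_rows ! i) (leech_rows ! j)) / 8" if "i < 24" "j < 24" for i j
    by (simp add: b_def comb_inner idot_sum[OF lenB(1) lenB(1)] that)
  have bd: "b i \<bullet> d j = (if i = j then 1 else 0)" if "i < 24" "j < 24" for i j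
  proof -
    have "idot (leech_rows ! i) (leech_dual_rows ! j) = (if i = j then 8 else 0)"
      using leech_rows_biorthogonal that by (simp add: list_all_iff)
    moreover have "b i \<bullet> d j = of_int (idot (leech_rows ! i) (leech_dual_rows ! j)) / 8"
      by (simp add: b_def d_def comb_inner idot_sum[OF lenB(1) lenB(2)] that)
    ultimately show ?thesis by (cases "i = j") simp_all
  qed
  have gram: "idot (leech_rows ! i) (leech_rows ! j) mod 8 = 0" "idot (leech_rows ! i) (leech_rows ! i) mod 16 = 0" if "i < 24" "j < 24" for i j
    using leech_rows_gram leech_table_lengths(1) that by (auto simp: list_all_length)
  have bb_int: "b i \<bullet> b j \<in> \<int>" if "i < 24" "j < 24" for i j
  proof -
    have "8 dvd idot (leech_rows ! i) (leech_rows ! j)" using gram(1)[OF that] by (simp add: mod_eq_0_iff_dvd)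
    then obtain q where "idot (leech_rows ! i) (leech_rows ! j) = 8 * q" by (elim dvdE)
    then show ?thesis by (simp add: bb[OF that])
  qed
  have bb_even: "\<exists>q::int. b i \<bullet> b i = 2 * of_int q" if "i < 24" for i
  proof -
    have "16 dvd idot (leech_rows ! i) (leech_rows ! i)" using gram(2)[OF that that] by (simp add: mod_eq_0_iff_dvd)
    then obtain q where "idot (leech_rows ! i) (leech_rows ! i) = 16 * q" by (elim dvdE)
    then show ?thesis by (simp add: bb[OF that that])
  qed
  have d_b: "d j = (\<Sum>k<24. of_int (leech_gram_inverse ! j ! k) *\<^sub>R b k)" if "j < 24" for j
  proof -
    have "leech_dual_rows ! j ! c = (\<Sum>k<24. leech_gram_inverse ! j ! k * leech_rows ! k ! c)" if "c < 24" for c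
    proof -
      have "leech_dual_rows ! j ! c = idot (leech_gram_inverse ! j) (map (\<lambda>r. r ! c) leech_rows)"
        unfolding leech_dual_rows_eq[symmetric] using \<open>j < 24\<close> that by (simp add: leech_table_lengths)
      also have "\<dots> = (\<Sum>k<24. leech_gram_inverse ! j ! k * map (\<lambda>r. r ! c) leech_rows ! k)"
        by (intro idot_sum) (simp_all add: lenB \<open>j < 24\<close> leech_table_lengths)
      also have "\<dots> = (\<Sum>k<24. leech_gram_inverse ! j ! k * leech_rows ! k ! c)"
        by (intro sum.cong refl) (simp add: leech_table_lengths)
      finally show ?thesis .
    qed
    then show ?thesis unfolding b_def comb_sum d_def by (simp add: comb_def)
  qed
  define \<Lambda> where "\<Lambda> = {(\<Sum>j<24. of_int (k j) *\<^sub>R b j) | k :: nat \<Rightarrow> int. True}"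
  have mem: "(\<Sum>j<24. of_int (k j) *\<^sub>R b j) \<in> \<Lambda>" for k unfolding \<Lambda>_def by blast
  have bmem: "b j \<in> \<Lambda>" if "j < 24" for j
  proof -
    have "(\<Sum>i<24. of_int (if i = j then 1 else 0) *\<^sub>R b i) = (\<Sum>i<24. if i = j then b j else 0)"
      by (intro sum.cong refl) simp
    then show ?thesis using mem[of "\<lambda>i. if i = j then 1 else 0"] that by simp
  qed
  have coeff: "(\<Sum>j<24. r j *\<^sub>R b j) \<bullet> d i = r i" if "i < 24" for r i
  proof -
    have "(\<Sum>j<24. r j *\<^sub>R b j) \<bullet> d i = (\<Sum>j<24. if j = i then r i else 0)"
      unfolding inner_sum_left by (intro sum.cong refl) (simp add: bd that)
    then show ?thesis using that by simp
  qed
  have injb: "inj_on b {..<24}"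
  proof (rule inj_onI)
    fix i j assume ij: "i \<in> {..<24}" "j \<in> {..<24}" "b i = b j"
    then have "b i \<bullet> d j = b j \<bullet> d j" by simp
    then show "i = j" using bd[of i j] bd[of j j] ij by (auto split: if_splits)
  qed
  define B where "B = b ` {..<24}"
  have B: "finite B" "card B = 24" using card_image[OF injb] by (auto simp: B_def)
  have sumB: "(\<Sum>v\<in>B. u v *\<^sub>R v) = (\<Sum>j<24. u (b j) *\<^sub>R b j)" for u
    unfolding B_def by (simp add: sum.reindex[OF injb])
  have indep: "independent B"
  proof (rule ccontr)
    assume "\<not> independent B"
    then obtain u v where u: "v \<in> B" "u v \<noteq> 0" "(\<Sum>v\<in>B. u v *\<^sub>R v) = 0"
      using dependent_finite[OF B(1)] by auto
    then obtain j where j: "j < 24" "v = b j" by (auto simp: B_def)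
    have "u (b j) = 0" using coeff[OF j(1), of "\<lambda>j. u (b j)"] u(3) by (simp add: sumB)
    then show False using u j by simp
  qed
  have spanB: "span B = UNIV"
    using card_eq_dim[of B UNIV] B indep by auto
  have full: "full_rank_lattice \<Lambda>"
    unfolding full_rank_lattice_def
  proof (intro exI[of _ B] conjI indep spanB set_eqI iffI)
    fix x assume "x \<in> \<Lambda>"
    then obtain k where k: "x = (\<Sum>j<24. of_int (k j) *\<^sub>R b j)" by (auto simp: \<Lambda>_def)
    have "x = (\<Sum>v\<in>B. of_int (k (the_inv_into {..<24} b v)) *\<^sub>R v)"
      unfolding k sumB by (intro sum.cong refl) (simp add: the_inv_into_f_f[OF injb])
    then show "x \<in> {(\<Sum>b\<in>B. of_int (c b) *\<^sub>R b) | c. True}"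
      by (auto intro!: exI[of _ "\<lambda>v. k (the_inv_into {..<24} b v)"])
  next
    fix x assume "x \<in> {(\<Sum>b\<in>B. of_int (c b) *\<^sub>R b) | c. True}"
    then obtain c :: "real ^ 24 \<Rightarrow> int" where "x = (\<Sum>b\<in>B. of_int (c b) *\<^sub>R b)" by blast
    then show "x \<in> \<Lambda>" using mem[of "\<lambda>j. c (b j)"] by (simp add: sumB)
  qed
  have inner_b: "x \<bullet> b j \<in> \<int>" if "x \<in> \<Lambda>" "j < 24" for x j
    using that by (auto simp: \<Lambda>_def inner_sum_left intro!: Ints_sum Ints_mult bb_int)
  have inner_int: "x \<bullet> y \<in> \<int>" if "x \<in> \<Lambda>" "y \<in> \<Lambda>" for x y
    using that(2) inner_b[OF that(1)] by (auto simp: \<Lambda>_def inner_sum_right intro!: Ints_sum Ints_mult)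
  have dual: "dual_lattice \<Lambda> = \<Lambda>"
  proof (intro set_eqI iffI)
    fix x assume "x \<in> \<Lambda>" then show "x \<in> dual_lattice \<Lambda>" using inner_int by (auto simp: dual_lattice_def)
  next
    fix x assume x: "x \<in> dual_lattice \<Lambda>"
    have "\<exists>k::int. x \<bullet> b j = of_int k" if "j < 24" for j
      using x bmem[OF that] by (auto simp: dual_lattice_def elim!: Ints_cases)
    then obtain k :: "nat \<Rightarrow> int" where k: "\<And>j. j < 24 \<Longrightarrow> x \<bullet> b j = of_int (k j)" by metis
    define z where "z = x - (\<Sum>j<24. of_int (k j) *\<^sub>R d j)"
    have "z \<bullet> b i = 0" if "i < 24" for i
    proof -
      have "(\<Sum>j<24. of_int (k j) *\<^sub>R d j) \<bullet> b i = (\<Sum>j<24. if j = i then real_of_int (k i) else 0)"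
        unfolding inner_sum_left using that by (intro sum.cong refl) (simp add: inner_commute[of _ "b i"] bd)
      then show ?thesis using that k by (simp add: z_def inner_diff_left)
    qed
    then have "orthogonal z z"
      using spanB by (intro orthogonal_to_span[of z B]) (auto simp: orthogonal_def B_def inner_commute)
    then have "x = (\<Sum>j<24. of_int (k j) *\<^sub>R d j)" by (simp add: z_def orthogonal_self)
    also have "\<dots> = (\<Sum>j<24. \<Sum>i<24. of_int (k j * leech_gram_inverse ! j ! i) *\<^sub>R b i)"
      by (intro sum.cong refl) (simp add: d_b scaleR_sum_right)
    also have "\<dots> = (\<Sum>i<24. of_int (\<Sum>j<24. k j * leech_gram_inverse ! j ! i) *\<^sub>R b i)"
      by (subst sum.swap) (simp add: scaleR_sum_left)
    finally show "x \<in> \<Lambda>" by (simp only: mem)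
  qed
  \<comment> \<open>Evenness passes from the basis to all sums because cross terms occur
    twice.\<close>
  have even_part: "\<exists>q::int. (\<Sum>j<n. of_int (k j) *\<^sub>R b j) \<bullet> (\<Sum>j<n. of_int (k j) *\<^sub>R b j) = 2 * of_int q" if "n \<le> 24" for n and k :: "nat \<Rightarrow> int"
    using that
  proof (induction n)
    case 0 show ?case by (intro exI[of _ 0]) simp
  next
    case (Suc n)
    define y where "y = (\<Sum>j<n. of_int (k j) *\<^sub>R b j)"
    obtain q :: int where q: "y \<bullet> y = 2 * of_int q" using Suc by (auto simp: y_def)
    obtain r :: int where r: "b n \<bullet> b n = 2 * of_int r" using bb_even[of n] Suc.prems by auto
    have "y \<bullet> b n \<in> \<int>"
      using Suc.prems by (auto simp: y_def inner_sum_left intro!: Ints_sum Ints_mult bb_int)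
    then obtain s :: int where s: "y \<bullet> b n = of_int s" by (auto elim: Ints_cases)
    have "(\<Sum>j<Suc n. of_int (k j) *\<^sub>R b j) \<bullet> (\<Sum>j<Suc n. of_int (k j) *\<^sub>R b j) = 2 * of_int (q + k n * k n * r + k n * s)"
      using q r s by (simp add: y_def[symmetric] inner_simps inner_commute algebra_simps)
    then show ?case by blast
  qed
  have even: "\<exists>q::int. x \<bullet> x = 2 * of_int q" if "x \<in> \<Lambda>" for x
    using that even_part[of 24] by (auto simp: \<Lambda>_def)
  have no_roots: "x \<bullet> x \<noteq> 2" if "x \<in> \<Lambda>" for x
  proof
    assume x2: "x \<bullet> x = 2"
    obtain k where k: "x = (\<Sum>j<24. of_int (k j) *\<^sub>R b j)" using \<open>x \<in> \<Lambda>\<close> by (auto simp: \<Lambda>_def)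
    define c where "c i = (\<Sum>j<24. k j * leech_rows ! j ! i)" for i
    have "x = comb c" unfolding k b_def comb_sum c_def ..
    \<comment> \<open>After scaling, norm 2 means that the squares of the integral coordinates sum
      to 16.\<close>
    then have c16: "(\<Sum>i<24. c i * c i) = 16" using x2 comb_inner[of c c] by (simp flip: of_int_mult of_int_sum)
    have R: "(leech_rows ! j ! i - leech_rows ! j ! 0) mod 2 = 0" "((\<Sum>i<24. leech_rows ! j ! i) - 4 * leech_rows ! j ! 0) mod 8 = 0"
      "g < 12 \<Longrightarrow> idot (golay_checks ! g) (leech_rows ! j) mod 4 = 0" if "j < 24" "i < 24" for i j g
    proof -
      have "leech_rows ! j \<in> set leech_rows" using that leech_table_lengths by simp
      then have *: "list_all (\<lambda>x. (x - hd (leech_rows ! j)) mod 2 = 0) (leech_rows ! j) \<and> (sum_list (leech_rows ! j) - 4 * hd (leech_rows ! j)) mod 8 = 0 \<and>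
        list_all (\<lambda>g. idot g (leech_rows ! j) mod 4 = 0) golay_checks"
        using leech_rows_congruences unfolding list_all_iff by blast
      have hd: "hd (leech_rows ! j) = leech_rows ! j ! 0" using lenB(1)[OF that(1)] by (intro hd_conv_nth) auto
      show "(leech_rows ! j ! i - leech_rows ! j ! 0) mod 2 = 0"
        using * that lenB(1)[OF that(1)] by (simp add: hd list_all_length)
      show "((\<Sum>i<24. leech_rows ! j ! i) - 4 * leech_rows ! j ! 0) mod 8 = 0"
        using * lenB(1)[OF that(1)] by (simp add: hd sum_list_sum_nth atLeast0LessThan)
      show "g < 12 \<Longrightarrow> idot (golay_checks ! g) (leech_rows ! j) mod 4 = 0"
        using * by (simp add: list_all_length leech_table_lengths)
    qed
    have par: "2 dvd c i - c 0" if "i < 24" for i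
    proof -
      have "c i - c 0 = (\<Sum>j<24. k j * (leech_rows ! j ! i - leech_rows ! j ! 0))"
        by (simp add: c_def right_diff_distrib sum_subtractf)
      also have "2 dvd \<dots>" 
      proof (intro dvd_sum dvd_mult)
        fix j assume "j \<in> {..<24::nat}"
        then show "2 dvd leech_rows ! j ! i - leech_rows ! j ! 0" using R(1)[of j i] that by (simp add: mod_eq_0_iff_dvd)
      qed
      finally show ?thesis .
    qed
    have tot: "8 dvd (\<Sum>i<24. c i) - 4 * c 0"
    proof -
      have "(\<Sum>i<24. c i) - 4 * c 0 = (\<Sum>j<24. k j * ((\<Sum>i<24. leech_rows ! j ! i) - 4 * leech_rows ! j ! 0))"
        unfolding c_def by (subst sum.swap) (simp add: sum_distrib_left right_diff_distrib sum_subtractf mult_ac)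
      also have "8 dvd \<dots>" 
      proof (intro dvd_sum dvd_mult)
        fix j assume "j \<in> {..<24::nat}"
        then show "8 dvd (\<Sum>i<24. leech_rows ! j ! i) - 4 * leech_rows ! j ! 0" using R(2)[of j 0] by (simp add: mod_eq_0_iff_dvd)
      qed
      finally show ?thesis .
    qed
    have chk: "4 dvd (\<Sum>i<24. golay_checks ! g ! i * c i)" if "g < 12" for g
    proof -
      have "(\<Sum>i<24. golay_checks ! g ! i * c i) = (\<Sum>j<24. k j * idot (golay_checks ! g) (leech_rows ! j))"
        unfolding c_def sum_distrib_left
        by (subst sum.swap) (intro sum.cong refl, simp add: idot_sum[OF lenG[OF that] lenB(1)] sum_distrib_left mult_ac)
      also have "4 dvd \<dots>" 
      proof (intro dvd_sum dvd_mult)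
        fix j assume "j \<in> {..<24::nat}"
        then show "4 dvd idot (golay_checks ! g) (leech_rows ! j)" using R(3)[of j 0 g] that by (simp add: mod_eq_0_iff_dvd)
      qed
      finally show ?thesis .
    qed
    \<comment> \<open>Otherwise all 24 coordinates are odd, hence nonzero, and their squares sum to
      at least 24.\<close>
    have c0: "even (c 0)"
    proof (rule ccontr)
      assume "odd (c 0)"
      then have "odd (c i)" if "i < 24" for i using par[OF that] by presburger
      then have "c i \<noteq> 0" if "i < 24" for i using that by fastforce
      then have "c i * c i \<ge> 1" if "i < 24" for i using that by (metis int_one_le_iff_zero_less mult_eq_0_iff not_real_square_gt_zero zero_le_square order_le_imp_less_or_eq)
      then have "(\<Sum>i<24::nat. (1::int)) \<le> (\<Sum>i<24. c i * c i)" by (intro sum_mono) auto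
      then show False using c16 by simp
    qed
    have "\<exists>d. c i = 2 * d" if "i < 24" for i using par[OF that] c0 by presburger
    then obtain d where d: "\<And>i. i < 24 \<Longrightarrow> c i = 2 * d i" by metis
    have d4: "(\<Sum>i<24. d i * d i) = 4"
    proof -
      have "(\<Sum>i<24. c i * c i) = 4 * (\<Sum>i<24. d i * d i)"
        unfolding sum_distrib_left by (intro sum.cong refl) (simp add: d)
      then show ?thesis using c16 by simp
    qed
    \<comment> \<open>The odd entries of \<open>d\<close> form a word satisfying the Golay checks.
      Its weight is at most 4, as the squares sum to 4, so it is zero.\<close>
    have deven: "\<not> odd (d i)" if "i < 24" for i
    proof (rule golay_parity[of "\<lambda>i. odd (d i)"])
      fix g :: nat assume g: "g < 12"
      have "(\<Sum>i<24. golay_checks ! g ! i * c i) = 2 * (\<Sum>i<24. golay_checks ! g ! i * d i)"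
        unfolding sum_distrib_left by (intro sum.cong refl) (simp add: d)
      then have "even (\<Sum>i<24. golay_checks ! g ! i * d i)" using chk[OF g] by presburger
      then have "even (card {i\<in>{..<24}. odd (golay_checks ! g ! i * d i)})" by (subst (asm) even_sum_iff) auto
      moreover have "{i\<in>{..<24}. odd (golay_checks ! g ! i * d i)} = {i\<in>{..<24}. golay_checks ! g ! i = 1 \<and> odd (d i)}"
      proof -
        have "golay_checks ! g ! i \<in> {0, 1}" if "i < 24" for i
          using golay_binary g that lenG[OF g] leech_table_lengths(7) by (auto simp: list_all_length)
        then show ?thesis by fastforce
      qed
      ultimately show "even (card {i\<in>{..<24}. golay_checks ! g ! i = 1 \<and> odd (d i)})" by simp
    next
      have "int (card {i\<in>{..<24}. odd (d i)}) = (\<Sum>i\<in>{i\<in>{..<24}. odd (d i)}. 1)" by simp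
      also have "\<dots> \<le> (\<Sum>i\<in>{i\<in>{..<24}. odd (d i)}. d i * d i)"
      proof (rule sum_mono)
        fix i assume "i \<in> {i\<in>{..<24}. odd (d i)}"
        then have "d i \<noteq> 0" by auto
        then have "d i * d i > 0" by (auto simp: zero_less_mult_iff linorder_neq_iff)
        then show "1 \<le> d i * d i" by simp
      qed
      also have "\<dots> \<le> (\<Sum>i<24. d i * d i)" by (intro sum_mono2) auto
      finally show "card {i\<in>{..<24}. odd (d i)} \<le> 4" using d4 by simp
    qed (rule that)
    have "\<exists>f. d i = 2 * f" if "i < 24" for i using deven[OF that] by auto
    then obtain f where f: "\<And>i. i < 24 \<Longrightarrow> d i = 2 * f i" by metis
    have "(\<Sum>i<24. d i * d i) = 4 * (\<Sum>i<24. f i * f i)"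
      unfolding sum_distrib_left by (intro sum.cong refl) (simp add: f)
    then have f1: "(\<Sum>i<24. f i * f i) = 1" using d4 by simp
    \<comment> \<open>The sum of \<open>f\<close> has the parity of the sum of squares, which is 1;
      the congruence modulo 8 for the coordinate sum of \<open>c\<close> makes it even.\<close>
    have "even (\<Sum>i<24. f i * f i - f i)" by (intro dvd_sum) simp
    then have fodd: "odd (\<Sum>i<24. f i)" using f1 by (simp add: sum_subtractf)
    have "(\<Sum>i<24. c i) = 4 * (\<Sum>i<24. f i)"
      unfolding sum_distrib_left by (intro sum.cong refl) (simp add: d f)
    moreover have "c 0 = 4 * f 0" by (simp add: d f)
    ultimately have "8 dvd 4 * (\<Sum>i<24. f i) - 16 * f 0" using tot by simp
    then obtain q where "4 * (\<Sum>i<24. f i) - 16 * f 0 = 8 * q" by (elim dvdE)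
    then have "(\<Sum>i<24. f i) = 2 * (q + 2 * f 0)" by simp
    then show False using fodd by simp
  qed
  have min: "x \<bullet> x \<ge> 4" if "x \<in> \<Lambda> - {0}" for x
  proof -
    have "x \<in> \<Lambda>" using that by simp
    then obtain q :: int where q: "x \<bullet> x = 2 * of_int q" using even by blast
    have "x \<bullet> x > 0" using that by simp
    then have "q > 0" using q by simp
    moreover have "q \<noteq> 1" using no_roots[of x] that q by auto
    ultimately have "q \<ge> 2" by simp
    then show ?thesis using q by simp
  qed
  have b0: "b 0 \<in> \<Lambda>" "b 0 \<bullet> b 0 = 4"
    using bmem[of 0] leech_special_vectors(1) by (simp_all add: bb)
  define kW :: "nat \<Rightarrow> int" where "kW i = (if i = 0 then 1 else if i = 1 then -1 else if i = 2 then 1 else 0)" for i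
  define W where "W = (\<Sum>j<24. of_int (kW j) *\<^sub>R b j)"
  have Wc: "W = comb (\<lambda>i. leech_rows ! 0 ! i - leech_rows ! 1 ! i + leech_rows ! 2 ! i)"
  proof -
    have "{..<24} = {0, 1, 2} \<union> {3..<24::nat}" by auto
    then have "(\<Sum>j<24. kW j * leech_rows ! j ! i) = leech_rows ! 0 ! i - leech_rows ! 1 ! i + leech_rows ! 2 ! i" for i
      by (simp add: sum.union_disjoint kW_def)
    then show ?thesis unfolding W_def b_def comb_sum by simp
  qed
  have "W \<bullet> W = 6"
  proof -
    define w where "w = map2 (+) (map2 (-) (leech_rows ! 0) (leech_rows ! 1)) (leech_rows ! 2)"
    have lw: "length w = 24" by (simp add: w_def lenB)
    have "W = comb (\<lambda>i. w ! i)" unfolding Wc comb_def by (intro sum.cong refl) (simp add: w_def lenB)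
    then have "W \<bullet> W = of_int (\<Sum>i<24. w ! i * w ! i) / 8" by (simp only: comb_inner)
    moreover have "idot w w = 48" using leech_special_vectors(2) by (simp only: w_def)
    then have "(\<Sum>i<24. w ! i * w ! i) = 48" by (simp only: idot_sum[OF lw lw])
    ultimately show ?thesis by simp
  qed
  moreover have "leech_lattice \<Lambda>"
    unfolding leech_lattice_def even_unimodular_lattice_def using full dual even min b0 by blast
  moreover have "W \<in> \<Lambda>" unfolding W_def by (rule mem)
  ultimately show ?thesis using that by blast
qed

section \<open>Optimality\<close>

lemma finite_nodes: "finite (node ` {..<5})" "node ` {..<5} = {-13/23, -7/23, -1/23, 5/23, 11/23}"
  by (auto simp: lessThan_lit node_simps)

lemma node_inj5: "inj_on node {..<5}"
  by (rule inj_on_subset[OF node_inj]) auto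

lemma sum_over_nodes:
  fixes g :: "real \<Rightarrow> real"
  assumes "finite A" "f ` A \<subseteq> node ` {..<5}"
  shows "(\<Sum>y\<in>A. g (f y)) = (\<Sum>i<5. real (card {y\<in>A. f y = node i}) * g (node i))"
  using sum_by_values[OF assms(1) finite_nodes(1) assms(2), of g "\<lambda>_. 1"]
  by (simp add: sum.reindex[OF node_inj5] mult.commute)

lemma energy_from_distribution:
  fixes C :: "(real ^ 23) set"
  assumes "finite C" "card C = 48600"
    and ip: "\<And>x y. x \<in> C \<Longrightarrow> y \<in> C - {x} \<Longrightarrow> x \<bullet> y \<in> node ` {..<5}"
    and dist: "\<And>x i. x \<in> C \<Longrightarrow> i < 5 \<Longrightarrow> real (card {y \<in> C - {x}. x \<bullet> y = node i}) = slice_dist i"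
  shows "energy h C = 48600 * slice_sum h"
proof -
  have "(\<Sum>y\<in>C - {x}. h (x \<bullet> y)) = slice_sum h" if x: "x \<in> C" for x
  proof -
    have "(\<Sum>y\<in>C - {x}. h (x \<bullet> y)) = (\<Sum>i<5. real (card {y\<in>C - {x}. x \<bullet> y = node i}) * h (node i))"
      using assms(1) ip[OF x] by (intro sum_over_nodes) auto
    also have "\<dots> = slice_sum h" unfolding slice_sum_def using dist[OF x] by (intro sum.cong refl) auto
    finally show ?thesis .
  qed
  then show ?thesis using assms(2) by (simp add: energy_def)
qed

section \<open>Designs whose inner products are the five nodes\<close>

lemma node_moments_zero:
  fixes D :: "nat \<Rightarrow> real"
  assumes "\<And>k. k \<le> 4 \<Longrightarrow> (\<Sum>i<5. D i * node i ^ k) = 0"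
  shows "i < 5 \<Longrightarrow> D i = 0"
proof -
  have e: "D 0 + D 1 + D 2 + D 3 + D 4 = 0"
    "-13/23 * D 0 + -7/23 * D 1 + -1/23 * D 2 + 5/23 * D 3 + 11/23 * D 4 = 0"
    "169/529 * D 0 + 49/529 * D 1 + 1/529 * D 2 + 25/529 * D 3 + 121/529 * D 4 = 0"
    "-2197/12167 * D 0 + -343/12167 * D 1 + -1/12167 * D 2 + 125/12167 * D 3 + 1331/12167 * D 4 = 0"
    "28561/279841 * D 0 + 2401/279841 * D 1 + 1/279841 * D 2 + 625/279841 * D 3 + 14641/279841 * D 4 = 0"
    using assms[of 0] assms[of 1] assms[of 2] assms[of 3] assms[of 4]
    by (simp_all add: lessThan_lit node_simps power_divide)
  have "D 0 = 0" "D 1 = 0" "D 2 = 0" "D 3 = 0" "D 4 = 0" using e by linarith+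
  moreover assume "i < 5"
  then have "i \<in> {0, 1, 2, 3, 4}" by auto
  ultimately show "D i = 0" by auto
qed

text \<open>Up to degree 4 the design property equates power sums of inner products with a point to
  spherical averages, which depend only on the length of that point. Five power sums determine the
  five counts, by the Vandermonde system at the nodes.\<close>

theorem design_distance_invariant:
  fixes C :: "(real ^ 23) set"
  assumes design: "spherical_design 5 C" and ip: "inner_products C = {-13/23, -7/23, -1/23, 5/23, 11/23}"
    and x: "x \<in> C" and x': "x' \<in> C" and i: "i < 5"
  shows "card {y \<in> C. x \<bullet> y = node i} = card {y \<in> C. x' \<bullet> y = node i}"
proof -
  have C: "finite C" "C \<subseteq> sphere 0 1" using design by (auto simp: spherical_design_def spherical_code_def)
  define N where "N z i = real (card {y \<in> C. z \<bullet> y = node i})" for z i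
  define I where "I k = (LINT u|sphere_measure. (x \<bullet> u) ^ k)" for k
  have mom: "1 + (\<Sum>i<5. N z i * node i ^ k) = real (card C) * I k" if z: "z \<in> C" and k: "k \<le> 4" for z k
  proof -
    have nz: "norm z = 1" "norm x = 1" using z x C(2) by auto
    have c0: "real (card C) \<noteq> 0" using z C(1) by auto
    have "(\<lambda>u. (z \<bullet> u) ^ k) \<in> polynomials_upto 5"
      using inner_power_polynomial[of z k] polynomials_upto_mono[of k 5] k by auto
    then have "(\<Sum>y\<in>C. (z \<bullet> y) ^ k) / real (card C) = (LINT u|sphere_measure. (z \<bullet> u) ^ k)"
      using design by (auto simp: spherical_design_def)
    also have "\<dots> = I k" unfolding I_def using nz by (intro sphere_measure_inner_integral) simp
    finally have "(\<Sum>y\<in>C. (z \<bullet> y) ^ k) = real (card C) * I k" using c0 by (simp add: field_simps)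
    moreover have "(\<Sum>y\<in>C. (z \<bullet> y) ^ k) = 1 + (\<Sum>y\<in>C - {z}. (z \<bullet> y) ^ k)"
      using sum.remove[OF C(1) z, of "\<lambda>y. (z \<bullet> y) ^ k"] nz by (simp add: norm_eq_1)
    moreover have "(\<Sum>y\<in>C - {z}. (z \<bullet> y) ^ k) = (\<Sum>i<5. N z i * node i ^ k)"
    proof -
      have "(\<lambda>y. z \<bullet> y) ` (C - {z}) \<subseteq> node ` {..<5}"
        unfolding finite_nodes(2) ip[symmetric] using z by (auto simp: inner_products_def)
      moreover have "{y \<in> C - {z}. z \<bullet> y = node i} = {y \<in> C. z \<bullet> y = node i}" if "i < 5" for i
        using node_bounds[of i] that nz by (auto simp: norm_eq_1)
      ultimately show ?thesis using sum_over_nodes[of "C - {z}" "\<lambda>y. z \<bullet> y" "\<lambda>t. t ^ k"] C(1) by (simp add: N_def)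
    qed
    ultimately show ?thesis by simp
  qed
  have "N x i - N x' i = 0"
  proof (rule node_moments_zero[OF _ i])
    fix k :: nat assume "k \<le> 4"
    from mom[OF x this] mom[OF x' this] show "(\<Sum>i<5. (N x i - N x' i) * node i ^ k) = 0"
      by (simp add: left_diff_distrib sum_subtractf)
  qed
  then show ?thesis by (simp add: N_def)
qed

lemma design_energy:
  fixes C :: "(real ^ 23) set"
  assumes design: "spherical_design 5 C" and ip: "inner_products C = {-13/23, -7/23, -1/23, 5/23, 11/23}"
    and card: "card C = 48600"
  shows "distance_invariant C"
    "distance_distribution C = [506, 8855, 23046, 14421, 1771] \<Longrightarrow> energy h C = 48600 * slice_sum h"
proof -
  have C: "finite C" "C \<subseteq> sphere 0 1" using design by (auto simp: spherical_design_def spherical_code_def)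
  have "C \<noteq> {}" using card by auto
  then obtain x0 where x0: "x0 \<in> C" by auto
  have const: "card {y \<in> C. x \<bullet> y = node i} = card {y \<in> C. x0 \<bullet> y = node i}" if "x \<in> C" "i < 5" for x i
    by (rule design_distance_invariant[OF design ip that(1) x0 that(2)])
  show "distance_invariant C"
    unfolding distance_invariant_def ip finite_nodes(2)[symmetric]
  proof
    fix t assume "t \<in> node ` {..<5}"
    then obtain i where i: "i < 5" "t = node i" by auto
    show "\<exists>A. \<forall>x\<in>C. card {y \<in> C. x \<bullet> y = t} = A"
      unfolding i(2) using const[OF _ i(1)] by (intro exI[of _ "card {y \<in> C. x0 \<bullet> y = node i}"] ballI)
  qed
  assume dd: "distance_distribution C = [506, 8855, 23046, 14421, 1771]"
  \<comment> \<open>Distance invariance makes each description in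
    \<open>distance_distribution\<close> denote the count at the single point
    \<open>x0\<close>.\<close>
  have the: "(THE A. \<forall>x\<in>C. card {y \<in> C. x \<bullet> y = node i} = A) = card {y \<in> C. x0 \<bullet> y = node i}" if "i < 5" for i
  proof (rule the_equality)
    show "\<forall>x\<in>C. card {y \<in> C. x \<bullet> y = node i} = card {y \<in> C. x0 \<bullet> y = node i}"
      by (intro ballI const that)
    fix A assume "\<forall>x\<in>C. card {y \<in> C. x \<bullet> y = node i} = A"
    from bspec[OF this x0] show "A = card {y \<in> C. x0 \<bullet> y = node i}" by (rule sym)
  qed
  have sl: "sorted_list_of_set {-13/23, -7/23, -1/23, 5/23, 11/23::real} = [-13/23, -7/23, -1/23, 5/23, 11/23]"
    by (rule sorted_distinct_set_unique) auto
  have "[card {y \<in> C. x0 \<bullet> y = node 0}, card {y \<in> C. x0 \<bullet> y = node 1}, card {y \<in> C. x0 \<bullet> y = node 2},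
     card {y \<in> C. x0 \<bullet> y = node 3}, card {y \<in> C. x0 \<bullet> y = node 4}] = [506, 8855, 23046, 14421, 1771]"
    using dd the[of 0] the[of 1] the[of 2] the[of 3] the[of 4]
    unfolding distance_distribution_def ip sl by (simp add: node_simps)
  then have cd: "real (card {y \<in> C. x0 \<bullet> y = node i}) = slice_dist i" if "i < 5" for i
  proof -
    have "i \<in> {0, 1, 2, 3, 4}" using that by auto
    moreover assume "[card {y \<in> C. x0 \<bullet> y = node 0}, card {y \<in> C. x0 \<bullet> y = node 1}, card {y \<in> C. x0 \<bullet> y = node 2},
      card {y \<in> C. x0 \<bullet> y = node 3}, card {y \<in> C. x0 \<bullet> y = node 4}] = [506, 8855, 23046, 14421, 1771]"
    ultimately show ?thesis by (auto simp: slice_dist_def)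
  qed
  show "energy h C = 48600 * slice_sum h"
  proof (rule energy_from_distribution[OF C(1) card])
    fix x assume x: "x \<in> C"
    then have nx: "x \<bullet> x = 1" using C(2) by (auto simp: norm_eq_1)
    show "x \<bullet> y \<in> node ` {..<5}" if "y \<in> C - {x}" for y
      unfolding finite_nodes(2) ip[symmetric] using that x by (auto simp: inner_products_def)
    show "real (card {y \<in> C - {x}. x \<bullet> y = node i}) = slice_dist i" if "i < 5" for i
    proof -
      have "{y \<in> C - {x}. x \<bullet> y = node i} = {y \<in> C. x \<bullet> y = node i}"
        using node_bounds[of i] that nx by auto
      then show ?thesis using const[OF x that] cd[OF that] by simp
    qed
  qed
qed

section \<open>From a Leech lattice to the spherical code\<close>

lemma leech_lattice_rootless:
  assumes L: "leech_lattice \<Lambda>" and W: "W \<in> \<Lambda>" "W \<bullet> W = 6"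
  shows "rootless_lattice_slice \<Lambda> W"
proof -
  have full: "full_rank_lattice \<Lambda>" and dual: "dual_lattice \<Lambda> = \<Lambda>"
    and even: "\<And>x. x \<in> \<Lambda> \<Longrightarrow> \<exists>k::int. x \<bullet> x = 2 * of_int k"
    and min: "\<And>x. x \<in> \<Lambda> - {0} \<Longrightarrow> x \<bullet> x \<ge> 4" and ex: "\<exists>x\<in>\<Lambda>. x \<bullet> x = 4"
    using L by (auto simp: leech_lattice_def even_unimodular_lattice_def)
  have memI: "x \<in> \<Lambda>" if "\<And>y. y \<in> \<Lambda> \<Longrightarrow> x \<bullet> y \<in> \<int>" for x
    using that dual by (auto simp: dual_lattice_def)
  have memD: "x \<bullet> y \<in> \<int>" if "x \<in> \<Lambda>" "y \<in> \<Lambda>" for x y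
    using that dual by (auto simp: dual_lattice_def)
  have span: "span \<Lambda> = UNIV"
  proof -
    obtain B where B: "independent B" "span B = UNIV"
      "\<Lambda> = {(\<Sum>b\<in>B. of_int (c b) *\<^sub>R b) | c :: real ^ 24 \<Rightarrow> int. True}"
      using full unfolding full_rank_lattice_def by blast
    have fB: "finite B" using B(1) independent_bound by blast
    have "b \<in> \<Lambda>" if "b \<in> B" for b
    proof -
      have "b = (\<Sum>v\<in>B. of_int (if v = b then 1 else 0) *\<^sub>R v)"
      proof -
        have "(\<Sum>v\<in>B. of_int (if v = b then 1 else 0) *\<^sub>R v) = (\<Sum>v\<in>B. if v = b then b else 0)"
          by (intro sum.cong refl) simp
        then show ?thesis using that fB by simp
      qed
      then show ?thesis unfolding B(3) by (auto intro!: exI[of _ "\<lambda>v. if v = b then 1 else 0"])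
    qed
    then have "span B \<subseteq> span \<Lambda>" by (intro span_mono) auto
    then show ?thesis using B(2) by auto
  qed
  interpret rootless_lattice \<Lambda>
  proof
    show "0 \<in> \<Lambda>" by (rule memI) simp
    show "x + y \<in> \<Lambda>" if "x \<in> \<Lambda>" "y \<in> \<Lambda>" for x y
      by (rule memI) (use that in \<open>auto simp: inner_add_left intro!: Ints_add memD\<close>)
    show "- x \<in> \<Lambda>" if "x \<in> \<Lambda>" for x by (rule memI) (use that in \<open>auto intro!: memD\<close>)
  qed (use memI memD span even min in auto)
  show ?thesis
  proof
    show "minvecs \<noteq> {}" using ex by (auto simp: minvecs_iff)
  qed (use W in auto)
qed

text \<open>Projection and rescaling of slice vectors act on inner products by the affine map that
  takes \<open>t\<close> to \<open>(6 * t - 1) / 23\<close>. It sends -2, ..., 2 to the five nodes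
  and 4 to 1, so the counts in the slice are those of the code.\<close>

theorem slice_code_properties:
  fixes \<phi> :: "real ^ 23 \<Rightarrow> real ^ 24"
  assumes L: "leech_lattice \<Lambda>" and W: "W \<in> \<Lambda>" "norm W = sqrt 6" and \<phi>: "complement_isometry W \<phi>"
  defines "C \<equiv> \<phi> -` leech_slice_code \<Lambda> W"
  shows "spherical_code C" "card C = 48600" "inner_products C \<subseteq> node ` {..<5}" "energy h C = 48600 * slice_sum h"
proof -
  have W6: "W \<bullet> W = 6" using W(2) by (simp add: norm_eq_sqrt_inner)
  interpret rootless_lattice_slice \<Lambda> W by (rule leech_lattice_rootless[OF L W(1) W6])
  have lin: "linear \<phi>" and nrm: "\<And>x. norm (\<phi> x) = norm x" and rng: "range \<phi> = {v. v \<bullet> W = 0}"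
    using \<phi> by (auto simp: complement_isometry_def)
  have \<phi>_inner: "\<phi> x \<bullet> \<phi> y = x \<bullet> y" for x y
    using nrm[of "x + y"] nrm[of x] nrm[of y] dot_norm[of "\<phi> x" "\<phi> y"] dot_norm[of x y] linear_add[OF lin, of x y] by simp
  have inj: "inj \<phi>"
    using nrm by (intro linear_injective_0[OF lin, THEN iffD2]) (metis norm_eq_zero)
  \<comment> \<open>The length of \<open>y - W / 6\<close> for \<open>y\<close> in the slice, as
    \<open>4 - 1/6 = 23/6\<close>.\<close>
  define r where "r = sqrt (23/6)"
  have r: "r > 0" "r * r = 23/6" by (simp_all add: r_def)
  define p where "p y = (1 / r) *\<^sub>R (y - (1/6) *\<^sub>R W)" for y
  have slice_code: "leech_slice_code \<Lambda> W = p ` slice"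
  proof -
    have a: "(sqrt 6 / 12) *\<^sub>R (W /\<^sub>R sqrt 6) = (1/12) *\<^sub>R W" by simp
    have b: "1 - (sqrt 6 / 12)\<^sup>2 = 23/24" by (simp add: power_divide)
    have c: "(y /\<^sub>R 2) \<bullet> (W /\<^sub>R sqrt 6) = sqrt 6 / 12 \<longleftrightarrow> y \<bullet> W = 1" for y :: "real ^ 24"
    proof -
      have s6: "inverse (sqrt 6) = sqrt 6 / (6::real)" by (rule inverse_unique) simp
      have eq: "(y /\<^sub>R 2) \<bullet> (W /\<^sub>R sqrt 6) = (y \<bullet> W) * (sqrt 6 / 12)"
        unfolding inner_scaleR_left inner_scaleR_right s6 by simp
      show ?thesis unfolding eq by simp
    qed
    have s: "sqrt (23/24) = r / 2"
    proof (rule real_sqrt_unique)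
      show "(r / 2)\<^sup>2 = 23 / 24" using r by (simp add: power2_eq_square)
    qed (use r in simp)
    have d: "(y /\<^sub>R 2 - (1/12) *\<^sub>R W) /\<^sub>R sqrt (23/24) = p y" for y
    proof -
      have eq: "y /\<^sub>R 2 - (1/12) *\<^sub>R W = (1/2) *\<^sub>R (y - (1/6) *\<^sub>R W)" by (simp add: scaleR_diff_right)
      have "inverse (r / 2) * (1/2) = 1 / r" using r by simp
      then show ?thesis unfolding p_def s eq scaleR_scaleR by simp
    qed
    have n: "norm x = 2 \<longleftrightarrow> x \<bullet> x = 4" for x :: "real ^ 24"
      unfolding dot_square_norm using power2_eq_iff_nonneg[of "norm x" 2] by simp
    have k: "leech_kissing_code \<Lambda> = (\<lambda>x. x /\<^sub>R 2) ` minvecs"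
      unfolding leech_kissing_code_def by (auto simp: n minvecs_iff)
    have img: "{F y |y. y \<in> G ` M \<and> P y} = (\<lambda>x. F (G x)) ` {x \<in> M. P (G x)}"
      for F :: "real ^ 24 \<Rightarrow> real ^ 24" and G :: "real ^ 24 \<Rightarrow> real ^ 24" and M P
      by blast
    show ?thesis
      unfolding leech_slice_code_def Let_def a b k img d c slice_def ..
  qed
  have pin: "p y \<bullet> p y' = (6 * (y \<bullet> y') - 1) / 23" if "y \<in> slice" "y' \<in> slice" for y y'
  proof -
    have "y \<bullet> W = 1" "W \<bullet> y' = 1" using that by (auto simp: slice_def inner_commute[of W y'])
    then have "(y - (1/6) *\<^sub>R W) \<bullet> (y' - (1/6) *\<^sub>R W) = y \<bullet> y' - 1/6"
      using W6 by (simp add: inner_diff_left inner_diff_right)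
    then have "p y \<bullet> p y' = (y \<bullet> y' - 1/6) / (r * r)"
      unfolding p_def inner_scaleR_left inner_scaleR_right by simp
    then show ?thesis unfolding r(2) by simp
  qed
  have injp: "inj_on p slice" using r by (auto simp: inj_on_def p_def)
  have "p ` slice \<subseteq> range \<phi>"
    unfolding rng using W6 by (auto simp: slice_def p_def inner_diff_left)
  then have im: "\<phi> ` C = p ` slice" unfolding C_def slice_code by (simp add: image_vimage_eq Int_absorb2)
  define g where "g y = inv \<phi> (p y)" for y
  have \<phi>g: "\<phi> (g y) = p y" if "y \<in> slice" for y
    unfolding g_def using \<open>p ` slice \<subseteq> range \<phi>\<close> that by (intro f_inv_into_f) auto
  have bij: "bij_betw g slice C"
  proof -
    have "inj_on g slice" using injp \<phi>g unfolding inj_on_def by metis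
    moreover have "g ` slice = C"
    proof
      show "g ` slice \<subseteq> C" using \<phi>g by (auto simp: C_def slice_code)
      show "C \<subseteq> g ` slice"
      proof
        fix x assume "x \<in> C"
        then obtain y where y: "y \<in> slice" "\<phi> x = p y" using im by blast
        then have "g y = x" using inj unfolding g_def by (metis inv_f_f)
        then show "x \<in> g ` slice" using y by auto
      qed
    qed
    ultimately show ?thesis by (simp add: bij_betw_def)
  qed
  have gin: "g y \<bullet> g y' = (6 * (y \<bullet> y') - 1) / 23" if "y \<in> slice" "y' \<in> slice" for y y'
    using pin[OF that] \<phi>_inner[of "g y" "g y'"] \<phi>g that by simp
  have finS: "finite slice" unfolding slice_def using finite_shell' by auto
  have finC: "finite C" using bij finS bij_betw_finite by blast
  have CE: "\<exists>y\<in>slice. x = g y" if "x \<in> C" for x using bij that by (auto simp: bij_betw_def)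
  have slice4: "y \<bullet> y = 4" if "y \<in> slice" for y using that by (auto simp: slice_def minvecs_iff)
  show sc: "spherical_code C"
    unfolding spherical_code_def
  proof (intro conjI subsetI finC)
    fix x assume "x \<in> C"
    then obtain y where "y \<in> slice" "x = g y" using CE by blast
    then show "x \<in> sphere 0 1" using gin[of y y] slice4[of y] by (simp add: norm_eq_1)
  qed
  have "real (card slice) = 48600" using slice_moments(1)[of 0] by simp
  then have cS: "card slice = 48600" by linarith
  show cC: "card C = 48600" using bij_betw_same_card[OF bij] cS by simp
  have ne: "g y \<noteq> g y' \<longleftrightarrow> y \<noteq> y'" if "y \<in> slice" "y' \<in> slice" for y y'
    using bij that by (auto simp: bij_betw_def inj_on_def)
  define val where "val i = [-2, -1, 0, 1, 2 :: real] ! i" for i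
  have valn: "(6 * t - 1) / 23 = node i \<longleftrightarrow> t = val i" if "i < 5" for t i
  proof -
    have "i \<in> {0, 1, 2, 3, 4}" using that by auto
    then show ?thesis by (auto simp: val_def node_simps)
  qed
  have ip: "x \<bullet> y \<in> node ` {..<5}" if x: "x \<in> C" and y: "y \<in> C - {x}" for x y
  proof -
    obtain a b where ab: "a \<in> slice" "x = g a" "b \<in> slice" "y = g b" using CE x y by (metis DiffD1)
    then have "a \<noteq> b" using y by auto
    then have "b \<bullet> a \<in> {-2, -1, 0, 1, 2}" using slice_distribution(6)[OF ab(1)] ab(3) by auto
    then have "\<exists>i<5. a \<bullet> b = val i"
      by (auto simp: val_def inner_commute intro: exI[of _ 0] exI[of _ 1] exI[of _ 2] exI[of _ 3] exI[of _ 4])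
    then obtain i where "i < 5" "x \<bullet> y = node i" using gin[OF ab(1,3)] ab valn by auto
    then show ?thesis by auto
  qed
  then show "inner_products C \<subseteq> node ` {..<5}" by (auto simp: inner_products_def)
  show "energy h C = 48600 * slice_sum h"
  proof (rule energy_from_distribution[OF finC cC ip])
    fix x i assume x: "x \<in> C" and i: "i < (5::nat)"
    obtain a where a: "a \<in> slice" "x = g a" using CE[OF x] by auto
    have "{y \<in> C - {x}. x \<bullet> y = node i} = g ` {y \<in> slice - {a}. y \<bullet> a = val i}"
    proof (intro set_eqI iffI)
      fix y assume y: "y \<in> {y \<in> C - {x}. x \<bullet> y = node i}"
      then obtain b where b: "b \<in> slice" "y = g b" using CE by auto
      then have "b \<in> slice - {a}" "b \<bullet> a = val i" using y a gin[OF a(1) b(1)] valn[OF i] by (auto simp: inner_commute)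
      then show "y \<in> g ` {y \<in> slice - {a}. y \<bullet> a = val i}" using b by auto
    next
      fix y assume "y \<in> g ` {y \<in> slice - {a}. y \<bullet> a = val i}"
      then obtain b where b: "b \<in> slice" "b \<noteq> a" "b \<bullet> a = val i" "y = g b" by auto
      moreover have "y \<in> C" using bij b by (auto simp: bij_betw_def)
      moreover have "x \<bullet> y = node i"
        using gin[OF a(1) b(1)] valn[OF i, of "a \<bullet> b"] b(3) a(2) b(4) by (simp add: inner_commute[of a b])
      ultimately show "y \<in> {y \<in> C - {x}. x \<bullet> y = node i}"
        using a ne[OF b(1) a(1)] by auto
    qed
    moreover have "inj_on g {y \<in> slice - {a}. y \<bullet> a = val i}"
      by (rule inj_on_subset[of g slice]) (use bij in \<open>auto simp: bij_betw_def\<close>)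
    ultimately have "card {y \<in> C - {x}. x \<bullet> y = node i} = card {y \<in> slice - {a}. y \<bullet> a = val i}"
      by (simp add: card_image)
    moreover have "real (card {y \<in> slice - {a}. y \<bullet> a = val i}) = slice_dist i"
    proof -
      have "i \<in> {0, 1, 2, 3, 4}" using i by auto
      then show ?thesis using slice_distribution[OF a(1)] by (auto simp: val_def slice_dist_def)
    qed
    ultimately show "real (card {y \<in> C - {x}. x \<bullet> y = node i}) = slice_dist i" by simp
  qed
qed

lemma complement_isometry_exists:
  assumes "W \<noteq> (0 :: real ^ 24)" obtains \<phi> where "complement_isometry W \<phi>"
proof -
  have s: "subspace {v :: real ^ 24. v \<bullet> W = 0}"
    using subspace_hyperplane[of W] by (simp add: inner_commute)
  have "dim {v :: real ^ 24. v \<bullet> W = 0} = 23"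
    using dim_hyperplane[OF assms] by (simp add: inner_commute)
  then have d: "dim (UNIV :: (real ^ 23) set) = dim {v :: real ^ 24. v \<bullet> W = 0}" by (simp add: dim_UNIV)
  obtain f g where "linear f" "f ` (UNIV :: (real ^ 23) set) = {v :: real ^ 24. v \<bullet> W = 0}"
    "\<And>x. x \<in> UNIV \<Longrightarrow> norm (f x) = norm x"
    using isometries_subspaces[OF subspace_UNIV s d] by metis
  then show ?thesis using that by (auto simp: complement_isometry_def)
qed

theorem theorem7p5:
  fixes T :: "real set"
  assumes "T \<in> {{-13/23<..<-7/23} \<union> {-1/23<..<5/23},
                {-13/23<..<-7/23} \<union> {5/23<..<11/23},
                {-7/23<..<-1/23} \<union> {5/23<..<11/23}}"
  shows
    "(\<forall>h. absolutely_monotone h \<and> (\<forall>t\<in>{-1<..<1}. (deriv ^^ 6) h t > 0) \<longrightarrow>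
        min_energy TYPE(real ^ 23) h 48600 T =
          48600 * (506 * h (-13/23) + 8855 * h (-7/23) + 23046 * h (-1/23)
                   + 14421 * h (5/23) + 1771 * h (11/23)) \<and>
        (\<exists>C\<in>avoiding_codes T 48600.
           energy h (C :: (real ^ 23) set) = min_energy TYPE(real ^ 23) h 48600 T) \<and>
        (\<forall>C\<in>avoiding_codes T 48600.
           energy h (C :: (real ^ 23) set) \<ge> min_energy TYPE(real ^ 23) h 48600 T \<and>
           (spherical_design 5 C \<and> inner_products C = {-13/23, -7/23, -1/23, 5/23, 11/23} \<longrightarrow>
              distance_invariant C \<and>
              (distance_distribution C = [506, 8855, 23046, 14421, 1771] \<longrightarrow>
                 energy h C = min_energy TYPE(real ^ 23) h 48600 T)))) \<and>
     (\<forall>\<Lambda> W \<phi>. leech_lattice \<Lambda> \<and> W \<in> \<Lambda> \<and> norm W = sqrt 6 \<and> complement_isometry W \<phi> \<longrightarrow>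
        universally_optimal T (\<phi> -` leech_slice_code \<Lambda> W))"
proof (intro conjI allI impI; (elim conjE)?)
  \<comment> \<open>The components of \<open>T\<close> are open, so the nodes at their endpoints are
    allowed inner products.\<close>
  have nodes_T: "node ` {..<5} \<inter> T = {}"
    using assms unfolding finite_nodes(2) by auto
  have slice_avoiding: "\<phi> -` leech_slice_code \<Lambda> W \<in> avoiding_codes T 48600"
    if "leech_lattice \<Lambda>" "W \<in> \<Lambda>" "norm W = sqrt 6" "complement_isometry W \<phi>" for \<Lambda> W \<phi>
    using slice_code_properties(1-3)[OF that] nodes_T by (auto simp: avoiding_codes_def avoiding_def)
  \<comment> \<open>The last claim concerns an arbitrary Leech lattice; a concrete one supplies the
    code that attains the minimum.\<close>
  obtain \<Lambda>0 W0 where L0: "leech_lattice \<Lambda>0" "W0 \<in> \<Lambda>0" "W0 \<bullet> W0 = 6" by (rule leech_lattice_exists)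
  then have nW0: "norm W0 = sqrt 6" and W0: "W0 \<noteq> 0" by (auto simp: norm_eq_sqrt_inner)
  obtain \<phi>0 where \<phi>0: "complement_isometry W0 \<phi>0" by (rule complement_isometry_exists[OF W0])
  define C0 where "C0 = \<phi>0 -` leech_slice_code \<Lambda>0 W0"
  have C0: "C0 \<in> avoiding_codes T 48600" "\<And>h. energy h C0 = 48600 * slice_sum h"
    unfolding C0_def using slice_avoiding[OF L0(1,2) nW0 \<phi>0] slice_code_properties(4)[OF L0(1,2) nW0 \<phi>0] by auto
  have min: "min_energy TYPE(real ^ 23) h 48600 T = 48600 * slice_sum h" if h: "absolutely_monotone h" for h
    unfolding min_energy_def
  proof (rule Least_equality)
    show "48600 * slice_sum h \<in> energy h ` (avoiding_codes T 48600 :: (real ^ 23) set set)"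
      using C0 by (metis imageI)
    show "48600 * slice_sum h \<le> e" if "e \<in> energy h ` (avoiding_codes T 48600 :: (real ^ 23) set set)" for e
      using energy_lower_bound[OF assms h] that by auto
  qed
  {
    fix h assume h: "absolutely_monotone h"
    show "min_energy TYPE(real ^ 23) h 48600 T = 48600 * (506 * h (-13/23) + 8855 * h (-7/23) + 23046 * h (-1/23)
      + 14421 * h (5/23) + 1771 * h (11/23))"
      unfolding min[OF h] slice_sum_eq ..
    show "\<exists>C\<in>avoiding_codes T 48600. energy h (C :: (real ^ 23) set) = min_energy TYPE(real ^ 23) h 48600 T"
      using C0 min[OF h] by auto
    show "\<forall>C\<in>avoiding_codes T 48600.
       energy h (C :: (real ^ 23) set) \<ge> min_energy TYPE(real ^ 23) h 48600 T \<and>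
       (spherical_design 5 C \<and> inner_products C = {-13/23, -7/23, -1/23, 5/23, 11/23} \<longrightarrow>
          distance_invariant C \<and>
          (distance_distribution C = [506, 8855, 23046, 14421, 1771] \<longrightarrow>
             energy h C = min_energy TYPE(real ^ 23) h 48600 T))"
    proof (intro ballI conjI impI; (elim conjE)?)
      fix C :: "(real ^ 23) set" assume C: "C \<in> avoiding_codes T 48600"
      then have card: "card C = 48600" by (simp add: avoiding_codes_def)
      show "energy h C \<ge> min_energy TYPE(real ^ 23) h 48600 T"
        unfolding min[OF h] by (rule energy_lower_bound[OF assms h C])
      assume d: "spherical_design 5 C" "inner_products C = {-13/23, -7/23, -1/23, 5/23, 11/23}"
      show "distance_invariant C" by (rule design_energy(1)[OF d card])
      assume "distance_distribution C = [506, 8855, 23046, 14421, 1771]"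
      then show "energy h C = min_energy TYPE(real ^ 23) h 48600 T"
        unfolding min[OF h] by (rule design_energy(2)[OF d card])
    qed
  }
  fix \<Lambda> W \<phi>
  assume L: "leech_lattice \<Lambda>" "W \<in> \<Lambda>" "norm W = sqrt 6" "complement_isometry W \<phi>"
  show "universally_optimal T (\<phi> -` leech_slice_code \<Lambda> W)"
    unfolding universally_optimal_def
  proof (intro conjI allI impI ballI)
    show "spherical_code (\<phi> -` leech_slice_code \<Lambda> W)" "avoiding T (\<phi> -` leech_slice_code \<Lambda> W)"
      using slice_avoiding[OF L] by (auto simp: avoiding_codes_def)
    fix h and D :: "(real ^ 23) set"
    assume h: "absolutely_monotone h" and "D \<in> avoiding_codes T (card (\<phi> -` leech_slice_code \<Lambda> W))"
    then have "D \<in> avoiding_codes T 48600" using slice_code_properties(2)[OF L] by simp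
    from energy_lower_bound[OF assms h this]
    show "energy h (\<phi> -` leech_slice_code \<Lambda> W) \<le> energy h D"
      using slice_code_properties(4)[OF L, of h] by simp
  qed
qed

end
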